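(* Let $(\mathcal{M},g)$ be a compact Riemannian manifold of dimension $n\geq 2$, and let $\omega_N^*=\{x_1^*,\dots,x_N^*\}$ be a configuration of $N\geq 2$ distinct points minimizing the discrete Green energy $E_G$ on $\mathcal{M}$. Then, for every $i\neq j$, \[ x_i^*\notin B^h\left(x_j^*,\frac{V}{N-1}\right), \] where $V=\mathrm{vol}(\mathcal{M})$ is the volume of $\mathcal{M}$ and $B^h(p,a)$ denotes the harmonic ball with center $p$ and volume $a$ (defined for $0<a<V$; the statement is read under this standing assumption on $a=V/(N-1)$).
   Context: $\mathcal{M}$ is compact, connected and without boundary. The Laplacian has the sign convention $\Delta=-\frac{1}{\sqrt{|g|}}\partial_i\sqrt{|g|}g^{ij}\partial_j$. The Green's function $G(x,y)$ of $\mathcal{M}$ is the symmetric function, smooth off the diagonal, with $\Delta G(x,\cdot)=\delta_x-V^{-1}\mathrm{vol}$ in the sense of distributions (here $\mathrm{vol}$ is the Riemannian volume measure) and normalized by $\int_{\mathcal{M}}G(x,\cdot)=0$. Write $G^{\delta_p}(x)=G(p,x)$; one has $G^{\delta_p}(x)\to+\infty$ as $x\to p$, and $G^{\delta_p}(p)$ is understood as $+\infty$. The discrete Green energy of $N\geq 2$ distinct points is $E_G(x_1,\dots,x_N)=\sum_{i\neq j}G(x_i,x_j)$, and a minimizing configuration minimizes $E_G$ among all configurations of $N$ distinct points of $\mathcal{M}$. Harmonic balls: let $p\in\mathcal{M}$ and let $a$ be a real number with $0<a<V$. Put $\mathrm{t}_a=1-aV^{-1}$ and $\mathcal{K}_a=\{u\in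 W^{1,2}(\mathcal{M}):u\leq aG^{\delta_p}\}$, where $W^{1,2}(\mathcal{M})$ is the Sobolev space of square integrable functions with square integrable first weak derivatives. The functional $J_a(u)=\int_{\mathcal{M}}\left(\langle\nabla u,\nabla u\rangle-2\mathrm{t}_a u\right)$ has a unique minimizer $u_a$ in $\mathcal{K}_a$, and $u_a$ is continuous. The harmonic ball with center $p$ and volume $a$ is the set $B^h(p,a)=\{x\in\mathcal{M}:u_a(x)<aG^{\delta_p}(x)\}$. For $a=V/(N-1)$ the condition $0<a<V$ holds exactly when $N\geq 3$; for $N=2$ one has $a=V$, for which no harmonic ball is defined. *)

theory Defs
  imports "HOL-Analysis.Analysis"
begin

section \<open>Smooth functions on open subsets of a Euclidean space\<close>

text \<open>Meant for open \<open>S\<close> only.\<close>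

primrec Ck_on :: "nat \<Rightarrow> 'a::euclidean_space set \<Rightarrow> ('a \<Rightarrow> 'b::real_normed_vector) \<Rightarrow> bool" where
  "Ck_on 0 S f \<longleftrightarrow> continuous_on S f"
| "Ck_on (Suc k) S f \<longleftrightarrow>
     (\<forall>x\<in>S. f differentiable (at x)) \<and>
     (\<forall>b\<in>Basis. Ck_on k S (\<lambda>x. frechet_derivative f (at x) b))"

definition smooth_on :: "'a::euclidean_space set \<Rightarrow> ('a \<Rightarrow> 'b::real_normed_vector) \<Rightarrow> bool" where
  "smooth_on S f \<longleftrightarrow> (\<forall>k. Ck_on k S f)"

definition pderiv_i :: "'n::finite \<Rightarrow> (real^'n \<Rightarrow> real) \<Rightarrow> real^'n \<Rightarrow> real" where
  "pderiv_i i f y = frechet_derivative f (at y) (axis i 1)"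

definition test_function :: "(real^'n) set \<Rightarrow> (real^'n \<Rightarrow> real) \<Rightarrow> bool" where
  "test_function \<Omega> \<psi> \<longleftrightarrow>
     smooth_on UNIV \<psi> \<and> compact (closure {y. \<psi> y \<noteq> 0}) \<and> closure {y. \<psi> y \<noteq> 0} \<subseteq> \<Omega>"


section \<open>Smooth manifolds\<close>

text \<open>The manifold is the whole type \<open>'a\<close>. A chart is a pair of an open domain and a coordinate
  map into \<open>real^'n\<close>; the values of the coordinate map outside the domain are irrelevant.\<close>

type_synonym ('a, 'n) chart = "'a set \<times> ('a \<Rightarrow> real^'n)"

definition cimage :: "('a, 'n) chart \<Rightarrow> (real^'n) set" where
  "cimage c = snd c ` fst c"

definition cinv :: "('a, 'n) chart \<Rightarrow> real^'n \<Rightarrow> 'a" where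
  "cinv c = inv_into (fst c) (snd c)"

definition is_chart :: "('a::topological_space, 'n::finite) chart \<Rightarrow> bool" where
  "is_chart c \<longleftrightarrow> open (fst c) \<and> open (cimage c) \<and> homeomorphism (fst c) (cimage c) (snd c) (cinv c)"

definition smooth_atlas :: "('a::topological_space, 'n::finite) chart set \<Rightarrow> bool" where
  "smooth_atlas A \<longleftrightarrow>
     (\<forall>c\<in>A. is_chart c) \<and> (\<Union>c\<in>A. fst c) = UNIV \<and>
     (\<forall>c\<in>A. \<forall>d\<in>A. smooth_on (snd c ` (fst c \<inter> fst d)) (snd d \<circ> cinv c))"

definition smooth_fun :: "('a, 'n::finite) chart set \<Rightarrow> ('a \<Rightarrow> real) \<Rightarrow> bool" where
  "smooth_fun A f \<longleftrightarrow> (\<forall>c\<in>A. smooth_on (cimage c) (f \<circ> cinv c))"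

text \<open>Joint smoothness of a function of two points on the complement of the diagonal.\<close>

definition smooth_off_diagonal :: "('a, 'n::finite) chart set \<Rightarrow> ('a \<Rightarrow> 'a \<Rightarrow> real) \<Rightarrow> bool" where
  "smooth_off_diagonal A G \<longleftrightarrow>
     (\<forall>c\<in>A. \<forall>d\<in>A.
        smooth_on {(y, z). y \<in> cimage c \<and> z \<in> cimage d \<and> cinv c y \<noteq> cinv d z}
          (\<lambda>(y, z). G (cinv c y) (cinv d z)))"

text \<open>Jacobian matrix at \<open>x\<close> of the change of coordinates from \<open>c\<close> to \<open>d\<close>.\<close>

definition transition_jacobian :: "('a, 'n::finite) chart \<Rightarrow> ('a, 'n) chart \<Rightarrow> 'a \<Rightarrow> real^'n^'n" where
  "transition_jacobian c d x = jacobian (snd d \<circ> cinv c) (at (snd c x))"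

definition chart_at :: "('a, 'n) chart set \<Rightarrow> 'a \<Rightarrow> ('a, 'n) chart" where
  "chart_at A x = (SOME c. c \<in> A \<and> x \<in> fst c)"


section \<open>Riemannian metrics, volume, Laplacian\<close>

text \<open>A metric is given by its matrices \<open>g c x = (g\<^sub>i\<^sub>j)\<close> in the charts \<open>c\<close> of the atlas.\<close>

type_synonym ('a, 'n) metric_tensor = "('a, 'n) chart \<Rightarrow> 'a \<Rightarrow> real^'n^'n"

definition riemannian_metric ::
  "('a::topological_space, 'n::finite) chart set \<Rightarrow> ('a, 'n) metric_tensor \<Rightarrow> bool" where
  "riemannian_metric A g \<longleftrightarrow>
     (\<forall>c\<in>A. (\<forall>i j. smooth_on (cimage c) (\<lambda>y. g c (cinv c y) $ i $ j)) \<and>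
        (\<forall>x\<in>fst c. transpose (g c x) = g c x \<and> (\<forall>v. v \<noteq> 0 \<longrightarrow> 0 < v \<bullet> (g c x *v v)))) \<and>
     (\<forall>c\<in>A. \<forall>d\<in>A. \<forall>x\<in>fst c \<inter> fst d.
        g c x = transpose (transition_jacobian c d x) ** g d x ** transition_jacobian c d x)"

text \<open>Charts map onto open subsets of \<open>real^'n\<close>, so there is no boundary; the dimension is
  \<open>CARD('n)\<close>.\<close>

definition compact_connected_riemannian_manifold ::
  "('a::{t2_space, second_countable_topology}, 'n::finite) chart set \<Rightarrow> ('a, 'n) metric_tensor \<Rightarrow> bool"
  where
  "compact_connected_riemannian_manifold A g \<longleftrightarrow>
     compact (UNIV :: 'a set) \<and> connected (UNIV :: 'a set) \<and>
     smooth_atlas A \<and> riemannian_metric A g"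

text \<open>The density \<open>\<surd>|g|\<close> as a function of the coordinates.\<close>

definition vol_density :: "('a, 'n::finite) metric_tensor \<Rightarrow> ('a, 'n) chart \<Rightarrow> real^'n \<Rightarrow> real" where
  "vol_density g c y = sqrt (det (g c (cinv c y)))"

text \<open>The Riemannian volume is the unique Borel measure that reads \<open>\<surd>|g| dy\<close> in every chart.\<close>

definition riemannian_volume ::
  "('a::topological_space, 'n::finite) chart set \<Rightarrow> ('a, 'n) metric_tensor \<Rightarrow> 'a measure \<Rightarrow> bool" where
  "riemannian_volume A g vol \<longleftrightarrow>
     sets vol = sets borel \<and>
     (\<forall>c\<in>A. \<forall>B\<in>sets borel. B \<subseteq> fst c \<longrightarrow>
        emeasure vol B = (\<integral>\<^sup>+y. ennreal (vol_density g c y) * indicator (snd c ` B) y \<partial>lborel))"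

text \<open>\<open>\<Delta> f = - |g|\<^sup>-\<^sup>1\<^sup>/\<^sup>2 \<partial>\<^sub>i (|g|\<^sup>1\<^sup>/\<^sup>2 g\<^sup>i\<^sup>j \<partial>\<^sub>j f)\<close>; the value does not depend on
  the chart.\<close>

definition chart_laplacian ::
  "('a, 'n::finite) metric_tensor \<Rightarrow> ('a, 'n) chart \<Rightarrow> ('a \<Rightarrow> real) \<Rightarrow> 'a \<Rightarrow> real" where
  "chart_laplacian g c f x =
     - (1 / vol_density g c (snd c x)) *
       (\<Sum>i\<in>UNIV. pderiv_i i
          (\<lambda>y. vol_density g c y *
             (\<Sum>j\<in>UNIV. matrix_inv (g c (cinv c y)) $ i $ j * pderiv_i j (f \<circ> cinv c) y))
          (snd c x))"

definition laplacian ::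
  "('a, 'n::finite) chart set \<Rightarrow> ('a, 'n) metric_tensor \<Rightarrow> ('a \<Rightarrow> real) \<Rightarrow> 'a \<Rightarrow> real" where
  "laplacian A g f x = chart_laplacian g (chart_at A x) f x"


section \<open>The Green's function and the discrete Green energy\<close>

text \<open>The distributional equation \<open>\<Delta> G(x,\<cdot>) = \<delta>\<^sub>x - V\<^sup>-\<^sup>1 vol\<close> is tested against smooth functions.
  The real value \<open>G x x\<close> is unconstrained; see \<open>green_ext\<close>.\<close>

definition greens_function ::
  "('a::topological_space, 'n::finite) chart set \<Rightarrow> ('a, 'n) metric_tensor \<Rightarrow> 'a measure
     \<Rightarrow> ('a \<Rightarrow> 'a \<Rightarrow> real) \<Rightarrow> bool" where
  "greens_function A g vol G \<longleftrightarrow>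
     (\<forall>x y. G x y = G y x) \<and>
     smooth_off_diagonal A G \<and>
     (\<forall>x. integrable vol (G x)) \<and>
     (\<forall>x \<phi>. smooth_fun A \<phi> \<longrightarrow>
        (LINT y|vol. G x y * laplacian A g \<phi> y)
          = \<phi> x - (LINT y|vol. \<phi> y) / measure vol UNIV) \<and>
     (\<forall>x. (LINT y|vol. G x y) = 0)"

definition green_ext :: "('a \<Rightarrow> 'a \<Rightarrow> real) \<Rightarrow> 'a \<Rightarrow> 'a \<Rightarrow> ereal" where
  "green_ext G p x = (if x = p then \<infinity> else ereal (G p x))"

definition green_energy :: "('a \<Rightarrow> 'a \<Rightarrow> real) \<Rightarrow> nat \<Rightarrow> (nat \<Rightarrow> 'a) \<Rightarrow> real" where
  "green_energy G N x = (\<Sum>i\<in>{1..N}. \<Sum>j\<in>{1..N} - {i}. G (x i) (x j))"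

definition minimizing_configuration :: "('a \<Rightarrow> 'a \<Rightarrow> real) \<Rightarrow> nat \<Rightarrow> (nat \<Rightarrow> 'a) \<Rightarrow> bool" where
  "minimizing_configuration G N x \<longleftrightarrow>
     inj_on x {1..N} \<and> (\<forall>y. inj_on y {1..N} \<longrightarrow> green_energy G N x \<le> green_energy G N y)"


section \<open>The Sobolev space of square integrable functions with square integrable weak derivatives\<close>

text \<open>A covector field is given by its components in the charts, transforming pointwise.\<close>

type_synonym ('a, 'n) covector_field = "('a, 'n) chart \<Rightarrow> 'a \<Rightarrow> real^'n"

definition covector_field :: "('a, 'n::finite) chart set \<Rightarrow> ('a, 'n) covector_field \<Rightarrow> bool" where
  "covector_field A w \<longleftrightarrow>
     (\<forall>c\<in>A. \<forall>d\<in>A. \<forall>x\<in>fst c \<inter> fst d. w c x = transpose (transition_jacobian c d x) *v w d x)"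

definition locally_integrable :: "(real^'n) set \<Rightarrow> (real^'n \<Rightarrow> real) \<Rightarrow> bool" where
  "locally_integrable \<Omega> f \<longleftrightarrow> (\<forall>K. compact K \<and> K \<subseteq> \<Omega> \<longrightarrow> set_integrable lborel K f)"

definition weak_differential ::
  "('a, 'n::finite) chart set \<Rightarrow> ('a \<Rightarrow> real) \<Rightarrow> ('a, 'n) covector_field \<Rightarrow> bool" where
  "weak_differential A u w \<longleftrightarrow>
     covector_field A w \<and>
     (\<forall>c\<in>A. locally_integrable (cimage c) (u \<circ> cinv c) \<and>
        (\<forall>i. locally_integrable (cimage c) (\<lambda>y. w c (cinv c y) $ i) \<and>
          (\<forall>\<psi>. test_function (cimage c) \<psi> \<longrightarrow>
             (LINT y:cimage c|lborel. u (cinv c y) * pderiv_i i \<psi> y)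
               = - (LINT y:cimage c|lborel. w c (cinv c y) $ i * \<psi> y))))"

text \<open>\<open>g\<^sup>i\<^sup>j w\<^sub>i w\<^sub>j\<close>, which for \<open>w = du\<close> is \<open>\<langle>\<nabla>u, \<nabla>u\<rangle>\<close>; independent of the chart.\<close>

definition covector_norm2 ::
  "('a, 'n::finite) chart set \<Rightarrow> ('a, 'n) metric_tensor \<Rightarrow> ('a, 'n) covector_field \<Rightarrow> 'a \<Rightarrow> real" where
  "covector_norm2 A g w x =
     (let c = chart_at A x in w c x \<bullet> (matrix_inv (g c x) *v w c x))"

text \<open>Elements are functions rather than classes modulo null sets.\<close>

definition W12 ::
  "('a::topological_space, 'n::finite) chart set \<Rightarrow> ('a, 'n) metric_tensor \<Rightarrow> 'a measure
     \<Rightarrow> ('a \<Rightarrow> real) set" where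
  "W12 A g vol =
     {u. u \<in> borel_measurable vol \<and> integrable vol (\<lambda>x. (u x)\<^sup>2) \<and>
         (\<exists>w. weak_differential A u w \<and> integrable vol (covector_norm2 A g w))}"

text \<open>Weak differentials are unique almost everywhere, so the choice below does not affect
  integrals.\<close>

definition grad_norm2 ::
  "('a, 'n::finite) chart set \<Rightarrow> ('a, 'n) metric_tensor \<Rightarrow> ('a \<Rightarrow> real) \<Rightarrow> 'a \<Rightarrow> real" where
  "grad_norm2 A g u = covector_norm2 A g (SOME w. weak_differential A u w)"


section \<open>Harmonic balls\<close>

definition obstacle_class ::
  "('a::topological_space, 'n::finite) chart set \<Rightarrow> ('a, 'n) metric_tensor \<Rightarrow> 'a measure
     \<Rightarrow> ('a \<Rightarrow> 'a \<Rightarrow> real) \<Rightarrow> 'a \<Rightarrow> real \<Rightarrow> ('a \<Rightarrow> real) set" where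
  "obstacle_class A g vol G p a =
     {u \<in> W12 A g vol. AE x in vol. ereal (u x) \<le> ereal a * green_ext G p x}"

definition obstacle_functional ::
  "('a::topological_space, 'n::finite) chart set \<Rightarrow> ('a, 'n) metric_tensor \<Rightarrow> 'a measure
     \<Rightarrow> real \<Rightarrow> ('a \<Rightarrow> real) \<Rightarrow> real" where
  "obstacle_functional A g vol a u =
     (let t = 1 - a / measure vol UNIV in LINT x|vol. (grad_norm2 A g u x - 2 * t * u x))"

definition obstacle_solution ::
  "('a::topological_space, 'n::finite) chart set \<Rightarrow> ('a, 'n) metric_tensor \<Rightarrow> 'a measure
     \<Rightarrow> ('a \<Rightarrow> 'a \<Rightarrow> real) \<Rightarrow> 'a \<Rightarrow> real \<Rightarrow> ('a \<Rightarrow> real) \<Rightarrow> bool" where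
  "obstacle_solution A g vol G p a u \<longleftrightarrow>
     u \<in> obstacle_class A g vol G p a \<and> continuous_on UNIV u \<and>
     (\<forall>v\<in>obstacle_class A g vol G p a.
        obstacle_functional A g vol a u \<le> obstacle_functional A g vol a v)"

text \<open>For \<open>0 < a < V\<close> there is exactly one continuous minimizer \<open>u = u\<^sub>a\<close>, so the existential
  quantifier merely names it.\<close>

definition harmonic_ball ::
  "('a::topological_space, 'n::finite) chart set \<Rightarrow> ('a, 'n) metric_tensor \<Rightarrow> 'a measure
     \<Rightarrow> ('a \<Rightarrow> 'a \<Rightarrow> real) \<Rightarrow> 'a \<Rightarrow> real \<Rightarrow> 'a set" where
  "harmonic_ball A g vol G p a =
     {x. \<exists>u. obstacle_solution A g vol G p a u \<and> ereal (u x) < ereal a * green_ext G p x}"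

end

theory Submission
  imports Defs
begin

text \<open>Fix \<open>i \<noteq> j\<close> and let \<open>F\<close> be the sum of the \<open>G (x k)\<close> over \<open>k \<noteq> i\<close>. Since moving \<open>x i\<close> alone
  cannot decrease the energy, \<open>F \<ge> F (x i)\<close>; hence \<open>h = a F (x i) - a (sum over k \<noteq> i, j of G (x k))\<close> lies
  below the obstacle \<open>a G (x j)\<close>, with equality at \<open>x i\<close>, and \<open>\<Delta> h = t\<^sub>a\<close> away from its poles \<open>x k\<close>, because
  \<open>a (N - 2) / V = t\<^sub>a\<close>. If \<open>x i\<close> were in the harmonic ball, \<open>h - u\<close> would have a positive supremum \<open>M\<close>.
  Wherever \<open>h > u\<close> the obstacle is not touched, so there \<open>\<Delta> u = t\<^sub>a\<close>, and \<open>q = M - h + u \<ge> 0\<close> is a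
  distributional supersolution with point sources of mass \<open>a\<close> at the poles. By a weak Harnack
  inequality \<open>q\<close> is bounded away from \<open>0\<close> near the poles and its zero set is open, hence empty by
  connectedness. By compactness the supremum \<open>M\<close> is then not approached anywhere, a contradiction.

  The Harnack inequality is obtained by testing with explicit bumps \<open>F (Q + r\<^sup>2)\<close>, regularised and
  truncated fundamental solutions, so that it only uses the weak equation and the continuity of \<open>q\<close>.\<close>

section \<open>Differentiability classes and flat functions\<close>

text \<open>The minimizer \<open>u\<close> is known only as a continuous member of
  \<open>W12\<close>, so \<open>h - u\<close> need not be twice differentiable and the classical
  strong maximum principle does not apply. Hence the weak Harnack inequality, which asks only for an
  integrated inequality and for continuity at the point of evaluation. At the poles,
  \<open>greens_function\<close> records no growth of \<open>G\<close> on the diagonal. The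
  information there is the unit mass in the distributional equation, and the term
  \<open>\<Lambda>\<close> of the Harnack inequality turns this mass into a positive lower bound for
  \<open>q\<close>. The equation for \<open>u\<close> may fail at a pole where \<open>u\<close>
  touches the obstacle. But \<open>h\<close> lies below the obstacle around it, so
  \<open>h - u\<close> is at most \<open>M / 2\<close> near such a pole and the supremum is not
  approached. The condition \<open>a < V\<close> forces N >= 3, so at least one pole exists; this
  keeps the set where \<open>h - u\<close> attains \<open>M\<close> from being the whole
  manifold.\<close>

lemma frechet_derivative_cong_open:
  assumes "open S" "x \<in> S" "\<And>y. y \<in> S \<Longrightarrow> f y = g y"
  shows "frechet_derivative f (at x) = frechet_derivative g (at x)"
    and "f differentiable (at x) \<longleftrightarrow> g differentiable (at x)"
proof -
  have "(f has_derivative D) (at x) \<longleftrightarrow> (g has_derivative D) (at x)" for D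
    using assms has_derivative_transform_within_open[of f D x UNIV S g]
      has_derivative_transform_within_open[of g D x UNIV S f] by (metis)
  then show "frechet_derivative f (at x) = frechet_derivative g (at x)"
    and "f differentiable (at x) \<longleftrightarrow> g differentiable (at x)"
    by (simp_all add: frechet_derivative_def differentiable_def)
qed

lemma Ck_on_cong:
  assumes "open S" "\<And>x. x \<in> S \<Longrightarrow> f x = g x"
  shows "Ck_on k S f \<longleftrightarrow> Ck_on k S g"
  using assms(2)
proof (induction k arbitrary: f g)
  case 0
  then show ?case by (simp cong: continuous_on_cong)
next
  case (Suc k)
  have "frechet_derivative f (at x) = frechet_derivative g (at x)"
    "f differentiable (at x) \<longleftrightarrow> g differentiable (at x)" if "x \<in> S" for x
    using frechet_derivative_cong_open[OF assms(1) that, of f g] Suc.prems by blast+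
  then show ?case
    using Suc.IH[of "\<lambda>x. frechet_derivative f (at x) _" "\<lambda>x. frechet_derivative g (at x) _"] by simp
qed

lemma Ck_on_subset: "Ck_on k S f \<Longrightarrow> T \<subseteq> S \<Longrightarrow> Ck_on k T f"
  by (induction k arbitrary: f) (auto intro: continuous_on_subset)

lemma Ck_on_imp_continuous_on: "Ck_on k S f \<Longrightarrow> continuous_on S f"
  by (cases k) (auto intro: continuous_at_imp_continuous_on differentiable_imp_continuous_within)

lemma Ck_on_SucD: "Ck_on (Suc k) S f \<Longrightarrow> Ck_on k S f"
  by (induction k arbitrary: f)
    (auto intro: continuous_at_imp_continuous_on differentiable_imp_continuous_within)

lemma Ck_on_local:
  assumes "\<And>x. x \<in> S \<Longrightarrow> \<exists>T. open T \<and> x \<in> T \<and> Ck_on k T f"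
  shows "Ck_on k S f"
  using assms
proof (induction k arbitrary: f)
  case 0
  then show ?case
    by (auto intro!: continuous_at_imp_continuous_on simp: continuous_on_eq_continuous_at)
      (metis continuous_on_eq_continuous_at)
next
  case (Suc k)
  then have "f differentiable (at x)" if "x \<in> S" for x using that by (metis Ck_on.simps(2))
  moreover have "Ck_on k S (\<lambda>x. frechet_derivative f (at x) b)" if "b \<in> Basis" for b
    using Suc.prems that by (intro Suc.IH) (metis Ck_on.simps(2))
  ultimately show ?case by simp
qed

lemma Ck_on_const: "Ck_on k S (\<lambda>x. c)"
  by (induction k arbitrary: c) auto

lemma Ck_on_bounded_linear:
  assumes "bounded_linear f"
  shows "Ck_on k S f"
proof (cases k)
  case 0
  then show ?thesis using assms by (simp add: linear_continuous_on)
next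
  case (Suc m)
  have d: "(f has_derivative f) (at x)" for x using assms by (rule bounded_linear_imp_has_derivative)
  then have "frechet_derivative f (at x) = f" for x by (metis frechet_derivative_at)
  then show ?thesis using Suc d by (auto simp: differentiable_def intro: Ck_on_const)
qed

text \<open>\<open>Ck_on\<close> speaks of the chosen derivative \<open>frechet_derivative\<close>.
  With this rule and its converse \<open>Ck_on_SucE\<close> an explicit derivative can be used
  instead, and each closure property below becomes an induction on the order with the functions
  generalized.\<close>

lemma Ck_on_SucI:
  assumes "open S" "\<And>x. x \<in> S \<Longrightarrow> (f has_derivative D x) (at x)"
    "\<And>b. b \<in> Basis \<Longrightarrow> Ck_on k S (\<lambda>x. D x b)"
  shows "Ck_on (Suc k) S f"
proof -
  have "frechet_derivative f (at x) = D x" if "x \<in> S" for x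
    using assms(2)[OF that] by (metis frechet_derivative_at)
  then have "Ck_on k S (\<lambda>x. frechet_derivative f (at x) b)" if "b \<in> Basis" for b
    using Ck_on_cong[OF assms(1), of "\<lambda>x. frechet_derivative f (at x) b" "\<lambda>x. D x b"] assms(3)[OF that] by simp
  then show ?thesis using assms(2) by (auto simp: differentiable_def)
qed

lemma Ck_on_SucE:
  assumes "Ck_on (Suc k) S f"
  shows "x \<in> S \<Longrightarrow> (f has_derivative frechet_derivative f (at x)) (at x)"
    and "b \<in> Basis \<Longrightarrow> Ck_on k S (\<lambda>x. frechet_derivative f (at x) b)"
  using assms by (auto simp: frechet_derivative_works)

lemma Ck_on_add:
  assumes "open S" "Ck_on k S f" "Ck_on k S g"
  shows "Ck_on k S (\<lambda>x. f x + g x)"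
  using assms(2,3)
proof (induction k arbitrary: f g)
  case 0
  then show ?case by (simp add: continuous_on_add)
next
  case (Suc k)
  note f = Ck_on_SucE[OF Suc.prems(1)] and g = Ck_on_SucE[OF Suc.prems(2)]
  show ?case
    by (rule Ck_on_SucI[OF assms(1) has_derivative_add[OF f(1) g(1)]])
      (auto intro!: Suc.IH f(2) g(2))
qed

lemma Ck_on_mult:
  fixes f g :: "'a::euclidean_space \<Rightarrow> real"
  assumes "open S" "Ck_on k S f" "Ck_on k S g"
  shows "Ck_on k S (\<lambda>x. f x * g x)"
  using assms(2,3)
proof (induction k arbitrary: f g)
  case 0
  then show ?case by (simp add: continuous_on_mult)
next
  case (Suc k)
  note f = Ck_on_SucE[OF Suc.prems(1)] and g = Ck_on_SucE[OF Suc.prems(2)]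
  show ?case
    by (rule Ck_on_SucI[OF assms(1) has_derivative_mult[OF f(1) g(1)]])
      (auto intro!: Ck_on_add[OF assms(1)] Suc.IH f(2) g(2) Ck_on_SucD[OF Suc.prems(1)]
        Ck_on_SucD[OF Suc.prems(2)])
qed

lemma Ck_on_minus:
  fixes f :: "'a::euclidean_space \<Rightarrow> real"
  assumes "open S" "Ck_on k S f"
  shows "Ck_on k S (\<lambda>x. - f x)"
  using Ck_on_mult[OF assms(1) Ck_on_const[of k S "-1"] assms(2)] by simp

lemma Ck_on_diff:
  fixes f g :: "'a::euclidean_space \<Rightarrow> real"
  assumes "open S" "Ck_on k S f" "Ck_on k S g"
  shows "Ck_on k S (\<lambda>x. f x - g x)"
  using Ck_on_add[OF assms(1,2) Ck_on_minus[OF assms(1,3)]] by simp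

lemma Ck_on_sum:
  assumes "open S" "\<And>i. i \<in> I \<Longrightarrow> Ck_on k S (f i)"
  shows "Ck_on k S (\<lambda>x. \<Sum>i\<in>I. f i x)"
  using assms(2)
  by (induction I rule: infinite_finite_induct) (auto intro: Ck_on_const Ck_on_add[OF assms(1)])

lemma Ck_on_prod:
  fixes f :: "'i \<Rightarrow> 'a::euclidean_space \<Rightarrow> real"
  assumes "open S" "\<And>i. i \<in> I \<Longrightarrow> Ck_on k S (f i)"
  shows "Ck_on k S (\<lambda>x. \<Prod>i\<in>I. f i x)"
  using assms(2)
  by (induction I rule: infinite_finite_induct) (auto intro: Ck_on_const Ck_on_mult[OF assms(1)])

text \<open>The inner map is controlled through its coordinates, so that the chain rule produces a
  finite sum of products of real functions; the induction hypothesis and the product rule handle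
  these.\<close>

lemma Ck_on_compose:
  fixes f :: "'b::euclidean_space \<Rightarrow> real" and h :: "'a::euclidean_space \<Rightarrow> 'b"
  assumes "open S" "\<And>b. b \<in> Basis \<Longrightarrow> Ck_on k S (\<lambda>x. h x \<bullet> b)" "Ck_on k T f" "h ` S \<subseteq> T"
  shows "Ck_on k S (\<lambda>x. f (h x))"
  using assms(2,3)
proof (induction k arbitrary: f)
  case 0
  have "continuous_on S h" using 0(1) by (subst continuous_on_componentwise) simp
  then show ?case using 0(2) by (auto intro: continuous_on_compose2[OF _ _ assms(4)])
next
  case (Suc k)
  note f = Ck_on_SucE[OF Suc.prems(2)]
  define H where "H x v = (\<Sum>b\<in>Basis. frechet_derivative (\<lambda>x. h x \<bullet> b) (at x) v *\<^sub>R b)" for x v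
  have H: "(h has_derivative H x) (at x)" if "x \<in> S" for x
  proof -
    have "((\<lambda>x. \<Sum>b\<in>Basis. (h x \<bullet> b) *\<^sub>R b) has_derivative H x) (at x)"
      unfolding H_def
      by (intro has_derivative_sum has_derivative_scaleR_left Ck_on_SucE(1)[OF Suc.prems(1)] that)
    then show ?thesis by (simp add: euclidean_representation)
  qed
  have Df: "frechet_derivative f (at (h x)) (H x v) =
      (\<Sum>b\<in>Basis. frechet_derivative (\<lambda>x. h x \<bullet> b) (at x) v * frechet_derivative f (at (h x)) b)"
    if "x \<in> S" for x v
  proof -
    have "linear (frechet_derivative f (at (h x)))"
      using f(1)[of "h x"] assms(4) that by (auto intro: has_derivative_linear)
    then show ?thesis unfolding H_def by (simp add: linear_sum linear_scale)
  qed
  have "((\<lambda>x. f (h x)) has_derivative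
      (\<lambda>v. \<Sum>b\<in>Basis. frechet_derivative (\<lambda>x. h x \<bullet> b) (at x) v * frechet_derivative f (at (h x)) b)) (at x)"
    if "x \<in> S" for x
  proof -
    have "((\<lambda>x. f (h x)) has_derivative (\<lambda>v. frechet_derivative f (at (h x)) (H x v))) (at x)"
      using f(1)[of "h x"] assms(4) that by (intro has_derivative_compose[OF H[OF that]]) auto
    then show ?thesis using Df[OF that] by simp
  qed
  moreover have "Ck_on k S (\<lambda>x. \<Sum>b\<in>Basis. frechet_derivative (\<lambda>x. h x \<bullet> b) (at x) v *
      frechet_derivative f (at (h x)) b)" if "v \<in> Basis" for v
  proof (intro Ck_on_sum[OF assms(1)] Ck_on_mult[OF assms(1)])
    fix b :: 'b assume b: "b \<in> Basis"
    show "Ck_on k S (\<lambda>x. frechet_derivative (\<lambda>x. h x \<bullet> b) (at x) v)"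
      by (rule Ck_on_SucE(2)[OF Suc.prems(1)[OF b] that])
    show "Ck_on k S (\<lambda>x. frechet_derivative f (at (h x)) b)"
      by (rule Suc.IH[OF Ck_on_SucD[OF Suc.prems(1)] f(2)[OF b]])
  qed
  ultimately show ?case by (rule Ck_on_SucI[OF assms(1)])
qed

lemma Ck_on_compose_real:
  fixes f :: "real \<Rightarrow> real" and h :: "'a::euclidean_space \<Rightarrow> real"
  assumes "open S" "Ck_on k S h" "Ck_on k T f" "h ` S \<subseteq> T"
  shows "Ck_on k S (\<lambda>x. f (h x))"
  by (rule Ck_on_compose[OF assms(1) _ assms(3,4)]) (use assms(2) in simp)

lemma Ck_on_real_SucI:
  fixes f :: "real \<Rightarrow> real"
  assumes "open S" "\<And>x. x \<in> S \<Longrightarrow> (f has_real_derivative f' x) (at x)" "Ck_on k S f'"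
  shows "Ck_on (Suc k) S f"
  using assms by (intro Ck_on_SucI[where D = "\<lambda>x v. f' x * v"]) (auto simp: has_field_derivative_def)

section \<open>Elementary smooth functions of one real variable\<close>

lemma Ck_on_powr: "Ck_on k {0<..} (\<lambda>x::real. x powr a)"
proof (induction k arbitrary: a)
  case 0
  show ?case by (auto intro!: continuous_intros)
next
  case (Suc k)
  show ?case
    by (rule Ck_on_real_SucI[where f' = "\<lambda>x. a * x powr (a - 1)", OF _ has_real_derivative_powr
          Ck_on_mult[OF _ Ck_on_const Suc.IH]]) simp_all
qed

lemma Ck_on_exp: "Ck_on k UNIV (exp :: real \<Rightarrow> real)"
proof (induction k)
  case 0
  show ?case by (simp add: continuous_on_exp)
next
  case (Suc k)
  then show ?case by (intro Ck_on_real_SucI[OF open_UNIV DERIV_exp])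
qed

text \<open>The factors \<open>t\<^sup>-\<^sup>m\<close> make the family closed under differentiation.\<close>

definition flat_exp :: "nat \<Rightarrow> real \<Rightarrow> real" where
  "flat_exp m t = (if t \<le> 0 then 0 else exp (- (1 / t)) / t ^ m)"

lemma flat_exp_tendsto_0: "((\<lambda>t. flat_exp m t) \<longlongrightarrow> 0) (at_right 0)"
proof -
  have "((\<lambda>t::real. (inverse t) ^ m / exp (inverse t)) \<longlongrightarrow> 0) (at_right 0)"
    by (rule filterlim_compose[OF tendsto_power_div_exp_0 filterlim_inverse_at_top_right])
  moreover have "\<forall>\<^sub>F t in at_right 0. (inverse t) ^ m / exp (inverse t) = flat_exp m (t::real)"
    by (auto simp: eventually_at_filter flat_exp_def exp_minus field_simps)
  ultimately show ?thesis by (rule Lim_transform_eventually)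
qed

text \<open>Away from 0 the two terms come from differentiating \<open>exp (- (1 / t))\<close> and
  the power of \<open>t\<close>. At 0 the right-hand difference quotient of
  \<open>flat_exp m\<close> is \<open>flat_exp (m + 1)\<close>, whose limit is already known to be
  0.\<close>

lemma flat_exp_deriv:
  "(flat_exp m has_real_derivative (flat_exp (m + 2) t - m * flat_exp (m + 1) t)) (at t)"
proof -
  consider "t < 0" | "t > 0" | "t = 0" by linarith
  then show ?thesis
  proof cases
    case 1
    have "((\<lambda>t. 0) has_real_derivative 0) (at t)" by simp
    then have "(flat_exp m has_real_derivative 0) (at t)"
      by (rule has_field_derivative_transform_within_open[of _ _ _ "{..<0}"]) (use 1 in \<open>auto simp: flat_exp_def\<close>)
    then show ?thesis using 1 by (simp add: flat_exp_def)
  next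
    case 2
    have "((\<lambda>t. exp (- (1 / t)) * inverse (t ^ m)) has_real_derivative
        flat_exp (m + 2) t - m * flat_exp (m + 1) t) (at t)"
      using 2
      by (cases m) (auto intro!: derivative_eq_intros simp: flat_exp_def field_simps power2_eq_square,
          metis One_nat_def power_eq_if)
    then show ?thesis
      by (rule has_field_derivative_transform_within_open[of _ _ _ "{0<..}"])
        (use 2 in \<open>auto simp: flat_exp_def field_simps\<close>)
  next
    case 3
    have "((\<lambda>h. flat_exp m h / h) \<longlongrightarrow> 0) (at 0)"
    proof (rule filterlim_split_at)
      have "\<forall>\<^sub>F h in at_left 0. 0 = flat_exp m h / (h::real)"
        by (auto simp: eventually_at_filter flat_exp_def)
      then show "((\<lambda>h. flat_exp m h / h) \<longlongrightarrow> 0) (at_left 0)"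
        by (rule Lim_transform_eventually[OF tendsto_const])
      have "\<forall>\<^sub>F h in at_right 0. flat_exp (m + 1) h = flat_exp m h / (h::real)"
        by (auto simp: eventually_at_filter flat_exp_def)
      then show "((\<lambda>h. flat_exp m h / h) \<longlongrightarrow> 0) (at_right 0)"
        by (rule Lim_transform_eventually[OF flat_exp_tendsto_0])
    qed
    then show ?thesis unfolding 3 DERIV_def by (simp add: flat_exp_def)
  qed
qed

lemma Ck_on_flat_exp: "Ck_on k UNIV (flat_exp m)"
proof (induction k arbitrary: m)
  case 0
  show ?case by (auto intro!: continuous_at_imp_continuous_on DERIV_isCont flat_exp_deriv)
next
  case (Suc k)
  show ?case
    by (rule Ck_on_real_SucI[OF _ flat_exp_deriv])
      (simp_all add: Suc.IH Ck_on_diff Ck_on_mult Ck_on_const del: Ck_on.simps)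
qed

lemma flat_exp_pos_iff [simp]: "0 < flat_exp m t \<longleftrightarrow> 0 < t"
  and flat_exp_nonneg [simp]: "0 \<le> flat_exp m t"
  and flat_exp_eq_0_iff [simp]: "flat_exp m t = 0 \<longleftrightarrow> t \<le> 0"
  and flat_exp_0_le_1: "flat_exp 0 t \<le> 1"
  by (auto simp: flat_exp_def)

lemma flat_exp_0_mono: "s \<le> t \<Longrightarrow> flat_exp 0 s \<le> flat_exp 0 t"
  by (auto simp: flat_exp_def frac_le)

section \<open>Test functions and the fundamental lemma of the calculus of variations\<close>

lemma pderiv_i_eqI: "(f has_derivative D) (at y) \<Longrightarrow> pderiv_i i f y = D (axis i 1)"
  unfolding pderiv_i_def by (metis frechet_derivative_at)

lemma pderiv_i_cong:
  assumes "open S" "y \<in> S" "\<And>z. z \<in> S \<Longrightarrow> f z = g z"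
  shows "pderiv_i i f y = pderiv_i i g y"
  unfolding pderiv_i_def using frechet_derivative_cong_open(1)[OF assms] by simp

lemma pderiv_i_const [simp]: "pderiv_i i (\<lambda>_. c) y = 0"
  by (rule pderiv_i_eqI[of _ "\<lambda>_. 0", simplified]) simp

lemma pderiv_i_mult:
  assumes "f differentiable (at y)" "g differentiable (at y)"
  shows "pderiv_i i (\<lambda>z. f z * g z) y = f y * pderiv_i i g y + pderiv_i i f y * g y"
  unfolding pderiv_i_def
  by (rule pderiv_i_eqI[unfolded pderiv_i_def]) (auto intro!: has_derivative_mult
      simp: assms frechet_derivative_works[symmetric])

lemma pderiv_i_add:
  assumes "f differentiable (at y)" "g differentiable (at y)"
  shows "pderiv_i i (\<lambda>z. f z + g z) y = pderiv_i i f y + pderiv_i i g y"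
  unfolding pderiv_i_def
  by (rule pderiv_i_eqI[unfolded pderiv_i_def]) (auto intro!: has_derivative_add
      simp: assms frechet_derivative_works[symmetric])

lemma pderiv_i_sum:
  assumes "\<And>j. j \<in> J \<Longrightarrow> f j differentiable (at y)"
  shows "pderiv_i i (\<lambda>z. \<Sum>j\<in>J. f j z) y = (\<Sum>j\<in>J. pderiv_i i (f j) y)"
  unfolding pderiv_i_def
  by (rule pderiv_i_eqI[unfolded pderiv_i_def]) (auto intro!: has_derivative_sum
      simp: assms frechet_derivative_works[symmetric])

lemma pderiv_i_compose_real:
  assumes "(F has_real_derivative F') (at (h y))" "h differentiable (at y)"
  shows "pderiv_i i (\<lambda>z. F (h z)) y = F' * pderiv_i i h y"
proof -
  have "(h has_derivative frechet_derivative h (at y)) (at y)"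
    using assms(2) by (simp add: frechet_derivative_works)
  from has_derivative_compose[OF this assms(1)[unfolded has_field_derivative_def]]
  show ?thesis unfolding pderiv_i_def[of i h] by (rule pderiv_i_eqI)
qed

lemma Ck_on_pderiv_i: "Ck_on (Suc k) S f \<Longrightarrow> Ck_on k S (pderiv_i i f)"
  by (simp add: pderiv_i_def[abs_def] axis_in_Basis_iff)

lemma smooth_on_pderiv_i: "smooth_on S f \<Longrightarrow> smooth_on S (pderiv_i i f)"
  unfolding smooth_on_def by (blast intro: Ck_on_pderiv_i)

lemma Ck_on_differentiable: "Ck_on (Suc k) S f \<Longrightarrow> y \<in> S \<Longrightarrow> f differentiable (at y)"
  by simp

lemma smooth_on_differentiable: "smooth_on S f \<Longrightarrow> y \<in> S \<Longrightarrow> f differentiable (at y)"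
  unfolding smooth_on_def by (blast intro: Ck_on_differentiable)

lemma smooth_on_continuous_on: "smooth_on S f \<Longrightarrow> continuous_on S f"
  unfolding smooth_on_def by (metis Ck_on.simps(1))

lemma smooth_on_mult: "open S \<Longrightarrow> smooth_on S p \<Longrightarrow> smooth_on S q \<Longrightarrow> smooth_on S (\<lambda>x. p x * q x :: real)"
  and smooth_on_const: "smooth_on S (\<lambda>x. c)"
  by (auto simp: smooth_on_def intro: Ck_on_add Ck_on_mult Ck_on_const)

lemma smooth_on_sum: "open S \<Longrightarrow> (\<And>i. i \<in> I \<Longrightarrow> smooth_on S (f i)) \<Longrightarrow> smooth_on S (\<lambda>x. \<Sum>i\<in>I. f i x)"
  by (auto simp: smooth_on_def intro: Ck_on_sum)

lemma smooth_on_subset: "smooth_on S f \<Longrightarrow> T \<subseteq> S \<Longrightarrow> smooth_on T f"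
  unfolding smooth_on_def by (blast intro: Ck_on_subset)

lemma smooth_on_cong: "open S \<Longrightarrow> (\<And>x. x \<in> S \<Longrightarrow> f x = g x) \<Longrightarrow> smooth_on S f \<longleftrightarrow> smooth_on S g"
  unfolding smooth_on_def using Ck_on_cong by blast

lemma smooth_on_local:
  assumes "\<And>x. x \<in> S \<Longrightarrow> \<exists>T. open T \<and> x \<in> T \<and> smooth_on T f"
  shows "smooth_on S f"
  unfolding smooth_on_def using assms by (intro allI Ck_on_local) (metis smooth_on_def)

text \<open>\<open>F\<close> may be arbitrary outside \<open>\<Omega>\<close>. Smoothness is local:
  the product is smooth on \<open>\<Omega>\<close> and zero on the complement of \<open>K\<close>,
  and these two open sets cover the space.\<close>

lemma smooth_on_mult_support:
  assumes "open \<Omega>" "smooth_on \<Omega> F" "smooth_on UNIV \<psi>" "closed K" "K \<subseteq> \<Omega>" "\<And>y. y \<notin> K \<Longrightarrow> \<psi> y = 0"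
  shows "smooth_on UNIV (\<lambda>y. F y * \<psi> y :: real)"
proof (rule smooth_on_local)
  fix y
  show "\<exists>T. open T \<and> y \<in> T \<and> smooth_on T (\<lambda>y. F y * \<psi> y)"
  proof (cases "y \<in> \<Omega>")
    case True
    then show ?thesis using assms by (blast intro: smooth_on_mult smooth_on_subset)
  next
    case False
    have "smooth_on (- K) (\<lambda>y. F y * \<psi> y) \<longleftrightarrow> smooth_on (- K) (\<lambda>y. 0 :: real)"
      using assms by (intro smooth_on_cong) auto
    then show ?thesis using False assms smooth_on_const by (intro exI[of _ "- K"]) auto
  qed
qed

lemma test_functionI:
  assumes "smooth_on UNIV \<psi>" "compact K" "K \<subseteq> \<Omega>" "\<And>y. y \<notin> K \<Longrightarrow> \<psi> y = 0"
  shows "test_function \<Omega> \<psi>"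
proof -
  have "closure {y. \<psi> y \<noteq> 0} \<subseteq> K"
    using assms(2,4) by (intro closure_minimal) (auto intro: compact_imp_closed)
  moreover from this have "compact (closure {y. \<psi> y \<noteq> 0})"
    using assms(2) by (metis closed_closure compact_Int_closed inf.absorb2)
  ultimately show ?thesis using assms(1,3) by (simp add: test_function_def)
qed

lemma test_functionE:
  assumes "test_function \<Omega> \<psi>"
  obtains K where "compact K" "K \<subseteq> \<Omega>" "\<And>y. y \<notin> K \<Longrightarrow> \<psi> y = 0"
    "\<And>i y. y \<notin> K \<Longrightarrow> pderiv_i i \<psi> y = 0"
proof -
  define K where "K = closure {y. \<psi> y \<noteq> 0}"
  have 1: "compact K" "K \<subseteq> \<Omega>" using assms unfolding test_function_def K_def by blast+
  have 2: "\<psi> y = 0" if "y \<notin> K" for y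
    using that closure_subset unfolding K_def by (metis (mono_tags) mem_Collect_eq subsetD)
  have "open (- K)" by (simp add: K_def open_Compl)
  then have "pderiv_i i \<psi> y = 0" if "y \<notin> K" for i y
    using pderiv_i_cong[of "- K" y \<psi> "\<lambda>_. 0" i] 2 that by simp
  then show thesis using that 1 2 by blast
qed

lemma test_function_support:
  assumes "test_function \<Omega> \<psi>"
  obtains K where "compact K" "K \<subseteq> \<Omega>" "\<And>y. y \<notin> K \<Longrightarrow> \<psi> y = 0"
  using test_functionE[OF assms] by metis

lemma test_function_smooth: "test_function \<Omega> \<psi> \<Longrightarrow> smooth_on UNIV \<psi>"
  by (simp add: test_function_def)

lemma test_function_mono: "test_function \<Omega> \<psi> \<Longrightarrow> \<Omega> \<subseteq> \<Omega>' \<Longrightarrow> test_function \<Omega>' \<psi>"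
  by (auto simp: test_function_def)

lemma test_function_pderiv_i:
  assumes "test_function \<Omega> \<psi>"
  shows "test_function \<Omega> (pderiv_i i \<psi>)"
  using assms
proof (rule test_functionE)
  fix K
  assume "compact K" "K \<subseteq> \<Omega>" "\<And>i y. y \<notin> K \<Longrightarrow> pderiv_i i \<psi> y = 0"
  then show ?thesis by (rule test_functionI[OF smooth_on_pderiv_i[OF test_function_smooth[OF assms]]])
qed

lemma test_function_mult:
  assumes "open \<Omega>" "smooth_on \<Omega> F" "test_function \<Omega> \<psi>"
  shows "test_function \<Omega> (\<lambda>y. F y * \<psi> y)"
proof -
  obtain K where K: "compact K" "K \<subseteq> \<Omega>" "\<And>y. y \<notin> K \<Longrightarrow> \<psi> y = 0"
    using assms(3) by (rule test_function_support) (rule that)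
  show ?thesis
    by (rule test_functionI[OF smooth_on_mult_support[OF assms(1,2) test_function_smooth[OF assms(3)]
            compact_imp_closed[OF K(1)] K(2,3)] K(1,2)]) (simp_all add: K(3))
qed

lemma test_function_0: "test_function \<Omega> (\<lambda>y. 0)"
  by (rule test_functionI[where K = "{}", OF smooth_on_const]) simp_all

lemma test_function_sum:
  assumes "\<And>j. j \<in> J \<Longrightarrow> test_function \<Omega> (\<psi> j)"
  shows "test_function \<Omega> (\<lambda>y. \<Sum>j\<in>J. \<psi> j y)"
  using assms
proof (induction J rule: infinite_finite_induct)
  case (insert j J)
  obtain K where K: "compact K" "K \<subseteq> \<Omega>" "\<And>y. y \<notin> K \<Longrightarrow> \<psi> j y = 0"
    using insert.prems[OF insertI1] by (rule test_function_support) (rule that)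
  have t: "test_function \<Omega> (\<lambda>y. \<Sum>j\<in>J. \<psi> j y)"
    by (rule insert.IH) (simp add: insert.prems)
  obtain K' where K': "compact K'" "K' \<subseteq> \<Omega>" "\<And>y. y \<notin> K' \<Longrightarrow> (\<Sum>j\<in>J. \<psi> j y) = 0"
    using t by (rule test_function_support) (rule that)
  show ?case
  proof (rule test_functionI[where K = "K \<union> K'"])
    show "smooth_on UNIV (\<lambda>y. \<Sum>j\<in>insert j J. \<psi> j y)"
      by (rule smooth_on_sum[OF open_UNIV]) (rule test_function_smooth[OF insert.prems])
    show "compact (K \<union> K')" "K \<union> K' \<subseteq> \<Omega>" using K K' by (simp_all add: compact_Un)
    show "(\<Sum>j\<in>insert j J. \<psi> j y) = 0" if "y \<notin> K \<union> K'" for y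
      using K(3)[of y] K'(3)[of y] that insert.hyps by simp
  qed
qed (simp_all add: test_function_0)

section \<open>Integrals of compactly supported functions and integration by parts\<close>

lemma integrable_continuous_compact_support:
  fixes f :: "'a::euclidean_space \<Rightarrow> real"
  assumes "continuous_on UNIV f" "compact K" "\<And>y. y \<notin> K \<Longrightarrow> f y = 0"
  shows "integrable lborel f"
proof -
  have "integrable lborel (\<lambda>x. indicator K x *\<^sub>R f x)"
    using assms by (intro borel_integrable_compact) (auto intro: continuous_on_subset)
  also have "(\<lambda>x. indicator K x *\<^sub>R f x) = f" using assms(3) by (intro ext) (auto simp: indicator_def)
  finally show ?thesis .
qed

lemma locally_integrable_continuous:
  assumes "continuous_on \<Omega> f"
  shows "locally_integrable \<Omega> f"
  unfolding locally_integrable_def set_integrable_def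
  using assms by (auto intro!: borel_integrable_compact intro: continuous_on_subset simp del: real_scaleR_def)

lemma bounded_continuous_compact_support:
  fixes f :: "'a::euclidean_space \<Rightarrow> real"
  assumes "continuous_on UNIV f" "compact K" "\<And>y. y \<notin> K \<Longrightarrow> f y = 0"
  obtains M where "\<And>y. \<bar>f y\<bar> \<le> M"
proof -
  have "bounded (f ` K)" using assms by (intro compact_imp_bounded compact_continuous_image)
      (auto intro: continuous_on_subset)
  then obtain B where "\<forall>y\<in>K. \<bar>f y\<bar> \<le> B" by (auto simp: bounded_iff)
  then have "\<bar>f y\<bar> \<le> max B 0" for y using assms(3)[of y] by (cases "y \<in> K") auto
  then show ?thesis using that by blast
qed

lemma set_integrable_mult_test:
  assumes "open \<Omega>" "locally_integrable \<Omega> w" "continuous_on UNIV \<psi>" "compact K" "K \<subseteq> \<Omega>"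
    "\<And>y. y \<notin> K \<Longrightarrow> \<psi> y = 0"
  shows "set_integrable lborel \<Omega> (\<lambda>y. w y * \<psi> y)"
proof -
  have i: "integrable lborel (\<lambda>y. indicator K y * w y)"
    using assms by (simp add: locally_integrable_def set_integrable_def)
  obtain B where B: "\<bar>\<psi> y\<bar> \<le> B" for y
    using bounded_continuous_compact_support[OF assms(3,4,6)] by blast
  have \<psi>m: "\<psi> \<in> borel_measurable lborel" using assms(3) by (simp add: borel_measurable_continuous_onI)
  have "integrable lborel (\<lambda>y. (indicator K y * w y) * \<psi> y)"
  proof (rule Bochner_Integration.integrable_bound)
    show "integrable lborel (\<lambda>y. B * (indicator K y * w y))" using i by simp
    show "(\<lambda>y. indicator K y * w y * \<psi> y) \<in> borel_measurable lborel"
      using borel_measurable_integrable[OF i] \<psi>m by (rule borel_measurable_times)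
    show "AE y in lborel. norm (indicator K y * w y * \<psi> y) \<le> norm (B * (indicator K y * w y))"
    proof (rule AE_I2)
      fix y
      have "\<bar>indicator K y * w y\<bar> * \<bar>\<psi> y\<bar> \<le> \<bar>indicator K y * w y\<bar> * \<bar>B\<bar>"
        using B[of y] by (intro mult_left_mono) auto
      then show "norm (indicator K y * w y * \<psi> y) \<le> norm (B * (indicator K y * w y))"
        by (simp add: abs_mult mult.commute)
    qed
  qed
  also have "(\<lambda>y. (indicator K y * w y) * \<psi> y) = (\<lambda>y. indicator \<Omega> y *\<^sub>R (w y * \<psi> y))"
    using assms(5,6) by (intro ext) (auto simp: indicator_def)
  finally show ?thesis by (simp add: set_integrable_def)
qed

text \<open>Translation invariance of Lebesgue measure makes every difference quotient in direction
  \<open>e\<close> integrate to 0, and dominated convergence passes this on to the partial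
  derivative.\<close>

lemma integral_pderiv_i_compact_support:
  fixes f :: "real^'n \<Rightarrow> real"
  assumes f: "Ck_on (Suc 0) UNIV f" and K: "compact K" "\<And>y. y \<notin> K \<Longrightarrow> f y = 0"
  shows "(LINT y|lborel. pderiv_i i f y) = 0"
proof -
  define e where "e = (axis i 1 :: real^'n)"
  have e: "norm e = 1" by (simp add: e_def)
  have fc: "continuous_on UNIV f" using f by (rule Ck_on_imp_continuous_on)
  have dc: "continuous_on UNIV (pderiv_i i f)"
    using Ck_on_pderiv_i[OF f] by (rule Ck_on_imp_continuous_on)
  have d0: "pderiv_i i f y = 0" if "y \<notin> K" for y
    using pderiv_i_cong[of "- K" y f "\<lambda>_. 0" i] K that by (auto intro: compact_imp_closed)
  have der: "((\<lambda>t. f (y + t *\<^sub>R e)) has_real_derivative pderiv_i i f (y + t *\<^sub>R e)) (at t)" for y t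
  proof -
    let ?D = "frechet_derivative f (at (y + t *\<^sub>R e))"
    have D: "(f has_derivative ?D) (at (y + t *\<^sub>R e))"
      using Ck_on_differentiable[OF f] by (simp add: frechet_derivative_works)
    have "((\<lambda>t. y + t *\<^sub>R e) has_derivative (\<lambda>h. h *\<^sub>R e)) (at t)"
      by (auto intro!: derivative_eq_intros)
    from has_derivative_compose[OF this D]
    have "((\<lambda>t. f (y + t *\<^sub>R e)) has_derivative (\<lambda>h. ?D (h *\<^sub>R e))) (at t)" .
    moreover have "(\<lambda>h. ?D (h *\<^sub>R e)) = (*) (pderiv_i i f (y + t *\<^sub>R e))"
      using has_derivative_linear[OF D] by (auto simp: linear_scale pderiv_i_def e_def)
    ultimately show ?thesis by (simp add: has_field_derivative_def)
  qed
  obtain M where M: "\<And>y. \<bar>pderiv_i i f y\<bar> \<le> M"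
    using bounded_continuous_compact_support[OF dc K(1) d0] by blast
  obtain R where "\<forall>y\<in>K. norm y \<le> R" using compact_imp_bounded[OF K(1)] by (auto simp: bounded_iff)
  then have R: "K \<subseteq> cball 0 R" by auto
  define \<delta> where "\<delta> = (\<lambda>n. 1 / real (Suc n))"
  have \<delta>: "0 < \<delta> n" "\<delta> n \<le> 1" for n by (auto simp: \<delta>_def)
  have \<delta>0: "\<delta> \<longlonglongrightarrow> 0" unfolding \<delta>_def by (rule LIMSEQ_Suc[OF lim_1_over_n])
  define q where "q = (\<lambda>n y. (f (y + \<delta> n *\<^sub>R e) - f y) / \<delta> n)"
  have fi: "integrable lborel f" by (rule integrable_continuous_compact_support[OF fc K])
  have shift: "integrable lborel (\<lambda>y. f (y + v))" "(LINT y|lborel. f (y + v)) = (LINT y|lborel. f y)" for v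
  proof -
    have "integrable (distr lborel borel ((+) v)) f" using fi by (simp add: lborel_distr_plus)
    then show "integrable lborel (\<lambda>y. f (y + v))"
      by (subst (asm) integrable_distr_eq)
        (use fc in \<open>auto simp: add.commute borel_measurable_continuous_onI\<close>)
    have "(LINT y|lborel. f y) = (LINT y|distr lborel borel ((+) v). f y)" by (simp add: lborel_distr_plus)
    also have "\<dots> = (LINT y|lborel. f (v + y))"
      by (rule integral_distr) (use fc in \<open>auto simp: borel_measurable_continuous_onI\<close>)
    finally show "(LINT y|lborel. f (y + v)) = (LINT y|lborel. f y)" by (simp add: add.commute)
  qed
  have q0: "(LINT y|lborel. q n y) = 0" for n
    unfolding q_def using shift fi by simp
  have "(\<lambda>n. LINT y|lborel. q n y) \<longlonglongrightarrow> (LINT y|lborel. pderiv_i i f y)"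
  proof (rule integral_dominated_convergence)
    show "pderiv_i i f \<in> borel_measurable lborel" using dc by (simp add: borel_measurable_continuous_onI)
    show "q n \<in> borel_measurable lborel" for n
      unfolding q_def using borel_measurable_integrable[OF shift(1)] borel_measurable_integrable[OF fi]
      by (intro borel_measurable_divide borel_measurable_diff) auto
    \<comment> \<open>By the mean value theorem the quotients are bounded by \<open>M\<close>. Since
      the shifts \<open>\<delta> n\<close> are at most 1, they vanish outside the ball of radius
      \<open>R + 1\<close>.\<close>
    show "integrable lborel (\<lambda>y :: real^'n. M * indicator (cball 0 (R + 1)) y)"
      using emeasure_lborel_cball_finite[of "0 :: real^'n" "R + 1"]
      by (intro integrable_mult_right integrable_real_indicator) auto
    show "AE y in lborel. (\<lambda>n. q n y) \<longlonglongrightarrow> pderiv_i i f y"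
    proof (rule AE_I2)
      fix y
      have "((\<lambda>h. (f (y + h *\<^sub>R e) - f y) / h) \<longlongrightarrow> pderiv_i i f y) (at 0)"
        using der[of y 0] by (simp add: DERIV_def)
      moreover have "filterlim \<delta> (at 0) sequentially"
        using \<delta>0 \<delta>(1) by (auto simp: filterlim_at intro!: always_eventually) (metis less_irrefl)
      ultimately show "(\<lambda>n. q n y) \<longlonglongrightarrow> pderiv_i i f y"
        unfolding q_def by (rule filterlim_compose)
    qed
    show "AE y in lborel. norm (q n y) \<le> M * indicator (cball 0 (R + 1)) y" for n
    proof (rule AE_I2)
      fix y :: "real^'n"
      show "norm (q n y) \<le> M * indicator (cball 0 (R + 1)) y"
      proof (cases "y \<in> cball 0 (R + 1)")
        case True
        obtain z where "f (y + \<delta> n *\<^sub>R e) - f (y + 0 *\<^sub>R e) = (\<delta> n - 0) * pderiv_i i f (y + z *\<^sub>R e)"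
          using MVT2[OF \<delta>(1)[of n], of "\<lambda>t. f (y + t *\<^sub>R e)" "\<lambda>t. pderiv_i i f (y + t *\<^sub>R e)"] der by blast
        then have "q n y = pderiv_i i f (y + z *\<^sub>R e)" using \<delta>(1)[of n] by (simp add: q_def)
        then show ?thesis using M True by simp
      next
        case False
        then have "norm y > R + 1" by simp
        moreover have "norm (y + \<delta> n *\<^sub>R e) \<ge> norm y - 1"
          using norm_triangle_ineq2[of y "- (\<delta> n *\<^sub>R e)"] \<delta>[of n] e by simp
        ultimately have "y \<notin> K" "y + \<delta> n *\<^sub>R e \<notin> K" using R by (auto simp: subset_iff)
        then show ?thesis using K False by (simp add: q_def)
      qed
    qed
  qed
  then show ?thesis using q0 by (simp add: LIMSEQ_const_iff)
qed

text \<open>\<open>F\<close> is smooth only on \<open>\<Omega>\<close>, but its product with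
  \<open>\<psi>\<close> is a globally smooth function of compact support, so its partial derivative
  integrates to 0; the product rule splits this integral.\<close>

lemma integral_by_parts:
  assumes "open \<Omega>" "smooth_on \<Omega> F" "test_function \<Omega> \<psi>"
  shows "(LINT y:\<Omega>|lborel. F y * pderiv_i i \<psi> y) = - (LINT y:\<Omega>|lborel. pderiv_i i F y * \<psi> y)"
proof -
  obtain K where K: "compact K" "K \<subseteq> \<Omega>" "\<And>y. y \<notin> K \<Longrightarrow> \<psi> y = 0" "\<And>i y. y \<notin> K \<Longrightarrow> pderiv_i i \<psi> y = 0"
    using assms(3) by (rule test_functionE) (rule that)
  note s = test_function_smooth[OF assms(3)]
  have "smooth_on UNIV (\<lambda>y. F y * \<psi> y)"
    using test_function_smooth[OF test_function_mult[OF assms]] .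
  then have "(LINT y|lborel. pderiv_i i (\<lambda>y. F y * \<psi> y) y) = 0"
    using K by (intro integral_pderiv_i_compact_support[OF _ K(1)]) (auto simp: smooth_on_def simp del: Ck_on.simps)
  also have "(\<lambda>y. pderiv_i i (\<lambda>y. F y * \<psi> y) y) =
      (\<lambda>y. indicator \<Omega> y *\<^sub>R (F y * pderiv_i i \<psi> y) + indicator \<Omega> y *\<^sub>R (pderiv_i i F y * \<psi> y))"
  proof
    fix y
    show "pderiv_i i (\<lambda>y. F y * \<psi> y) y =
      indicator \<Omega> y *\<^sub>R (F y * pderiv_i i \<psi> y) + indicator \<Omega> y *\<^sub>R (pderiv_i i F y * \<psi> y)"
    proof (cases "y \<in> \<Omega>")
      case True
      then show ?thesis using s assms(2)
        by (subst pderiv_i_mult) (auto intro: smooth_on_differentiable)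
    next
      case False
      then have "pderiv_i i (\<lambda>y. F y * \<psi> y) y = 0"
        using pderiv_i_cong[of "- K" y "\<lambda>y. F y * \<psi> y" "\<lambda>_. 0" i] K
        by (auto intro: compact_imp_closed)
      then show ?thesis using False by simp
    qed
  qed
  finally have *: "(LINT y|lborel. indicator \<Omega> y *\<^sub>R (F y * pderiv_i i \<psi> y) + indicator \<Omega> y *\<^sub>R (pderiv_i i F y * \<psi> y)) = 0" .
  have "integrable lborel (\<lambda>y. indicator \<Omega> y *\<^sub>R (F y * pderiv_i i \<psi> y))"
    using set_integrable_mult_test[OF assms(1) locally_integrable_continuous[OF smooth_on_continuous_on[OF assms(2)]]
       smooth_on_continuous_on[OF smooth_on_pderiv_i[OF s]] K(1,2,4)]
    by (simp add: set_integrable_def)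
  moreover have "integrable lborel (\<lambda>y. indicator \<Omega> y *\<^sub>R (pderiv_i i F y * \<psi> y))"
    using set_integrable_mult_test[OF assms(1) locally_integrable_continuous[OF smooth_on_continuous_on[OF
       smooth_on_pderiv_i[OF assms(2)]]] smooth_on_continuous_on[OF s] K(1,2,3)]
    by (simp add: set_integrable_def)
  ultimately show ?thesis using * by (simp add: set_lebesgue_integral_def)
qed

section \<open>Approximation of boxes and the du Bois-Reymond lemma\<close>

lemma Ck_on_vec_nth: "Ck_on k S (\<lambda>y. y $ i)"
  by (rule Ck_on_bounded_linear) (rule bounded_linear_vec_nth)

lemma box_test_functions:
  fixes a b :: "real^'n"
  assumes "cbox a b \<subseteq> \<Omega>"
  obtains \<psi> where "\<And>k. test_function \<Omega> (\<psi> k)" "\<And>k y. \<bar>\<psi> k y\<bar> \<le> 1"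
    "\<And>y. (\<lambda>k. \<psi> k y) \<longlonglongrightarrow> indicator (box a b) y"
    "\<And>k y. y \<notin> cbox a b \<Longrightarrow> \<psi> k y = 0"
proof -
  \<comment> \<open>A smooth function that is positive exactly on the open box: each coordinate
    contributes one flat factor per face.\<close>
  define \<rho> where "\<rho> y = (\<Prod>i\<in>UNIV. flat_exp 0 (y $ i - a $ i) * flat_exp 0 (b $ i - y $ i))" for y
  have \<rho>: "Ck_on k UNIV \<rho>" for k
    unfolding \<rho>_def
    by (intro Ck_on_prod Ck_on_mult open_UNIV Ck_on_compose_real[OF _ _ Ck_on_flat_exp] Ck_on_diff
        Ck_on_const Ck_on_vec_nth) simp_all
  have \<rho>0: "0 \<le> \<rho> y" for y by (simp add: \<rho>_def prod_nonneg)
  have \<rho>1: "\<rho> y = 0" if "y \<notin> box a b" for y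
  proof -
    have "\<exists>i. \<not> (a $ i < y $ i \<and> y $ i < b $ i)" using that by (simp add: mem_box_cart)
    then obtain i where "\<not> (a $ i < y $ i \<and> y $ i < b $ i)" by blast
    then show ?thesis unfolding \<rho>_def by (intro prod_zero) (auto intro!: exI[of _ i])
  qed
  have \<rho>2: "0 < \<rho> y" if "y \<in> box a b" for y
    using that unfolding \<rho>_def by (intro prod_pos mult_pos_pos ballI) (auto simp: mem_box_cart)
  \<comment> \<open>Where \<open>\<rho>\<close> is positive this tends to 1 as \<open>k\<close>
    grows, elsewhere it stays 0; all values lie between 0 and 1.\<close>
  define \<psi> where "\<psi> k y = 1 - exp (- real k * \<rho> y)" for k :: nat and y
  show thesis
  proof
    show "test_function \<Omega> (\<psi> k)" for k
    proof (rule test_functionI[OF _ compact_cbox assms])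
      show "smooth_on UNIV (\<psi> k)"
        unfolding smooth_on_def \<psi>_def
        by (intro allI Ck_on_diff Ck_on_const open_UNIV Ck_on_compose_real[OF _ _ Ck_on_exp] Ck_on_mult \<rho>) simp
      show "\<psi> k y = 0" if "y \<notin> cbox a b" for y
        using \<rho>1[of y] box_subset_cbox that by (auto simp: \<psi>_def)
    qed
    show "\<bar>\<psi> k y\<bar> \<le> 1" for k y using \<rho>0[of y] by (simp add: \<psi>_def)
    show "\<psi> k y = 0" if "y \<notin> cbox a b" for k y
      using \<rho>1[of y] box_subset_cbox that by (auto simp: \<psi>_def)
    show "(\<lambda>k. \<psi> k y) \<longlonglongrightarrow> indicator (box a b) y" for y
    proof (cases "y \<in> box a b")
      case True
      have "filterlim (\<lambda>k. - real k * \<rho> y) at_bot sequentially"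
        using filterlim_tendsto_neg_mult_at_bot[OF tendsto_const, of "- \<rho> y" "\<lambda>k. real k" sequentially]
          \<rho>2[OF True] filterlim_real_sequentially by (simp add: mult.commute)
      then have "(\<lambda>k. exp (- real k * \<rho> y)) \<longlonglongrightarrow> 0" by (rule filterlim_compose[OF exp_at_bot])
      then have "(\<lambda>k. \<psi> k y) \<longlonglongrightarrow> 1 - 0" unfolding \<psi>_def by (intro tendsto_intros)
      then show ?thesis using True by simp
    next
      case False
      then show ?thesis using \<rho>1 by (simp add: \<psi>_def)
    qed
  qed
qed

text \<open>Open boxes are closed under intersection and generate the Borel sets, so the vanishing
  integral spreads to every Borel set; the integral over the whole space serves the complement step.
  The sets where \<open>f\<close> is positive and where it is negative then finish the
  argument.\<close>

lemma integrable_zero_on_boxes_AE: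
  fixes f :: "'a::euclidean_space \<Rightarrow> real"
  assumes f: "integrable lborel f" and U: "(LINT y|lborel. f y) = 0"
    and box: "\<And>c d. (LINT y|lborel. indicator (box c d) y * f y) = 0"
  shows "AE y in lborel. f y = 0"
proof -
  have i: "integrable lborel (\<lambda>y. indicator A y * f y)" if "A \<in> sets borel" for A
    using integrable_mult_indicator[OF _ f, of A] that by simp
  have z: "(LINT y|lborel. indicator A y * f y) = 0" if A: "A \<in> sets borel" for A
  proof -
    have "Int_stable (range (\<lambda>(a, b). box a b :: 'a set))"
      by (auto simp: Int_stable_def box_Int_box)
    moreover have "range (\<lambda>(a, b). box a b :: 'a set) \<subseteq> Pow UNIV" by simp
    moreover have "A \<in> sigma_sets UNIV (range (\<lambda>(a, b). box a b :: 'a set))"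
      using A by (simp add: borel_eq_box)
    ultimately show ?thesis
    proof (induction rule: sigma_sets_induct_disjoint)
      show "(LINT y|lborel. indicator A y * f y) = 0" if "A \<in> range (\<lambda>(a, b). box a b)" for A
        using that box by auto
      show "(LINT y|lborel. indicator {} y * f y) = 0" by simp
      show "(LINT y|lborel. indicator (UNIV - A) y * f y) = 0"
        if "A \<in> sigma_sets UNIV (range (\<lambda>(a, b). box a b))" "(LINT y|lborel. indicator A y * f y) = 0" for A
      proof -
        have "A \<in> sets borel" using that by (simp add: borel_eq_box)
        have "(LINT y|lborel. indicator (UNIV - A) y * f y) = (LINT y|lborel. f y - indicator A y * f y)"
          by (rule Bochner_Integration.integral_cong) (auto simp: indicator_def)
        then show ?thesis using U that(2) f i[OF \<open>A \<in> sets borel\<close>] by simp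
      qed
      show "(LINT y|lborel. indicator (\<Union> (range B)) y * f y) = 0"
        if "disjoint_family B" "range B \<subseteq> sigma_sets UNIV (range (\<lambda>(a, b). box a b))"
          "\<And>i. (LINT y|lborel. indicator (B i) y * f y) = 0" for B :: "nat \<Rightarrow> 'a set"
      proof -
        have B: "B i \<in> sets borel" for i using that(2) by (auto simp: borel_eq_box)
        have "(LINT y:\<Union> (range B)|lborel. f y) = (\<Sum>i. LINT y:B i|lborel. f y)"
          using that(1) B i[of "\<Union> (range B)"]
          by (intro lebesgue_integral_countable_add) (auto simp: disjoint_family_on_def set_integrable_def)
        then show ?thesis using that(3) by (simp add: set_lebesgue_integral_def)
      qed
    qed
  qed
  have fm: "f \<in> borel_measurable borel" using borel_measurable_integrable[OF f] by simp
  have s: "{y. f y > 0} \<in> sets borel" "{y. f y < 0} \<in> sets borel"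
    using fm by measurable
  have "AE y in lborel. indicator {y. f y > 0} y * f y = 0"
    using z[OF s(1)] by (subst (asm) integral_nonneg_eq_0_iff_AE[OF i[OF s(1)]]) (auto simp: indicator_def)
  moreover have "AE y in lborel. indicator {y. f y < 0} y * (- f y) = 0"
  proof -
    have "integrable lborel (\<lambda>y. indicator {y. f y < 0} y * (- f y))"
      using i[OF s(2)] by simp
    from integral_nonneg_eq_0_iff_AE[OF this] show ?thesis using z[OF s(2)] by (auto simp: indicator_def)
  qed
  ultimately show ?thesis
    by eventually_elim (auto simp: indicator_def split: if_splits)
qed

text \<open>The test functions of \<open>box_test_functions\<close> converge boundedly to box
  indicators, so \<open>f\<close> integrates to 0 over every open box whose closed box lies in
  \<open>\<Omega>\<close>. The preceding lemma is applied to \<open>f\<close> cut off to one such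
  box at a time.\<close>

lemma du_Bois_Reymond:
  fixes f :: "real^'n \<Rightarrow> real"
  assumes \<Omega>: "open \<Omega>" and f: "locally_integrable \<Omega> f"
    and test: "\<And>\<psi>. test_function \<Omega> \<psi> \<Longrightarrow> (LINT y:\<Omega>|lborel. f y * \<psi> y) = 0"
  shows "AE y in lborel. y \<in> \<Omega> \<longrightarrow> f y = 0"
proof -
  have fi: "integrable lborel (\<lambda>y. indicator (cbox a b) y * f y)" if "cbox a b \<subseteq> \<Omega>" for a b
    using f that by (simp add: locally_integrable_def set_integrable_def)
  have bi: "integrable lborel (\<lambda>y. indicator (box a b) y * f y)" if "cbox a b \<subseteq> \<Omega>" for a b
  proof -
    have "integrable lborel (\<lambda>y. indicator (box a b) y *\<^sub>R (indicator (cbox a b) y * f y))"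
      by (rule integrable_mult_indicator[OF _ fi[OF that]]) simp
    also have "(\<lambda>y. indicator (box a b) y *\<^sub>R (indicator (cbox a b) y * f y)) =
        (\<lambda>y. indicator (box a b) y * f y)"
      using box_subset_cbox[of a b] by (intro ext) (auto simp: indicator_def)
    finally show ?thesis .
  qed
  have z: "(LINT y|lborel. indicator (box a b) y * f y) = 0" if ab: "cbox a b \<subseteq> \<Omega>" for a b
  proof -
    obtain \<psi> where \<psi>: "\<And>k. test_function \<Omega> (\<psi> k)" "\<And>k y. \<bar>\<psi> k y\<bar> \<le> 1"
      "\<And>y. (\<lambda>k. \<psi> k y) \<longlonglongrightarrow> indicator (box a b) y"
      "\<And>k y. y \<notin> cbox a b \<Longrightarrow> \<psi> k y = 0"
      using box_test_functions[OF ab] by metis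
    have "(\<lambda>k. LINT y|lborel. (indicator (cbox a b) y * f y) * \<psi> k y) \<longlonglongrightarrow>
        (LINT y|lborel. (indicator (cbox a b) y * f y) * indicator (box a b) y)"
    proof (rule integral_dominated_convergence[where w = "\<lambda>y. \<bar>indicator (cbox a b) y * f y\<bar>"])
      show "integrable lborel (\<lambda>y. \<bar>indicator (cbox a b) y * f y\<bar>)" using fi[OF ab] by simp
      show "(\<lambda>y. indicator (cbox a b) y * f y * \<psi> k y) \<in> borel_measurable lborel" for k
        using smooth_on_continuous_on[OF test_function_smooth[OF \<psi>(1)[of k]]]
        by (intro borel_measurable_times[OF borel_measurable_integrable[OF fi[OF ab]]])
          (simp add: borel_measurable_continuous_onI)
      show "(\<lambda>y. indicator (cbox a b) y * f y * indicator (box a b) y) \<in> borel_measurable lborel"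
        by (intro borel_measurable_times[OF borel_measurable_integrable[OF fi[OF ab]]]) simp
      show "AE y in lborel. (\<lambda>k. indicator (cbox a b) y * f y * \<psi> k y) \<longlonglongrightarrow>
          indicator (cbox a b) y * f y * indicator (box a b) y"
        by (intro AE_I2 tendsto_mult tendsto_const \<psi>(3))
      show "AE y in lborel. norm (indicator (cbox a b) y * f y * \<psi> k y) \<le> \<bar>indicator (cbox a b) y * f y\<bar>" for k
        using mult_left_mono[OF \<psi>(2), of "\<bar>indicator (cbox a b) _ * f _\<bar>"]
        by (intro AE_I2) (simp add: abs_mult)
    qed
    moreover have "(LINT y|lborel. (indicator (cbox a b) y * f y) * \<psi> k y) = 0" for k
    proof -
      have "(\<lambda>y. (indicator (cbox a b) y * f y) * \<psi> k y) = (\<lambda>y. indicator \<Omega> y *\<^sub>R (f y * \<psi> k y))"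
        using ab \<psi>(4)[of _ k] by (intro ext) (auto simp: indicator_def)
      then show ?thesis using test[OF \<psi>(1)[of k]] by (simp add: set_lebesgue_integral_def)
    qed
    moreover have "(\<lambda>y. (indicator (cbox a b) y * f y) * indicator (box a b) y) = (\<lambda>y. indicator (box a b) y * f y)"
      using box_subset_cbox[of a b] by (intro ext) (auto simp: indicator_def)
    ultimately show ?thesis by (simp add: LIMSEQ_const_iff)
  qed
  have ae: "AE y in lborel. y \<in> box a b \<longrightarrow> f y = 0" if ab: "cbox a b \<subseteq> \<Omega>" for a b
  proof -
    have "AE y in lborel. indicator (box a b) y * f y = 0"
    proof (rule integrable_zero_on_boxes_AE[OF bi[OF ab] z[OF ab]])
      fix c d :: "real^'n"
      obtain p q where pq: "box c d \<inter> box a b = box p q" by (simp add: box_Int_box)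
      have "(LINT y|lborel. indicator (box p q) y * f y) = 0"
      proof (cases "box p q = {}")
        case False
        \<comment> \<open>A nonempty open box has the closed box as its closure. An empty one says
          nothing about where its corners lie, which is why this case is split off.\<close>
        then have "cbox p q \<subseteq> cbox a b"
          using pq closure_mono[of "box p q" "box a b"] by (metis box_eq_empty(1) closure_box closure_empty closure_mono inf_le2 subset_empty)
        then show ?thesis using z ab by blast
      qed simp
      moreover have "(\<lambda>y. indicator (box c d) y * (indicator (box a b) y * f y)) = (\<lambda>y. indicator (box p q) y * f y)"
        unfolding pq[symmetric] by (intro ext) (auto simp: indicator_def)
      ultimately show "(LINT y|lborel. indicator (box c d) y * (indicator (box a b) y * f y)) = 0" by simp
    qed
    then show ?thesis by eventually_elim (auto simp: indicator_def)
  qed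
  \<comment> \<open>Lindelof reduces the cover of \<open>\<Omega>\<close> by boxes to a countable
    one, as null sets may only be united countably often.\<close>
  define \<F> where "\<F> = {box a b | a b. cbox a b \<subseteq> \<Omega>}"
  obtain \<F>' where F': "\<F>' \<subseteq> \<F>" "countable \<F>'" "\<Union>\<F>' = \<Union>\<F>"
    using Lindelof[of \<F>] by (auto simp: \<F>_def)
  have "AE y in lborel. \<forall>B\<in>\<F>'. y \<in> B \<longrightarrow> f y = 0"
    using F'(1,2) ae by (subst AE_ball_countable) (auto simp: \<F>_def)
  moreover have "\<Omega> \<subseteq> \<Union>\<F>'"
  proof
    fix y assume "y \<in> \<Omega>"
    then obtain a b where "cbox a b \<subseteq> \<Omega>" "y \<in> box a b"
      using \<Omega> by (metis open_contains_cbox)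
    then show "y \<in> \<Union>\<F>'" unfolding F'(3) \<F>_def by blast
  qed
  ultimately show ?thesis by (auto elim!: eventually_mono)
qed

lemma continuous_AE_zero_imp_zero:
  fixes f :: "'a::euclidean_space \<Rightarrow> real"
  assumes "open U" "continuous_on U f" "AE y in lborel. y \<in> U \<longrightarrow> f y = 0" "y \<in> U"
  shows "f y = 0"
proof (rule ccontr)
  assume "f y \<noteq> 0"
  define W where "W = U \<inter> f -` (- {0})"
  have "open W" unfolding W_def using assms by (intro continuous_open_preimage) auto
  moreover have "y \<in> W" using assms \<open>f y \<noteq> 0\<close> by (simp add: W_def)
  ultimately obtain e where e: "e > 0" "ball y e \<subseteq> W" by (auto simp: open_contains_ball)
  have "AE z in lborel. z \<notin> ball y e" using assms(3) e(2) by (auto simp: W_def elim!: eventually_mono)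
  then have "ball y e \<in> null_sets lborel" by (subst (asm) AE_iff_null_sets[symmetric]) auto
  then have "measure lborel (ball y e) = 0" by (simp add: null_setsD1 measure_def)
  then show False using content_ball_pos[OF e(1), of y] by simp
qed

section \<open>Approximate fundamental solutions\<close>

text \<open>Up to a constant factor, the Euclidean Laplacian of the regularised fundamental
  solution, that is of \<open>|z|^2 + r^2\<close> to the power \<open>1 - n/2\<close> (of its
  logarithm for n = 2). It has the form \<open>r^(-n) k(z/r)\<close> with a fixed profile
  \<open>k\<close>, so it concentrates at 0 as \<open>r\<close> tends to 0 while keeping its
  mass.\<close>

definition reg_kernel :: "real \<Rightarrow> real^'n \<Rightarrow> real" where
  "reg_kernel r z = r\<^sup>2 * ((norm z)\<^sup>2 + r\<^sup>2) powr (- (CARD('n) / 2) - 1)"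

lemma reg_kernel_nonneg: "0 \<le> reg_kernel r z"
  by (simp add: reg_kernel_def)

lemma reg_kernel_measurable [measurable]: "(\<lambda>y. reg_kernel r (y - x)) \<in> borel_measurable borel"
  unfolding reg_kernel_def by measurable

lemma reg_kernel_le:
  fixes z :: "real^'n"
  assumes "0 < \<rho>" "\<rho>\<^sup>2 \<le> (norm z)\<^sup>2 + r\<^sup>2"
  shows "reg_kernel r z \<le> r\<^sup>2 / \<rho> ^ (CARD('n) + 2)"
proof -
  have "((norm z)\<^sup>2 + r\<^sup>2) powr (- (CARD('n) / 2) - 1) \<le> (\<rho>\<^sup>2) powr (- (CARD('n) / 2) - 1)"
    using assms by (intro powr_mono2') auto
  also have "\<dots> = (\<rho> powr 2) powr (- (CARD('n) / 2) - 1)" using assms(1) by simp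
  also have "\<dots> = \<rho> powr (- real (CARD('n) + 2))" by (simp add: powr_powr algebra_simps)
  also have "\<dots> = 1 / \<rho> ^ (CARD('n) + 2)"
    using assms(1) by (simp only: powr_minus powr_realpow) (simp add: field_simps)
  finally show ?thesis unfolding reg_kernel_def using mult_left_mono[of _ _ "r\<^sup>2"] by fastforce
qed

text \<open>A dyadic decomposition replaces the exact integral. On the k-th shell the kernel is at
  most \<open>r^2 / (2^k r / 2)^(n+2)\<close> and the enclosing ball has volume proportional to
  \<open>(2^k r)^n\<close>, so the contributions form a geometric series of ratio 1/4, with a sum
  independent of \<open>r\<close> and \<open>x\<close>.\<close>

lemma reg_kernel_mass:
  obtains C where "0 \<le> C" "\<And>r (x :: real^'n). 0 < r \<Longrightarrow> integrable lborel (\<lambda>y. reg_kernel r (y - x))"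
    "\<And>r (x :: real^'n). 0 < r \<Longrightarrow> (LINT y|lborel. reg_kernel r (y - x)) \<le> C"
proof -
  let ?n = "CARD('n)"
  define c where "c = 2 ^ (?n + 2) * measure lborel (ball (0 :: real^'n) 1)"
  have c0: "0 \<le> c" by (simp add: c_def)
  define C where "C = (\<Sum>k. c * (1 / 4) ^ k)"
  have sm: "summable (\<lambda>k. c * (1 / 4) ^ k)" by (intro summable_mult summable_geometric) simp
  have C0: "0 \<le> C" unfolding C_def using c0 by (intro suminf_nonneg sm) simp
  have nn: "(\<integral>\<^sup>+ y. ennreal (reg_kernel r (y - x)) \<partial>lborel) \<le> ennreal C" if r: "0 < r" for r and x :: "real^'n"
  proof -
    \<comment> \<open>dyadic shells: \<open>T k\<close> dominates the kernel where the distance to \<open>x\<close> is between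
      \<open>2\<^sup>k r / 2\<close> and \<open>2\<^sup>k r\<close>\<close>
    define T where "T k y = r\<^sup>2 / (2 ^ k * r / 2) ^ (?n + 2) * indicator (ball x (2 ^ k * r)) y" for k :: nat and y
    have T: "(\<integral>\<^sup>+ y. ennreal (T k y) \<partial>lborel) = ennreal (c * (1 / 4) ^ k)" for k
    proof -
      have "(\<integral>\<^sup>+ y. ennreal (T k y) \<partial>lborel) =
          (\<integral>\<^sup>+ y. ennreal (r\<^sup>2 / (2 ^ k * r / 2) ^ (?n + 2)) * indicator (ball x (2 ^ k * r)) y \<partial>lborel)"
        unfolding T_def by (intro nn_integral_cong) (auto simp: indicator_def)
      also have "\<dots> = ennreal (r\<^sup>2 / (2 ^ k * r / 2) ^ (?n + 2)) * emeasure lborel (ball x (2 ^ k * r))"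
        by (simp add: nn_integral_cmult_indicator)
      also have "emeasure lborel (ball x (2 ^ k * r)) = ennreal (measure lborel (ball x (2 ^ k * r)))"
        using emeasure_lborel_ball_finite[of x "2 ^ k * r"] by (simp add: emeasure_eq_ennreal_measure)
      also have "measure lborel (ball x (2 ^ k * r)) = (2 ^ k * r) ^ ?n * measure lborel (ball (0 :: real^'n) 1)"
        using content_ball_conv_unit_ball[of "2 ^ k * r" x] r by simp
      also have "ennreal (r\<^sup>2 / (2 ^ k * r / 2) ^ (?n + 2)) * ennreal ((2 ^ k * r) ^ ?n * measure lborel (ball (0 :: real^'n) 1)) =
          ennreal (r\<^sup>2 / (2 ^ k * r / 2) ^ (?n + 2) * ((2 ^ k * r) ^ ?n * measure lborel (ball (0 :: real^'n) 1)))"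
        by (rule ennreal_mult'[symmetric]) (use r in simp)
      also have "r\<^sup>2 / (2 ^ k * r / 2) ^ (?n + 2) * ((2 ^ k * r) ^ ?n * measure lborel (ball (0 :: real^'n) 1)) =
          c * (1 / 4) ^ k"
      proof -
        have "(2::real) ^ k * 2 ^ k = 4 ^ k" by (simp add: power_mult_distrib[symmetric])
        then have "(1 / 4 :: real) ^ k = 1 / (2 ^ k * 2 ^ k)" by (simp add: power_one_over)
        then show ?thesis using r unfolding c_def
          by (simp add: power_add power_divide power_mult_distrib power2_eq_square field_simps)
      qed
      finally show ?thesis .
    qed
    have "(\<integral>\<^sup>+ y. ennreal (reg_kernel r (y - x)) \<partial>lborel) \<le> (\<integral>\<^sup>+ y. (\<Sum>k. ennreal (T k y)) \<partial>lborel)"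
    proof (rule nn_integral_mono)
      fix y :: "real^'n"
      obtain m :: nat where "norm (y - x) / r < 2 ^ m" using real_arch_pow[of 2 "norm (y - x) / r"] by auto
      then have ex: "norm (y - x) < 2 ^ m * r" using r by (simp add: field_simps)
      \<comment> \<open>By minimality the ball of half the radius misses \<open>y\<close>, which
        bounds the distance from below; for \<open>k = 0\<close> the summand \<open>r^2\<close>
        supplies the lower bound.\<close>
      define k where "k = (LEAST m. norm (y - x) < 2 ^ m * r)"
      have k: "norm (y - x) < 2 ^ k * r" unfolding k_def by (rule LeastI) (rule ex)
      have "(2 ^ k * r / 2)\<^sup>2 \<le> (norm (y - x))\<^sup>2 + r\<^sup>2"
      proof (cases k)
        case 0
        have "(r / 2)\<^sup>2 \<le> r\<^sup>2" using r by (intro power_mono) auto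
        then show ?thesis using 0 by (simp add: add_increasing)
      next
        case (Suc j)
        then have "\<not> norm (y - x) < 2 ^ j * r" using not_less_Least[of j "\<lambda>m. norm (y - x) < 2 ^ m * r"]
            by (simp add: k_def)
        then have "(2 ^ k * r / 2)\<^sup>2 \<le> (norm (y - x))\<^sup>2" using Suc r by (intro power_mono) auto
        then show ?thesis by (simp add: add_increasing2)
      qed
      then have "reg_kernel r (y - x) \<le> r\<^sup>2 / (2 ^ k * r / 2) ^ (?n + 2)"
        using r by (intro reg_kernel_le) auto
      also have "\<dots> = T k y" using k by (simp add: T_def dist_norm norm_minus_commute)
      finally have "ennreal (reg_kernel r (y - x)) \<le> ennreal (T k y)" by (rule ennreal_leI)
      also have "\<dots> \<le> (\<Sum>k. ennreal (T k y))"
        using sum_le_suminf[of "\<lambda>k. ennreal (T k y)" "{k}"] by simp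
      finally show "ennreal (reg_kernel r (y - x)) \<le> (\<Sum>k. ennreal (T k y))" .
    qed
    also have "\<dots> = (\<Sum>k. \<integral>\<^sup>+ y. ennreal (T k y) \<partial>lborel)"
    proof (intro nn_integral_suminf measurable_compose[OF _ measurable_ennreal])
      show "T k \<in> borel_measurable lborel" for k
        unfolding T_def by (intro borel_measurable_times borel_measurable_const borel_measurable_indicator) simp
    qed
    also have "\<dots> = ennreal C"
      unfolding T C_def using c0 sm by (intro suminf_ennreal2) auto
    finally show ?thesis .
  qed
  have int: "integrable lborel (\<lambda>y. reg_kernel r (y - x))" if "0 < r" for r and x :: "real^'n"
    using nn[OF that, of x] reg_kernel_nonneg[of r]
    by (intro integrableI_nonneg) (auto intro: le_less_trans)
  moreover have "(LINT y|lborel. reg_kernel r (y - x)) \<le> C" if "0 < r" for r and x :: "real^'n"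
  proof -
    have "ennreal (LINT y|lborel. reg_kernel r (y - x)) \<le> ennreal C"
      using nn_integral_eq_integral[OF int[OF that, of x] AE_I2[OF reg_kernel_nonneg]] nn[OF that, of x] by simp
    then show ?thesis using C0 by (simp add: ennreal_le_iff)
  qed
  ultimately show thesis using C0 that by blast
qed

text \<open>The upper half of the approximate identity property. Near \<open>x\<close> continuity
  bounds \<open>g\<close> by \<open>g x + \<eta>\<close>; at distance at least \<open>\<tau>\<close>
  the kernel itself is at most \<open>r^2 / \<tau>^(n+2)\<close>, which is small against the
  integral of \<open>g\<close>.\<close>

lemma reg_kernel_limit:
  fixes g :: "real^'n \<Rightarrow> real"
  assumes C: "0 \<le> C" "\<And>r (x :: real^'n). 0 < r \<Longrightarrow> integrable lborel (\<lambda>y. reg_kernel r (y - x))"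
    "\<And>r (x :: real^'n). 0 < r \<Longrightarrow> (LINT y|lborel. reg_kernel r (y - x)) \<le> C"
    and g: "integrable lborel g" "AE y in lborel. 0 \<le> g y" "isCont g x" "0 \<le> g x" and "0 < \<eta>"
  obtains r0 where "0 < r0" "\<And>r. 0 < r \<Longrightarrow> r < r0 \<Longrightarrow> integrable lborel (\<lambda>y. g y * reg_kernel r (y - x))"
    "\<And>r. 0 < r \<Longrightarrow> r < r0 \<Longrightarrow> (LINT y|lborel. g y * reg_kernel r (y - x)) \<le> C * (g x + \<eta>) + \<eta>"
proof -
  let ?n = "CARD('n)"
  obtain \<tau> where \<tau>: "0 < \<tau>" "\<And>y. dist y x < \<tau> \<Longrightarrow> g y \<le> g x + \<eta>"
  proof -
    have "\<exists>d>0. \<forall>y. dist y x < d \<longrightarrow> dist (g y) (g x) < \<eta>"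
      using g(3) \<open>0 < \<eta>\<close> by (simp add: continuous_at)  (metis continuous_at_eps_delta g(3))
    then show ?thesis using that by (force simp: dist_real_def)
  qed
  \<comment> \<open>The added 1 keeps the denominator in \<open>r0\<close> positive when
    \<open>g\<close> has integral 0.\<close>
  define I where "I = (LINT y|lborel. g y) + 1"
  have I: "I > 0" using integral_nonneg_AE[OF g(2)] by (simp add: I_def)
  define r0 where "r0 = sqrt (\<eta> * \<tau> ^ (?n + 2) / I)"
  have r0: "0 < r0" using \<open>0 < \<eta>\<close> \<tau>(1) I by (simp add: r0_def)
  have r2: "r\<^sup>2 / \<tau> ^ (?n + 2) * (LINT y|lborel. g y) \<le> \<eta>" if "0 < r" "r < r0" for r
  proof -
    have "r\<^sup>2 \<le> r0\<^sup>2" using that by (intro power_mono) auto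
    also have "r0\<^sup>2 = \<eta> * \<tau> ^ (?n + 2) / I" unfolding r0_def using \<open>0 < \<eta>\<close> \<tau>(1) I by simp
    finally have "r\<^sup>2 / \<tau> ^ (?n + 2) * I \<le> \<eta>" using \<tau>(1) I by (simp add: field_simps)
    moreover have "r\<^sup>2 / \<tau> ^ (?n + 2) * (LINT y|lborel. g y) \<le> r\<^sup>2 / \<tau> ^ (?n + 2) * I"
      using \<tau>(1) by (intro mult_left_mono) (auto simp: I_def)
    ultimately show ?thesis by linarith
  qed
  define b where "b r y = (g x + \<eta>) * reg_kernel r (y - x) + r\<^sup>2 / \<tau> ^ (?n + 2) * g y" for r y
  have bi: "integrable lborel (b r)" if "0 < r" for r
    unfolding b_def using C(2)[OF that] g(1) by simp
  have le: "AE y in lborel. 0 \<le> g y * reg_kernel r (y - x) \<and> g y * reg_kernel r (y - x) \<le> b r y" for r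
    using g(2)
  proof eventually_elim
    case (elim y)
    have k: "0 \<le> reg_kernel r (y - x)" by (rule reg_kernel_nonneg)
    show ?case
    proof (cases "dist y x < \<tau>")
      case True
      then have "g y * reg_kernel r (y - x) \<le> (g x + \<eta>) * reg_kernel r (y - x)"
        using \<tau>(2) k by (intro mult_right_mono)
      moreover have "0 \<le> r\<^sup>2 / \<tau> ^ (?n + 2) * g y" using elim \<tau>(1) by simp
      ultimately show ?thesis using elim k by (simp add: b_def)
    next
      case False
      have "\<tau>\<^sup>2 \<le> (norm (y - x))\<^sup>2" using False \<tau>(1) by (intro power_mono) (auto simp: dist_norm)
      then have "reg_kernel r (y - x) \<le> r\<^sup>2 / \<tau> ^ (?n + 2)"
        using \<tau>(1) by (intro reg_kernel_le) (auto simp: add_increasing2)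
      then have "g y * reg_kernel r (y - x) \<le> r\<^sup>2 / \<tau> ^ (?n + 2) * g y"
        using elim by (metis mult.commute mult_right_mono)
      moreover have "0 \<le> (g x + \<eta>) * reg_kernel r (y - x)" using g(4) \<open>0 < \<eta>\<close> k by simp
      ultimately show ?thesis using elim k by (simp add: b_def)
    qed
  qed
  have int: "integrable lborel (\<lambda>y. g y * reg_kernel r (y - x))" if "0 < r" for r
  proof (rule Bochner_Integration.integrable_bound[OF bi[OF that]])
    show "(\<lambda>y. g y * reg_kernel r (y - x)) \<in> borel_measurable lborel"
      using borel_measurable_integrable[OF g(1)] by measurable
    show "AE y in lborel. norm (g y * reg_kernel r (y - x)) \<le> norm (b r y)"
      using le[of r] by eventually_elim simp
  qed
  show thesis
  proof
    show "0 < r0" by (rule r0)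
    fix r assume r: "0 < r" "r < r0"
    show "integrable lborel (\<lambda>y. g y * reg_kernel r (y - x))" by (rule int[OF r(1)])
    have "(LINT y|lborel. g y * reg_kernel r (y - x)) \<le> (LINT y|lborel. b r y)"
      using le[of r] by (intro integral_mono_AE int bi r(1)) (auto elim: eventually_mono)
    also have "\<dots> = (g x + \<eta>) * (LINT y|lborel. reg_kernel r (y - x)) + r\<^sup>2 / \<tau> ^ (?n + 2) * (LINT y|lborel. g y)"
      unfolding b_def using C(2)[OF r(1)] g(1) by simp
    also have "\<dots> \<le> (g x + \<eta>) * C + \<eta>"
      using C(3)[OF r(1)] g(4) \<open>0 < \<eta>\<close> r2[OF r] by (intro add_mono mult_left_mono) auto
    finally show "(LINT y|lborel. g y * reg_kernel r (y - x)) \<le> C * (g x + \<eta>) + \<eta>" by (simp add: mult.commute)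
  qed
qed

text \<open>The powers of \<open>s\<close> below are the derivatives of the fundamental solution in dimension \<open>n\<close>
  regularised by \<open>s = Q + r\<^sup>2\<close>, corrected by a less singular term (weight \<open>K\<close>) that absorbs the
  variation of the coefficients.\<close>

lemma radial_inequality:
  fixes n C1 K s Q r e l :: real
  defines "f1 \<equiv> - (s powr (- n / 2)) + K * s powr (- (n - 1) / 2)"
    and "f2 \<equiv> n / 2 * s powr (- n / 2 - 1) - K * ((n - 1) / 2) * s powr (- (n + 1) / 2)"
  assumes "2 \<le> n" "0 \<le> C1" "K = C1 * (n / 2 + 1) + 1" "0 \<le> Q" "0 < r" "s = Q + r\<^sup>2" "K * sqrt s \<le> 1"
    "\<bar>e - 4 * Q\<bar> \<le> C1 * (Q * sqrt Q)" "\<bar>l - 2 * n\<bar> \<le> C1 * sqrt Q"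
  shows "- (2 * n * r\<^sup>2 * s powr (- n / 2 - 1)) + s powr (- (n - 1) / 2) \<le> e * f2 + l * f1"
    and "f1 \<le> 0"
proof -
  have s: "0 < s" using assms by (simp add: add_nonneg_pos)
  \<comment> \<open>With these abbreviations every power of \<open>s\<close> in the statement is
    \<open>p\<close> divided by an integer power of \<open>\<sigma>\<close>, and the estimates
    become rational.\<close>
  define \<sigma> where "\<sigma> = sqrt s"
  define p where "p = s powr (- (n - 1) / 2)"
  have \<sigma>: "0 < \<sigma>" "s = \<sigma> * \<sigma>" "s powr (1 / 2) = \<sigma>"
    using s by (simp_all add: \<sigma>_def powr_half_sqrt)
  have p: "0 < p" using s by (simp add: p_def)
  have 1: "s powr (- n / 2) = p / \<sigma>"
  proof -
    have "s powr (- n / 2) = s powr (- (n - 1) / 2 - 1 / 2)" by (rule arg_cong[of _ _ "\<lambda>a. s powr a"]) (simp add: field_simps)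
    then show ?thesis by (simp add: powr_diff p_def \<sigma>(3))
  qed
  have 2: "s powr (- n / 2 - 1) = p / \<sigma> / s" using s by (simp only: powr_diff 1) simp
  have 3: "s powr (- (n + 1) / 2) = p / s"
  proof -
    have "s powr (- (n + 1) / 2) = s powr (- (n - 1) / 2 - 1)" by (rule arg_cong[of _ _ "\<lambda>a. s powr a"]) (simp add: field_simps)
    then show ?thesis using s by (simp add: powr_diff p_def)
  qed
  have f1: "f1 = - (p / \<sigma>) + K * p" unfolding f1_def 1 p_def ..
  have f2: "f2 = n / 2 * (p / \<sigma> / s) - K * ((n - 1) / 2) * (p / s)" unfolding f2_def 2 3 ..
  have K: "1 \<le> K" using assms by simp
  have K\<sigma>: "K * \<sigma> \<le> 1" using assms by (simp add: \<sigma>_def)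
  \<comment> \<open>The condition \<open>K * sqrt s <= 1\<close> says that the correction term does
    not exceed the leading one. It fixes the sign of \<open>f1\<close> and bounds \<open>f1\<close>
    and \<open>f2\<close> by their leading terms.\<close>
  have Kp: "K * p \<le> p / \<sigma>" using K\<sigma> \<sigma>(1) p by (simp add: field_simps)
  show "f1 \<le> 0" using Kp by (simp add: f1)
  have f1b: "\<bar>f1\<bar> \<le> p / \<sigma>" using Kp K p \<sigma>(1) by (simp add: f1)
  have Kps: "K * (p / s) \<le> p / \<sigma> / s" using Kp s by (simp add: field_simps)
  have "K * ((n - 1) / 2) * (p / s) \<le> n / 2 * (p / \<sigma> / s)"
  proof -
    have "((n - 1) / 2) * (K * (p / s)) \<le> (n / 2) * (p / \<sigma> / s)"
      using Kps assms(3) K p s by (intro mult_mono) auto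
    then show ?thesis by (simp add: mult_ac)
  qed
  moreover have "0 \<le> K * ((n - 1) / 2) * (p / s)" using K p s assms(3) by simp
  moreover have "0 \<le> n / 2 * (p / \<sigma> / s)" using p s \<sigma> assms(3) by simp
  ultimately have f2b: "\<bar>f2\<bar> \<le> n / 2 * (p / \<sigma> / s)" by (simp add: f2)
  have Qs: "0 \<le> Q" "Q \<le> s" "sqrt Q \<le> \<sigma>" using assms by (auto simp: \<sigma>_def)
  have E1: "\<bar>(e - 4 * Q) * f2\<bar> \<le> C1 * (n / 2) * p"
  proof -
    have "\<bar>(e - 4 * Q) * f2\<bar> \<le> (C1 * (Q * sqrt Q)) * (n / 2 * (p / \<sigma> / s))"
      unfolding abs_mult using assms f2b by (intro mult_mono) auto
    also have "\<dots> \<le> (C1 * (s * \<sigma>)) * (n / 2 * (p / \<sigma> / s))"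
      using Qs assms p s \<sigma> by (intro mult_right_mono mult_left_mono mult_mono) auto
    also have "\<dots> = C1 * (n / 2) * p" using s \<sigma>(1) by (simp add: field_simps)
    finally show ?thesis .
  qed
  have E2: "\<bar>(l - 2 * n) * f1\<bar> \<le> C1 * p"
  proof -
    have "\<bar>(l - 2 * n) * f1\<bar> \<le> (C1 * sqrt Q) * (p / \<sigma>)"
      unfolding abs_mult using assms f1b by (intro mult_mono) auto
    also have "\<dots> \<le> (C1 * \<sigma>) * (p / \<sigma>)"
      using Qs assms p \<sigma> by (intro mult_right_mono mult_left_mono) auto
    also have "\<dots> = C1 * p" using \<sigma>(1) by (simp add: field_simps)
    finally show ?thesis .
  qed
  \<comment> \<open>The unperturbed case \<open>e = 4 Q\<close>, \<open>l = 2 n\<close>. The leading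
    powers cancel up to the \<open>r^2\<close> term, and the correction leaves a surplus of at least
    \<open>2 K p\<close>.\<close>
  have "4 * Q * f2 + 2 * n * f1 = - (2 * n * r\<^sup>2 * (p / \<sigma> / s)) + K * (p / s) * (2 * s + 2 * (n - 1) * r\<^sup>2)"
  proof -
    have Q: "Q = s - r\<^sup>2" using assms by simp
    define A B where "A = p / \<sigma> / s" and "B = p / s"
    have f1': "f1 = - (s * A) + K * (s * B)" using s by (simp add: f1 A_def B_def)
    have f2': "f2 = n / 2 * A - K * ((n - 1) / 2) * B" by (simp add: f2 A_def B_def)
    have "4 * Q * f2 + 2 * n * f1 = - (2 * n * r\<^sup>2 * A) + K * B * (2 * s + 2 * (n - 1) * r\<^sup>2)"
      unfolding f1' f2' Q by (simp add: field_simps)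
    then show ?thesis by (simp add: A_def B_def)
  qed
  moreover have "K * (p / s) * (2 * s + 2 * (n - 1) * r\<^sup>2) \<ge> 2 * K * p"
  proof -
    have "K * (p / s) * (2 * s + 2 * (n - 1) * r\<^sup>2) \<ge> K * (p / s) * (2 * s)"
      using K p s assms(3) by (intro mult_left_mono) auto
    then show ?thesis using s by (simp add: field_simps)
  qed
  moreover have "e * f2 + l * f1 = (4 * Q * f2 + 2 * n * f1) + (e - 4 * Q) * f2 + (l - 2 * n) * f1"
    by (simp add: algebra_simps)
  \<comment> \<open>The surplus pays for the errors \<open>E1\<close> and \<open>E2\<close> and
    still leaves \<open>p\<close>; the value of \<open>K\<close> is made for this.\<close>
  moreover have "C1 * (n / 2) * p + C1 * p + p \<le> 2 * K * p"
  proof -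
    have "C1 * (n / 2) * p + C1 * p + p = K * p" unfolding assms(5) by (simp add: algebra_simps)
    then show ?thesis using K p by simp
  qed
  ultimately show "- (2 * n * r\<^sup>2 * s powr (- n / 2 - 1)) + s powr (- (n - 1) / 2) \<le> e * f2 + l * f1"
    unfolding 2 p_def[symmetric] using E1 E2 by linarith
qed

text \<open>\<open>F1\<close> and \<open>F2\<close> are the first two derivatives of the profile. In
  the last clause \<open>e\<close> and \<open>l\<close> stand for the values of
  \<open>gradient_form a Q\<close> and \<open>divop a Q\<close> at one point: exactly
  \<open>4 Q\<close> and \<open>2 n\<close> for constant coefficients, with a slack
  \<open>C1\<close> for variable ones.\<close>

definition is_radial_profile ::
  "real \<Rightarrow> real \<Rightarrow> real \<Rightarrow> (real \<Rightarrow> real) \<Rightarrow> (real \<Rightarrow> real) \<Rightarrow> (real \<Rightarrow> real) \<Rightarrow> bool" where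
  "is_radial_profile n C1 S0 F F1 F2 \<longleftrightarrow>
     smooth_on {0<..} F \<and>
     (\<forall>s>0. (F has_real_derivative F1 s) (at s) \<and> (F1 has_real_derivative F2 s) (at s)) \<and>
     (\<forall>s\<ge>S0. F s = 0) \<and> (\<forall>s>0. 0 \<le> F s) \<and> 0 < F (S0 / 2) \<and> (\<forall>s t. 0 < s \<longrightarrow> s \<le> t \<longrightarrow> F t \<le> F s) \<and>
     (\<forall>Q r e l. 0 \<le> Q \<longrightarrow> 0 < r \<longrightarrow> 0 \<le> e \<longrightarrow> \<bar>e - 4 * Q\<bar> \<le> C1 * (Q * sqrt Q) \<longrightarrow> \<bar>l - 2 * n\<bar> \<le> C1 * sqrt Q \<longrightarrow>
       flat_exp 0 (S0 - (Q + r\<^sup>2)) - 2 * n * r\<^sup>2 * (Q + r\<^sup>2) powr (- n / 2 - 1)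
         \<le> e * F2 (Q + r\<^sup>2) + l * F1 (Q + r\<^sup>2))"

text \<open>The cutoff is applied to the derivative \<open>f1\<close> and the product is then
  integrated. In this way differentiating the cutoff produces only one extra term, multiplied by
  \<open>f1 <= 0\<close> and \<open>e >= 0\<close>, and that term has the favourable sign.\<close>

lemma radial_profile:
  fixes n C1 :: real
  assumes n: "2 \<le> n" and C1: "0 \<le> C1"
  obtains S1 where "0 < S1" "\<And>S0. 0 < S0 \<Longrightarrow> S0 \<le> S1 \<Longrightarrow> \<exists>F F1 F2. is_radial_profile n C1 S0 F F1 F2"
proof -
  define K where "K = C1 * (n / 2 + 1) + 1"
  have K: "1 \<le> K" using assms by (simp add: K_def)
  \<comment> \<open>This makes \<open>K * sqrt s\<close> at most 1/2 below \<open>S1\<close>, so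
    that \<open>f1\<close> is strictly negative there. Also \<open>S1 <= 1\<close>, so the negative
    power of \<open>s\<close> gained in \<open>radial_inequality\<close> is at least 1.\<close>
  define S1 where "S1 = (1 / (2 * K))\<^sup>2"
  have S1: "0 < S1" using K by (simp add: S1_def)
  have KS1: "K * sqrt S1 = 1 / 2" using K by (simp add: S1_def real_sqrt_divide)
  have S1_le: "S1 \<le> 1" unfolding S1_def using K by (intro power_le_one) auto
  show thesis
  proof (rule that[OF S1])
    fix S0 :: real assume S0: "0 < S0" "S0 \<le> S1"
    define f1 where "f1 s = - (s powr (- n / 2)) + K * s powr (- (n - 1) / 2)" for s
    define f2 where "f2 s = n / 2 * s powr (- n / 2 - 1) - K * ((n - 1) / 2) * s powr (- (n + 1) / 2)" for s
    define \<theta> where "\<theta> s = flat_exp 0 (S0 - s)" for s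
    define F1 where "F1 s = f1 s * \<theta> s" for s
    define F2 where "F2 s = f2 s * \<theta> s - f1 s * flat_exp 2 (S0 - s)" for s
    have d\<theta>: "(\<theta> has_real_derivative - flat_exp 2 (S0 - s)) (at s)" for s
    proof -
      have "((\<lambda>s. S0 - s) has_real_derivative - 1) (at s)" by (auto intro!: derivative_eq_intros)
      from DERIV_chain2[OF flat_exp_deriv this, of 0] show ?thesis
        unfolding \<theta>_def by (simp add: numeral_2_eq_2)
    qed
    have df1: "(f1 has_real_derivative f2 s) (at s)" if "0 < s" for s
      unfolding f1_def[abs_def] f2_def using that
      by (auto intro!: derivative_eq_intros simp: field_simps)
    have dF1: "(F1 has_real_derivative F2 s) (at s)" if "0 < s" for s
      unfolding F1_def[abs_def] F2_def using DERIV_mult[OF df1[OF that] d\<theta>] by (simp add: algebra_simps)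
    have CkF1: "Ck_on k {0<..} F1" for k
    proof -
      have "Ck_on k {0<..} \<theta>" unfolding \<theta>_def
        by (rule Ck_on_compose_real[OF _ _ Ck_on_flat_exp])
          (auto intro!: Ck_on_diff Ck_on_const Ck_on_bounded_linear[OF bounded_linear_ident])
      moreover have "Ck_on k {0<..} f1" unfolding f1_def
        by (intro Ck_on_add Ck_on_minus Ck_on_mult Ck_on_const Ck_on_powr) simp_all
      ultimately show ?thesis unfolding F1_def by (intro Ck_on_mult) simp_all
    qed
    have "isCont F1 s" if "0 < s" for s using dF1[OF that] by (rule DERIV_isCont)
    \<comment> \<open>\<open>F1\<close> is continuous on the half line, hence has an antiderivative.
      \<open>F\<close> below is the one vanishing at \<open>S0\<close>, and it stays 0 beyond
      because \<open>F1\<close> does.\<close>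
    then obtain H where H: "\<And>s. 0 < s \<Longrightarrow> (H has_real_derivative F1 s) (at s)"
      using einterval_antiderivative[of 0 \<infinity> F1] by (auto simp: has_real_derivative_iff_has_vector_derivative zero_ereal_def)
    define F where "F s = H s - H S0" for s
    have dF: "(F has_real_derivative F1 s) (at s)" if "0 < s" for s
      unfolding F_def using H[OF that] by (auto intro!: derivative_eq_intros)
    have f1: "f1 s < 0" if "0 < s" "s < S0" for s
    proof -
      have "K * sqrt s \<le> 1 / 2"
        using that S0 K by (subst KS1[symmetric], intro mult_left_mono real_sqrt_le_mono) auto
      moreover have "s powr (- (n - 1) / 2) = s powr (- n / 2) * sqrt s"
      proof -
        have eq: "- (n - 1) / 2 = - n / 2 + 1 / 2" by (simp add: field_simps)
        show ?thesis using that by (simp only: eq powr_add) (simp add: powr_half_sqrt)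
      qed
      moreover from calculation(1) have "s powr (- n / 2) * (K * sqrt s) \<le> s powr (- n / 2) * (1 / 2)"
        by (intro mult_left_mono) auto
      ultimately have "f1 s \<le> - (s powr (- n / 2)) + s powr (- n / 2) * (1 / 2)"
        unfolding f1_def by (simp only: mult.left_commute)
      moreover have "0 < s powr (- n / 2)" using that by simp
      ultimately show ?thesis by linarith
    qed
    have F1_0: "F1 s = 0" "F2 s = 0" "\<theta> s = 0" if "S0 \<le> s" for s using that by (simp_all add: F1_def F2_def \<theta>_def flat_exp_def)
    have F1_neg: "F1 s < 0" if "0 < s" "s < S0" for s
      using f1[OF that] that by (simp add: F1_def \<theta>_def mult_neg_pos)
    have F1_le: "F1 s \<le> 0" if "0 < s" for s using F1_neg[OF that] F1_0[of s] by (cases "s < S0") auto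
    have mono: "F t \<le> F s" if "0 < s" "s \<le> t" for s t
    proof (rule DERIV_nonpos_imp_nonincreasing[OF that(2)])
      fix x assume "s \<le> x"
      then show "\<exists>y. DERIV F x :> y \<and> y \<le> 0"
        using that(1) dF[of x] F1_le[of x] by (intro exI[of _ "F1 x"]) auto
    qed
    have F0: "F s = 0" if "S0 \<le> s" for s
    proof (cases "s = S0")
      case False
      then have "S0 < s" using that by simp
      then have "F s = F S0"
      proof (rule DERIV_isconst_end)
        show "continuous_on {S0..s} F"
          using S0 by (intro continuous_at_imp_continuous_on ballI DERIV_isCont[OF dF]) auto
        show "DERIV F x :> 0" if "S0 < x" for x
          using dF[of x] F1_0(1)[of x] that S0 by simp
      qed
      then show ?thesis by (simp add: F_def)
    qed (simp add: F_def)
    have F_nonneg: "0 \<le> F s" if "0 < s" for s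
      using mono[OF that, of "max s S0"] F0[of "max s S0"] by simp
    have F_pos: "0 < F (S0 / 2)"
    proof -
      have "F S0 < F (S0 / 2)"
      proof (rule DERIV_neg_imp_decreasing_open[of "S0 / 2" S0 F])
        show "S0 / 2 < S0" using S0 by simp
        show "\<exists>y. DERIV F x :> y \<and> y < 0" if "S0 / 2 < x" "x < S0" for x
          using dF[of x] F1_neg[of x] that S0 by (intro exI[of _ "F1 x"]) auto
        show "continuous_on {S0 / 2..S0} F"
          using S0 by (intro continuous_at_imp_continuous_on ballI DERIV_isCont[OF dF]) auto
      qed
      then show ?thesis using F0[of S0] by simp
    qed
    have smooth: "smooth_on {0<..} F"
      unfolding smooth_on_def
    proof
      fix k show "Ck_on k {0<..} F"
        by (rule Ck_on_SucD, rule Ck_on_real_SucI[OF _ dF CkF1]) auto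
    qed
    have ineq: "flat_exp 0 (S0 - (Q + r\<^sup>2)) - 2 * n * r\<^sup>2 * (Q + r\<^sup>2) powr (- n / 2 - 1)
         \<le> e * F2 (Q + r\<^sup>2) + l * F1 (Q + r\<^sup>2)"
      if h: "0 \<le> Q" "0 < r" "0 \<le> e" "\<bar>e - 4 * Q\<bar> \<le> C1 * (Q * sqrt Q)" "\<bar>l - 2 * n\<bar> \<le> C1 * sqrt Q" for Q r e l
    proof -
      define s where "s = Q + r\<^sup>2"
      have s: "0 < s" using h by (simp add: s_def add_nonneg_pos)
      define m where "m = 2 * n * r\<^sup>2 * s powr (- n / 2 - 1)"
      have m: "0 \<le> m" using n by (simp add: m_def)
      have "flat_exp 0 (S0 - s) - m \<le> e * F2 s + l * F1 s"
      proof (cases "s < S0")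
        case True
        have "K * sqrt s \<le> 1"
        proof -
          have "K * sqrt s \<le> K * sqrt S1" using True S0 K by (intro mult_left_mono real_sqrt_le_mono) auto
          then show ?thesis using KS1 by simp
        qed
        note R = radial_inequality[OF n C1 K_def h(1,2) s_def this h(4,5)]
        have "1 \<le> s powr (- (n - 1) / 2)"
        proof -
          have "1 powr (- (n - 1) / 2) \<le> s powr (- (n - 1) / 2)"
            using True S0 S1_le s n by (intro powr_mono2') auto
          then show ?thesis by simp
        qed
        then have "1 - m \<le> e * f2 s + l * f1 s"
          using R(1) by (simp add: f1_def f2_def m_def)
        then have "\<theta> s * (1 - m) \<le> \<theta> s * (e * f2 s + l * f1 s)"
          by (intro mult_left_mono) (simp_all add: \<theta>_def)
        \<comment> \<open>The term created by differentiating the cutoff can only help the lower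
          bound.\<close>
        moreover have "0 \<le> - (e * f1 s * flat_exp 2 (S0 - s))"
          using R(2) h(3) by (simp add: f1_def mult_nonneg_nonpos mult_nonpos_nonneg)
        moreover have "e * F2 s + l * F1 s = \<theta> s * (e * f2 s + l * f1 s) - e * f1 s * flat_exp 2 (S0 - s)"
          by (simp add: F1_def F2_def algebra_simps)
        moreover have "\<theta> s * m \<le> m" using flat_exp_0_le_1[of "S0 - s"] m by (simp add: \<theta>_def mult_left_le_one_le)
        ultimately show ?thesis by (simp add: \<theta>_def[symmetric] algebra_simps)
      next
        case False
        then show ?thesis using F1_0[of s] m by (simp add: flat_exp_def)
      qed
      then show ?thesis by (simp add: s_def m_def)
    qed
    show "\<exists>F F1 F2. is_radial_profile n C1 S0 F F1 F2"
      unfolding is_radial_profile_def using smooth dF dF1 F0 F_nonneg F_pos mono ineq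
      by (intro exI[of _ F] exI[of _ F1] exI[of _ F2]) auto
  qed
qed

section \<open>A weak Harnack inequality in divergence form\<close>

lemma inner_matrix_vector: "(v::real^'n) \<bullet> (A *v w) = (\<Sum>i\<in>UNIV. \<Sum>j\<in>UNIV. v $ i * A $ i $ j * w $ j)"
  by (simp add: inner_vec_def matrix_vector_mult_def sum_distrib_left mult.assoc)

lemma norm_matrix_vector_le:
  fixes A :: "real^'n^'n" and B :: real
  assumes "\<And>i j. \<bar>A $ i $ j\<bar> \<le> B"
  shows "norm (A *v v) \<le> (real CARD('n))\<^sup>2 * B * norm v"
proof -
  have "norm (A *v v) \<le> (\<Sum>i\<in>UNIV. \<bar>(A *v v) $ i\<bar>)" by (rule norm_le_l1_cart)
  also have "\<dots> \<le> (\<Sum>i\<in>(UNIV::'n set). \<Sum>j\<in>(UNIV::'n set). B * norm v)"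
  proof (rule sum_mono)
    fix i :: 'n
    show "\<bar>(A *v v) $ i\<bar> \<le> (\<Sum>j\<in>(UNIV::'n set). B * norm v)"
      unfolding matrix_vector_mult_def vec_lambda_beta
    proof (rule order_trans[OF sum_abs], rule sum_mono)
      fix j :: 'n
      show "\<bar>A $ i $ j * v $ j\<bar> \<le> B * norm v"
        unfolding abs_mult by (intro mult_mono assms component_le_norm_cart order_trans[OF abs_ge_zero assms]) simp
    qed
  qed
  also have "\<dots> = (real CARD('n))\<^sup>2 * B * norm v" by (simp add: power2_eq_square)
  finally show ?thesis .
qed

lemma abs_inner_matrix_vector_le:
  fixes A :: "real^'n^'n" and B :: real
  assumes "\<And>i j. \<bar>A $ i $ j\<bar> \<le> B"
  shows "\<bar>v \<bullet> (A *v v)\<bar> \<le> (real CARD('n))\<^sup>2 * B * (norm v)\<^sup>2"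
proof -
  have "\<bar>v \<bullet> (A *v v)\<bar> \<le> norm v * norm (A *v v)" by (rule Cauchy_Schwarz_ineq2)
  also have "\<dots> \<le> norm v * ((real CARD('n))\<^sup>2 * B * norm v)"
    by (intro mult_left_mono norm_matrix_vector_le assms) simp
  finally show ?thesis by (simp add: power2_eq_square mult_ac)
qed

lemma pos_def_imp_invertible:
  fixes A :: "real^'n^'n"
  assumes "\<And>v. v \<noteq> 0 \<Longrightarrow> 0 < v \<bullet> (A *v v)"
  shows "invertible A"
proof -
  have "A *v v = 0 \<Longrightarrow> v = 0" for v using assms[of v] by (metis inner_zero_right less_irrefl)
  then have "\<exists>B. B ** A = mat 1" by (simp add: matrix_left_invertible_ker)
  then show ?thesis by (metis invertible_def matrix_left_right_inverse)
qed

lemma matrix_inv_mult: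
  assumes "invertible A"
  shows "A ** matrix_inv A = mat 1" "matrix_inv A ** A = mat 1"
proof -
  have "\<exists>A'. A ** A' = mat 1 \<and> A' ** A = mat 1" using assms by (simp add: invertible_def)
  from someI_ex[OF this] show "A ** matrix_inv A = mat 1" "matrix_inv A ** A = mat 1"
    unfolding matrix_inv_def by blast+
qed

lemma inner_symmetric_matrix:
  fixes A :: "real^'n^'n"
  assumes "transpose A = A"
  shows "v \<bullet> (A *v w) = (A *v v) \<bullet> w"
  by (metis assms dot_lmul_matrix transpose_matrix_vector)

lemma frechet_derivative_eq_sum_pderiv_i:
  fixes f :: "real^'n \<Rightarrow> real"
  assumes "f differentiable (at y)"
  shows "frechet_derivative f (at y) v = (\<Sum>k\<in>UNIV. v $ k * pderiv_i k f y)"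
proof -
  have l: "linear (frechet_derivative f (at y))"
    using assms by (simp add: frechet_derivative_works has_derivative_linear)
  have "v = (\<Sum>k\<in>UNIV. v $ k *\<^sub>R axis k 1)"
    using basis_expansion[of v] by (simp add: scalar_mult_eq_scaleR)
  then have "frechet_derivative f (at y) v = frechet_derivative f (at y) (\<Sum>k\<in>UNIV. v $ k *\<^sub>R axis k 1)" by simp
  also have "\<dots> = (\<Sum>k\<in>UNIV. v $ k * pderiv_i k f y)"
    by (simp add: linear_sum[OF l] linear_scale[OF l] pderiv_i_def)
  finally show ?thesis .
qed

lemma lipschitz_of_bounded_pderiv_i:
  fixes f :: "real^'n \<Rightarrow> real" and B :: real
  assumes "convex S" "\<And>y. y \<in> S \<Longrightarrow> f differentiable (at y)"
    "\<And>k y. y \<in> S \<Longrightarrow> \<bar>pderiv_i k f y\<bar> \<le> B" "y \<in> S" "z \<in> S"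
  shows "\<bar>f y - f z\<bar> \<le> real CARD('n) * B * norm (y - z)"
proof -
  have "norm (f y - f z) \<le> (CARD('n) * B) * norm (y - z)"
  proof (rule differentiable_bound[OF assms(1)])
    fix x assume x: "x \<in> S"
    show "(f has_derivative frechet_derivative f (at x)) (at x within S)"
      using assms(2)[OF x] by (simp add: frechet_derivative_works has_derivative_at_withinI)
    show "onorm (frechet_derivative f (at x)) \<le> real CARD('n) * B"
    proof (rule onorm_le)
      fix v :: "real^'n"
      have "\<bar>\<Sum>k\<in>UNIV. v $ k * pderiv_i k f x\<bar> \<le> (\<Sum>k\<in>(UNIV::'n set). norm v * B)"
      proof (rule order_trans[OF sum_abs], rule sum_mono)
        fix k :: 'n
        show "\<bar>v $ k * pderiv_i k f x\<bar> \<le> norm v * B"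
          unfolding abs_mult by (intro mult_mono assms(3)[OF x] component_le_norm_cart) simp_all
      qed
      then show "norm (frechet_derivative f (at x) v) \<le> real CARD('n) * B * norm v"
        using frechet_derivative_eq_sum_pderiv_i[OF assms(2)[OF x], of v] by (simp add: mult_ac)
    qed
  qed (use assms in auto)
  then show ?thesis by simp
qed

text \<open>The operator in divergence form, with the sign opposite to that of
  \<open>laplacian\<close>. For the coefficients \<open>principal_coeff g c\<close> it is
  \<open>- vol_density\<close> times the Laplacian in the chart.\<close>

definition divop :: "(real^'n \<Rightarrow> real^'n^'n) \<Rightarrow> (real^'n \<Rightarrow> real) \<Rightarrow> real^'n \<Rightarrow> real" where
  "divop a \<phi> y = (\<Sum>i\<in>UNIV. pderiv_i i (\<lambda>z. \<Sum>j\<in>UNIV. a z $ i $ j * pderiv_i j \<phi> z) y)"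

abbreviation gradient_form :: "(real^'n \<Rightarrow> real^'n^'n) \<Rightarrow> (real^'n \<Rightarrow> real) \<Rightarrow> real^'n \<Rightarrow> real" where
  "gradient_form a \<phi> y \<equiv> \<Sum>i\<in>UNIV. \<Sum>j\<in>UNIV. a y $ i $ j * pderiv_i i \<phi> y * pderiv_i j \<phi> y"

section \<open>Elliptic operators in divergence form and test functions adapted to them\<close>

locale elliptic =
  fixes \<Omega> :: "(real^'n) set" and a :: "real^'n \<Rightarrow> real^'n^'n"
  assumes open_\<Omega>: "open \<Omega>"
    and smooth_a: "\<And>i j. smooth_on \<Omega> (\<lambda>y. a y $ i $ j)"
    and sym_a: "\<And>y. y \<in> \<Omega> \<Longrightarrow> transpose (a y) = a y"
    and pos_a: "\<And>y v. y \<in> \<Omega> \<Longrightarrow> v \<noteq> 0 \<Longrightarrow> 0 < v \<bullet> (a y *v v)"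
begin

lemma elliptic_subset:
  assumes "open U" "U \<subseteq> \<Omega>"
  shows "elliptic U a"
  using assms smooth_a sym_a pos_a by (intro elliptic.intro) (auto intro: smooth_on_subset)

lemma smooth_flux:
  assumes "smooth_on \<Omega> \<phi>"
  shows "smooth_on \<Omega> (\<lambda>z. \<Sum>j\<in>UNIV. a z $ i $ j * pderiv_i j \<phi> z)"
  by (intro smooth_on_sum smooth_on_mult open_\<Omega> smooth_a smooth_on_pderiv_i assms)

lemma smooth_divop:
  assumes "smooth_on \<Omega> \<phi>"
  shows "smooth_on \<Omega> (divop a \<phi>)"
  unfolding divop_def[abs_def]
  by (intro smooth_on_sum open_\<Omega> smooth_on_pderiv_i smooth_flux assms)

lemma test_flux:
  assumes "test_function \<Omega> \<phi>"
  shows "test_function \<Omega> (\<lambda>z. \<Sum>j\<in>UNIV. a z $ i $ j * pderiv_i j \<phi> z)"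
  by (intro test_function_sum test_function_mult open_\<Omega> smooth_a test_function_pderiv_i assms)

lemma test_divop:
  assumes "test_function \<Omega> \<phi>"
  shows "test_function \<Omega> (divop a \<phi>)"
  unfolding divop_def[abs_def]
  by (intro test_function_sum test_function_pderiv_i test_flux assms)

text \<open>The locale assumes ellipticity only pointwise. Compactness of a closed ball, and of its
  product with the unit sphere, makes it uniform; a single \<open>M\<close> serves for entries,
  first derivatives and Lipschitz constants.\<close>

lemma coefficient_bounds:
  assumes "y0 \<in> \<Omega>"
  obtains R M \<kappa> where "0 < R" "cball y0 R \<subseteq> \<Omega>" "0 < M" "0 < \<kappa>"
    "\<And>y i j. y \<in> cball y0 R \<Longrightarrow> \<bar>a y $ i $ j\<bar> \<le> M"
    "\<And>y i j k. y \<in> cball y0 R \<Longrightarrow> \<bar>pderiv_i k (\<lambda>z. a z $ i $ j) y\<bar> \<le> M"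
    "\<And>y z i j. y \<in> cball y0 R \<Longrightarrow> z \<in> cball y0 R \<Longrightarrow> \<bar>a y $ i $ j - a z $ i $ j\<bar> \<le> M * norm (y - z)"
    "\<And>y v. y \<in> cball y0 R \<Longrightarrow> \<kappa> * (norm v)\<^sup>2 \<le> v \<bullet> (a y *v v)"
proof -
  obtain R where R: "0 < R" "cball y0 R \<subseteq> \<Omega>" using assms open_\<Omega> by (auto simp: open_contains_cball)
  let ?B = "cball y0 R"
  have ex: "\<exists>M. \<forall>y\<in>?B. \<bar>f y\<bar> \<le> M" if "continuous_on \<Omega> f" for f :: "real^'n \<Rightarrow> real"
  proof -
    have "bounded (f ` ?B)"
      using that R by (intro compact_imp_bounded compact_continuous_image) (auto intro: continuous_on_subset)
    then show ?thesis by (auto simp: bounded_iff)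
  qed
  define M1 where "M1 i j = (SOME M. \<forall>y\<in>?B. \<bar>a y $ i $ j\<bar> \<le> M)" for i j
  have M1: "\<bar>a y $ i $ j\<bar> \<le> M1 i j" if "y \<in> ?B" for i j y
    using someI_ex[OF ex[OF smooth_on_continuous_on[OF smooth_a[of i j]]]] that unfolding M1_def by blast
  define M2 where "M2 i j k = (SOME M. \<forall>y\<in>?B. \<bar>pderiv_i k (\<lambda>z. a z $ i $ j) y\<bar> \<le> M)" for i j k
  have M2: "\<bar>pderiv_i k (\<lambda>z. a z $ i $ j) y\<bar> \<le> M2 i j k" if "y \<in> ?B" for i j k y
    using someI_ex[OF ex[OF smooth_on_continuous_on[OF smooth_on_pderiv_i[OF smooth_a[of i j], of k]]]] that
    unfolding M2_def by blast
  define B1 where "B1 = (\<Sum>i\<in>UNIV. \<Sum>j\<in>UNIV. \<bar>M1 i j\<bar>)"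
  define B2 where "B2 = (\<Sum>i\<in>UNIV. \<Sum>j\<in>UNIV. \<Sum>k\<in>UNIV. \<bar>M2 i j k\<bar>)"
  have B1: "\<bar>a y $ i $ j\<bar> \<le> B1" if "y \<in> ?B" for y i j
  proof -
    have "\<bar>M1 i j\<bar> \<le> (\<Sum>j\<in>UNIV. \<bar>M1 i j\<bar>)" by (rule member_le_sum) auto
    also have "\<dots> \<le> B1" unfolding B1_def by (rule member_le_sum) (auto intro: sum_nonneg)
    finally show ?thesis using M1[OF that, of i j] by linarith
  qed
  have B2: "\<bar>pderiv_i k (\<lambda>z. a z $ i $ j) y\<bar> \<le> B2" if "y \<in> ?B" for y i j k
  proof -
    have "\<bar>M2 i j k\<bar> \<le> (\<Sum>k\<in>UNIV. \<bar>M2 i j k\<bar>)" by (rule member_le_sum) auto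
    also have "\<dots> \<le> (\<Sum>j\<in>UNIV. \<Sum>k\<in>UNIV. \<bar>M2 i j k\<bar>)" by (rule member_le_sum) (auto intro: sum_nonneg)
    also have "\<dots> \<le> B2" unfolding B2_def by (rule member_le_sum) (auto intro: sum_nonneg)
    finally show ?thesis using M2[OF that, where i = i and j = j and k = k] by linarith
  qed
  have B0: "0 \<le> B1" "0 \<le> B2" unfolding B1_def B2_def by (auto intro!: sum_nonneg)
  define M where "M = B1 + B2 + CARD('n) * B2 + 1"
  have M: "0 < M" "B1 \<le> M" "B2 \<le> M" "CARD('n) * B2 \<le> M" 
  proof -
    have "0 \<le> real CARD('n) * B2" by (intro mult_nonneg_nonneg B0) simp
    then show "0 < M" "B1 \<le> M" "B2 \<le> M" "CARD('n) * B2 \<le> M" unfolding M_def using B0 by linarith+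
  qed
  have lip: "\<bar>a y $ i $ j - a z $ i $ j\<bar> \<le> M * norm (y - z)" if "y \<in> ?B" "z \<in> ?B" for y z i j
  proof -
    have "\<bar>a y $ i $ j - a z $ i $ j\<bar> \<le> real CARD('n) * B2 * norm (y - z)"
      using that R by (intro lipschitz_of_bounded_pderiv_i[of ?B "\<lambda>z. a z $ i $ j"] B2)
        (auto intro: smooth_on_differentiable[OF smooth_a])
    also have "\<dots> \<le> M * norm (y - z)" using M by (intro mult_right_mono) auto
    finally show ?thesis .
  qed
  let ?S = "?B \<times> sphere (0 :: real^'n) 1"
  have cont: "continuous_on ?S (\<lambda>(y, v). v \<bullet> (a y *v v))"
    unfolding inner_matrix_vector case_prod_unfold
    using R by (intro continuous_on_sum continuous_on_mult continuous_on_compose2[OF smooth_on_continuous_on[OF smooth_a] continuous_on_fst]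
        continuous_on_component continuous_on_snd continuous_on_id) auto
  obtain e where e: "norm (e :: real^'n) = 1" using vector_choose_size[of 1] by auto
  have "compact ?S" "?S \<noteq> {}" using R e by (auto intro!: compact_Times)
  from continuous_attains_inf[OF this cont]
  obtain y1 v1 where yv: "y1 \<in> ?B" "norm v1 = 1" "\<And>y v. y \<in> ?B \<Longrightarrow> norm v = 1 \<Longrightarrow> v1 \<bullet> (a y1 *v v1) \<le> v \<bullet> (a y *v v)"
    by auto
  define \<kappa> where "\<kappa> = v1 \<bullet> (a y1 *v v1)"
  have \<kappa>: "0 < \<kappa>" unfolding \<kappa>_def using yv(1,2) R by (intro pos_a) auto
  have low: "\<kappa> * (norm v)\<^sup>2 \<le> v \<bullet> (a y *v v)" if "y \<in> ?B" for y v
  proof (cases "v = 0")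
    case False
    then have "\<kappa> \<le> (v /\<^sub>R norm v) \<bullet> (a y *v (v /\<^sub>R norm v))"
      unfolding \<kappa>_def using that by (intro yv(3)) auto
    also have "\<dots> = (v \<bullet> (a y *v v)) / (norm v)\<^sup>2"
      by (simp add: matrix_vector_mult_scaleR power2_eq_square divide_inverse)
    finally show ?thesis using False by (simp add: field_simps)
  qed simp
  show thesis
    by (rule that[OF R M(1) \<kappa> order_trans[OF B1 M(2)] order_trans[OF B2 M(3)] lip low])
qed

text \<open>The quadratic form of the inverse of the coefficient matrix frozen at \<open>y1\<close>, for which the
  operator is close to the Laplacian applied to the squared norm.\<close>

lemma frozen_quadratic_form:
  assumes "y0 \<in> \<Omega>"
  obtains R C1 \<mu> \<nu> where "0 < R" "cball y0 R \<subseteq> \<Omega>" "0 \<le> C1" "0 < \<mu>" "0 < \<nu>"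
    "\<And>y1. y1 \<in> cball y0 R \<Longrightarrow> \<exists>Q. smooth_on UNIV Q \<and>
       (\<forall>y. \<mu> * (norm (y - y1))\<^sup>2 \<le> Q y \<and> Q y \<le> \<nu> * (norm (y - y1))\<^sup>2) \<and>
       (\<forall>y\<in>cball y0 R. 0 \<le> gradient_form a Q y \<and>
          \<bar>gradient_form a Q y - 4 * Q y\<bar> \<le> C1 * (Q y * sqrt (Q y)) \<and>
          \<bar>divop a Q y - 2 * real CARD('n)\<bar> \<le> C1 * sqrt (Q y))"
proof -
  obtain R M \<kappa> where R: "0 < R" "cball y0 R \<subseteq> \<Omega>" and M: "0 < M" and \<kappa>: "0 < \<kappa>"
    and bd: "\<And>y i j. y \<in> cball y0 R \<Longrightarrow> \<bar>a y $ i $ j\<bar> \<le> M"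
    "\<And>y i j k. y \<in> cball y0 R \<Longrightarrow> \<bar>pderiv_i k (\<lambda>z. a z $ i $ j) y\<bar> \<le> M"
    "\<And>y z i j. y \<in> cball y0 R \<Longrightarrow> z \<in> cball y0 R \<Longrightarrow> \<bar>a y $ i $ j - a z $ i $ j\<bar> \<le> M * norm (y - z)"
    "\<And>y v. y \<in> cball y0 R \<Longrightarrow> \<kappa> * (norm v)\<^sup>2 \<le> v \<bullet> (a y *v v)"
    by (rule coefficient_bounds[OF assms]) (rule that)
  let ?n = "real CARD('n)"
  define m where "m = ?n\<^sup>2 * M"
  have m: "0 < m" using M by (simp add: m_def)
  define \<mu> where "\<mu> = \<kappa> / m\<^sup>2"
  define \<nu> where "\<nu> = 1 / \<kappa>"
  define C1 where "C1 = 4 * m * m / (\<kappa> * sqrt \<kappa>) + (2 * m + 2 * m * m / \<kappa>) / sqrt \<kappa>"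
  have C1: "0 \<le> C1" using m \<kappa> by (simp add: C1_def)
  show thesis
  proof (rule that[OF R C1])
    show "0 < \<mu>" "0 < \<nu>" using m \<kappa> by (simp_all add: \<mu>_def \<nu>_def)
    fix y1 assume y1: "y1 \<in> cball y0 R"
    then have y1\<Omega>: "y1 \<in> \<Omega>" using R by auto
    define A where "A = a y1"
    define P where "P = matrix_inv A"
    have inv: "invertible A" unfolding A_def using pos_a[OF y1\<Omega>] by (rule pos_def_imp_invertible)
    have AP: "A *v (P *v v) = v" for v
      using matrix_inv_mult(1)[OF inv] by (simp add: matrix_vector_mul_assoc P_def)
    have symA: "transpose A = A" unfolding A_def by (rule sym_a[OF y1\<Omega>])
    \<comment> \<open>Half the gradient of \<open>Q\<close>. All bounds go through its norm, which
      is comparable both to the distance from \<open>y1\<close> and to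
      \<open>sqrt (Q y)\<close>.\<close>
    define \<zeta> where "\<zeta> y = P *v (y - y1)" for y
    define Q where "Q y = (y - y1) \<bullet> \<zeta> y" for y
    have A\<zeta>: "A *v \<zeta> y = y - y1" for y by (simp add: \<zeta>_def AP)
    have Q_eq: "Q y = \<zeta> y \<bullet> (A *v \<zeta> y)" for y by (simp add: Q_def A\<zeta> inner_commute)
    have Q_lower: "\<kappa> * (norm (\<zeta> y))\<^sup>2 \<le> Q y" for y unfolding Q_eq A_def by (rule bd(4)[OF y1])
    have Q0: "0 \<le> Q y" for y using Q_lower[of y] \<kappa> by (meson mult_nonneg_nonneg order_trans less_imp_le zero_le_power2)
    have z_le: "norm (y - y1) \<le> m * norm (\<zeta> y)" for y
      using norm_matrix_vector_le[of A M "\<zeta> y"] bd(1)[OF y1] unfolding A\<zeta> by (simp add: A_def m_def)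
    have P_le: "norm (P *v v) \<le> norm v / \<kappa>" for v
    proof -
      have "\<kappa> * (norm (P *v v))\<^sup>2 \<le> (P *v v) \<bullet> (A *v (P *v v))" unfolding A_def by (rule bd(4)[OF y1])
      also have "\<dots> \<le> norm (P *v v) * norm v" unfolding AP by (rule norm_cauchy_schwarz)
      finally have "norm (P *v v) * (\<kappa> * norm (P *v v)) \<le> norm (P *v v) * norm v"
        by (simp add: power2_eq_square mult_ac)
      then have "\<kappa> * norm (P *v v) \<le> norm v"
        by (cases "norm (P *v v) = 0") (auto dest: mult_left_le_imp_le)
      then show ?thesis using \<kappa> by (simp add: field_simps)
    qed
    have Pij: "\<bar>P $ i $ j\<bar> \<le> 1 / \<kappa>" for i j
    proof -
      have "P $ i $ j = (P *v axis j 1) $ i" by (simp add: matrix_vector_mult_basis column_def)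
      then show ?thesis using component_le_norm_cart[of "P *v axis j 1" i] P_le[of "axis j 1"] by simp
    qed
    have d\<zeta>: "((\<lambda>y. \<zeta> y $ j) has_derivative (\<lambda>v. (P *v v) $ j)) (at y)" for y j
      unfolding \<zeta>_def
      by (intro bounded_linear.has_derivative[OF bounded_linear_vec_nth]
          bounded_linear.has_derivative[OF matrix_vector_mul_bounded_linear])
        (auto intro!: derivative_eq_intros)
    have dQ: "(Q has_derivative (\<lambda>v. 2 * (\<zeta> y \<bullet> v))) (at y)" for y
    proof -
      have d: "(\<zeta> has_derivative (\<lambda>v. P *v v)) (at y)"
        unfolding \<zeta>_def
        by (intro bounded_linear.has_derivative[OF matrix_vector_mul_bounded_linear])
          (auto intro!: derivative_eq_intros)
      have "(Q has_derivative (\<lambda>v. (y - y1) \<bullet> (P *v v) + v \<bullet> \<zeta> y)) (at y)"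
        unfolding Q_def by (rule has_derivative_inner[OF _ d, of "\<lambda>y. y - y1" "\<lambda>v. v", simplified])
          (auto intro!: derivative_eq_intros)
      moreover have "(y - y1) \<bullet> (P *v v) = \<zeta> y \<bullet> v" for v
      proof -
        have "(y - y1) \<bullet> (P *v v) = (A *v \<zeta> y) \<bullet> (P *v v)" by (simp add: A\<zeta>)
        also have "\<dots> = \<zeta> y \<bullet> (A *v (P *v v))" using inner_symmetric_matrix[OF symA] by simp
        finally show ?thesis by (simp add: AP)
      qed
      ultimately show ?thesis by (simp add: inner_commute)
    qed
    have pQ: "pderiv_i i Q y = 2 * \<zeta> y $ i" for i y
      using pderiv_i_eqI[OF dQ] by (simp add: inner_axis)
    have Ck\<zeta>: "smooth_on UNIV (\<lambda>y. \<zeta> y $ j)" for j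
    proof -
      have "Ck_on k UNIV (\<lambda>y. \<Sum>i\<in>UNIV. P $ j $ i * (y $ i - y1 $ i))" for k
        by (intro Ck_on_sum Ck_on_mult Ck_on_diff Ck_on_const Ck_on_vec_nth open_UNIV)
      then show ?thesis by (simp add: smooth_on_def \<zeta>_def matrix_vector_mult_def)
    qed
    have smQ: "smooth_on UNIV Q"
    proof -
      have "Q = (\<lambda>y. \<Sum>i\<in>UNIV. (y $ i - y1 $ i) * \<zeta> y $ i)" by (auto simp: Q_def inner_vec_def)
      then show ?thesis using Ck\<zeta> unfolding smooth_on_def
        by (auto intro!: Ck_on_sum Ck_on_mult Ck_on_diff Ck_on_const Ck_on_vec_nth)
    qed
    have bounds: "\<mu> * (norm (y - y1))\<^sup>2 \<le> Q y" "Q y \<le> \<nu> * (norm (y - y1))\<^sup>2" for y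
    proof -
      have "(norm (y - y1))\<^sup>2 \<le> (m * norm (\<zeta> y))\<^sup>2" using z_le by (intro power_mono) auto
      then have "\<mu> * (norm (y - y1))\<^sup>2 \<le> \<mu> * (m * norm (\<zeta> y))\<^sup>2"
        using m \<kappa> by (intro mult_left_mono) (auto simp: \<mu>_def)
      also have "\<dots> = \<kappa> * (norm (\<zeta> y))\<^sup>2" using m by (simp add: \<mu>_def power_mult_distrib)
      finally show "\<mu> * (norm (y - y1))\<^sup>2 \<le> Q y" using Q_lower[of y] by linarith
      have "Q y \<le> norm (y - y1) * norm (\<zeta> y)" unfolding Q_def by (rule norm_cauchy_schwarz)
      also have "\<dots> \<le> norm (y - y1) * (norm (y - y1) / \<kappa>)"
        unfolding \<zeta>_def by (intro mult_left_mono P_le) simp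
      finally show "Q y \<le> \<nu> * (norm (y - y1))\<^sup>2" by (simp add: \<nu>_def power2_eq_square)
    qed
    have \<zeta>_le: "norm (\<zeta> y) \<le> sqrt (Q y) / sqrt \<kappa>" for y
    proof -
      have "(norm (\<zeta> y))\<^sup>2 \<le> Q y / \<kappa>" using Q_lower[of y] \<kappa> by (simp add: field_simps)
      then have "norm (\<zeta> y) \<le> sqrt (Q y / \<kappa>)" by (rule real_le_rsqrt)
      then show ?thesis by (simp add: real_sqrt_divide)
    qed
    have main: "0 \<le> gradient_form a Q y \<and>
        \<bar>gradient_form a Q y - 4 * Q y\<bar> \<le> C1 * (Q y * sqrt (Q y)) \<and>
        \<bar>divop a Q y - 2 * real CARD('n)\<bar> \<le> C1 * sqrt (Q y)" if y: "y \<in> cball y0 R" for y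
    proof -
      let ?e = "\<Sum>i\<in>UNIV. \<Sum>j\<in>UNIV. a y $ i $ j * pderiv_i i Q y * pderiv_i j Q y"
      have y\<Omega>: "y \<in> \<Omega>" using y R by auto
      have e: "?e = 4 * (\<zeta> y \<bullet> (a y *v \<zeta> y))"
        unfolding pQ inner_matrix_vector sum_distrib_left by (intro sum.cong) auto
      have "0 \<le> \<zeta> y \<bullet> (a y *v \<zeta> y)"
        using bd(4)[OF y, of "\<zeta> y"] \<kappa> by (meson mult_nonneg_nonneg order_trans less_imp_le zero_le_power2)
      then have e0: "0 \<le> ?e" unfolding e by simp
      have "?e - 4 * Q y = 4 * (\<zeta> y \<bullet> ((a y - A) *v \<zeta> y))"
        unfolding e Q_eq by (simp add: matrix_vector_mult_diff_rdistrib inner_diff_right)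
      then have "\<bar>?e - 4 * Q y\<bar> = 4 * \<bar>\<zeta> y \<bullet> ((a y - A) *v \<zeta> y)\<bar>" by (simp add: abs_mult)
      also have "\<dots> \<le> 4 * (?n\<^sup>2 * (M * norm (y - y1)) * (norm (\<zeta> y))\<^sup>2)"
        using bd(3)[OF y y1] by (intro mult_left_mono abs_inner_matrix_vector_le) (auto simp: A_def)
      also have "\<dots> = 4 * m * norm (y - y1) * (norm (\<zeta> y))\<^sup>2" by (simp add: m_def)
      also have "\<dots> \<le> 4 * m * (m * norm (\<zeta> y)) * (norm (\<zeta> y))\<^sup>2"
        using z_le m by (intro mult_right_mono mult_left_mono) auto
      also have "\<dots> = 4 * m * m * (norm (\<zeta> y) ^ 3)" by (simp add: power2_eq_square power3_eq_cube)
      also have "\<dots> \<le> 4 * m * m * ((sqrt (Q y) / sqrt \<kappa>) ^ 3)"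
        using \<zeta>_le m by (intro mult_left_mono power_mono) auto
      also have "(sqrt (Q y) / sqrt \<kappa>) ^ 3 = (Q y * sqrt (Q y)) / (\<kappa> * sqrt \<kappa>)"
        using Q0 \<kappa> by (simp add: power3_eq_cube)
      also have "4 * m * m * ((Q y * sqrt (Q y)) / (\<kappa> * sqrt \<kappa>)) = 4 * m * m / (\<kappa> * sqrt \<kappa>) * (Q y * sqrt (Q y))"
        by simp
      also have "\<dots> \<le> C1 * (Q y * sqrt (Q y))"
        using m \<kappa> Q0[of y] by (intro mult_right_mono) (auto simp: C1_def)
      finally have e4: "\<bar>?e - 4 * Q y\<bar> \<le> C1 * (Q y * sqrt (Q y))" .
      have trace: "(\<Sum>i\<in>UNIV. \<Sum>j\<in>UNIV. A $ i $ j * P $ j $ i) = ?n"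
      proof -
        have "(\<Sum>j\<in>UNIV. A $ i $ j * P $ j $ i) = 1" for i
        proof -
          have "(A ** P) $ i $ i = 1" using matrix_inv_mult(1)[OF inv] by (simp add: P_def mat_def)
          then show ?thesis by (simp add: matrix_matrix_mult_def)
        qed
        then show ?thesis by simp
      qed
      have div: "divop a Q y = (\<Sum>i\<in>UNIV. \<Sum>j\<in>UNIV.
          2 * (a y $ i $ j * P $ j $ i) + 2 * (pderiv_i i (\<lambda>z. a z $ i $ j) y * \<zeta> y $ j))"
        unfolding divop_def pQ
      proof (intro sum.cong refl)
        fix i :: 'n
        have df: "(\<lambda>z. 2 * \<zeta> z $ j) differentiable (at y)" for j
          using has_derivative_mult_right[OF d\<zeta>] by (auto simp: differentiable_def)
        have da: "(\<lambda>z. a z $ i $ j) differentiable (at y)" for j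
          by (rule smooth_on_differentiable[OF smooth_a y\<Omega>])
        have p\<zeta>: "pderiv_i i (\<lambda>z. 2 * \<zeta> z $ j) y = 2 * P $ j $ i" for j
        proof -
          have "pderiv_i i (\<lambda>z. 2 * \<zeta> z $ j) y = 2 * (P *v axis i 1) $ j"
            by (rule pderiv_i_eqI[OF has_derivative_mult_right[OF d\<zeta>]])
          then show ?thesis by (simp add: matrix_vector_mult_basis column_def)
        qed
        show "pderiv_i i (\<lambda>z. \<Sum>j\<in>UNIV. a z $ i $ j * (2 * \<zeta> z $ j)) y =
          (\<Sum>j\<in>UNIV. 2 * (a y $ i $ j * P $ j $ i) + 2 * (pderiv_i i (\<lambda>z. a z $ i $ j) y * \<zeta> y $ j))"
          by (subst pderiv_i_sum, intro differentiable_mult da df)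
            (auto intro!: sum.cong simp: pderiv_i_mult[OF da df] p\<zeta>)
      qed
      \<comment> \<open>Two first-order errors remain: the variation of the coefficients against the
        constant Hessian of \<open>Q\<close>, and the derivative of the coefficients against its
        gradient.\<close>
      have "divop a Q y - 2 * ?n = (\<Sum>i\<in>UNIV. \<Sum>j\<in>UNIV.
          2 * ((a y $ i $ j - A $ i $ j) * P $ j $ i) + 2 * (pderiv_i i (\<lambda>z. a z $ i $ j) y * \<zeta> y $ j))"
        unfolding div trace[symmetric] sum_distrib_left sum_subtractf[symmetric]
        by (intro sum.cong refl) (simp add: algebra_simps)
      also have "\<bar>\<dots>\<bar> \<le> (\<Sum>i\<in>(UNIV::'n set). \<Sum>j\<in>(UNIV::'n set).
          2 * (M * norm (y - y1) * (1 / \<kappa>)) + 2 * (M * norm (\<zeta> y)))"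
      proof (intro order_trans[OF sum_abs] sum_mono)
        fix i j :: 'n
        have "\<bar>(a y $ i $ j - A $ i $ j) * P $ j $ i\<bar> \<le> M * norm (y - y1) * (1 / \<kappa>)"
          unfolding abs_mult A_def using bd(3)[OF y y1] Pij M by (intro mult_mono) auto
        moreover have "\<bar>pderiv_i i (\<lambda>z. a z $ i $ j) y * \<zeta> y $ j\<bar> \<le> M * norm (\<zeta> y)"
          unfolding abs_mult using bd(2)[OF y] component_le_norm_cart M by (intro mult_mono) auto
        ultimately show "\<bar>2 * ((a y $ i $ j - A $ i $ j) * P $ j $ i) + 2 * (pderiv_i i (\<lambda>z. a z $ i $ j) y * \<zeta> y $ j)\<bar>
          \<le> 2 * (M * norm (y - y1) * (1 / \<kappa>)) + 2 * (M * norm (\<zeta> y))" by linarith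
      qed
      also have "\<dots> = 2 * m / \<kappa> * norm (y - y1) + 2 * m * norm (\<zeta> y)"
        by (simp add: m_def power2_eq_square algebra_simps)
      also have "\<dots> \<le> 2 * m / \<kappa> * (m * norm (\<zeta> y)) + 2 * m * norm (\<zeta> y)"
        using z_le m \<kappa> by (intro add_mono mult_left_mono) auto
      also have "\<dots> = (2 * m + 2 * m * m / \<kappa>) * norm (\<zeta> y)" by (simp add: algebra_simps)
      also have "\<dots> \<le> (2 * m + 2 * m * m / \<kappa>) * (sqrt (Q y) / sqrt \<kappa>)"
        using \<zeta>_le m \<kappa> by (intro mult_left_mono) auto
      also have "\<dots> = (2 * m + 2 * m * m / \<kappa>) / sqrt \<kappa> * sqrt (Q y)" by simp
      also have "\<dots> \<le> C1 * sqrt (Q y)"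
        using m \<kappa> Q0[of y] by (intro mult_right_mono) (auto simp: C1_def)
      finally show ?thesis using e0 e4 by simp
    qed
    show "\<exists>Q. smooth_on UNIV Q \<and>
       (\<forall>y. \<mu> * (norm (y - y1))\<^sup>2 \<le> Q y \<and> Q y \<le> \<nu> * (norm (y - y1))\<^sup>2) \<and>
       (\<forall>y\<in>cball y0 R. 0 \<le> gradient_form a Q y \<and>
          \<bar>gradient_form a Q y - 4 * Q y\<bar> \<le> C1 * (Q y * sqrt (Q y)) \<and>
          \<bar>divop a Q y - 2 * real CARD('n)\<bar> \<le> C1 * sqrt (Q y))"
      using smQ bounds main by (intro exI[of _ Q]) blast
  qed
qed

text \<open>Chain rule; the two coefficients are the numbers called \<open>e\<close> and
  \<open>l\<close> in \<open>is_radial_profile\<close>.\<close>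

lemma divop_radial:
  assumes Q: "smooth_on UNIV Q" "\<And>y. 0 < Q y + d"
    and F: "\<And>s. 0 < s \<Longrightarrow> (F has_real_derivative F1 s) (at s)"
      "\<And>s. 0 < s \<Longrightarrow> (F1 has_real_derivative F2 s) (at s)"
    and y: "y \<in> \<Omega>"
  shows "divop a (\<lambda>y. F (Q y + d)) y =
    gradient_form a Q y * F2 (Q y + d) + divop a Q y * F1 (Q y + d)"
proof -
  have dQ: "(\<lambda>z. Q z + d) differentiable (at z)" for z
    using smooth_on_differentiable[OF Q(1)] by (intro differentiable_add) auto
  have pQ: "pderiv_i j (\<lambda>z. Q z + d) z = pderiv_i j Q z" for j z
    using smooth_on_differentiable[OF Q(1)] by (subst pderiv_i_add) auto
  define b where "b i z = (\<Sum>j\<in>UNIV. a z $ i $ j * pderiv_i j Q z)" for i z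
  have db: "b i differentiable (at y)" for i
    unfolding b_def using smooth_flux[OF smooth_on_subset[OF Q(1)]] y
    by (intro smooth_on_differentiable[of \<Omega>]) auto
  have 1: "(\<lambda>z. \<Sum>j\<in>UNIV. a z $ i $ j * pderiv_i j (\<lambda>y. F (Q y + d)) z) = (\<lambda>z. F1 (Q z + d) * b i z)" for i
  proof
    fix z
    have "pderiv_i j (\<lambda>y. F (Q y + d)) z = F1 (Q z + d) * pderiv_i j Q z" for j
      using pderiv_i_compose_real[of F _ "\<lambda>y. Q y + d" z j, OF F(1)[OF Q(2)] dQ] pQ by simp
    then show "(\<Sum>j\<in>UNIV. a z $ i $ j * pderiv_i j (\<lambda>y. F (Q y + d)) z) = F1 (Q z + d) * b i z"
      by (simp add: b_def sum_distrib_left mult_ac)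
  qed
  have 2: "pderiv_i i (\<lambda>z. F1 (Q z + d) * b i z) y =
      F1 (Q y + d) * pderiv_i i (b i) y + F2 (Q y + d) * pderiv_i i Q y * b i y" for i
  proof -
    have "(\<lambda>z. F1 (Q z + d)) differentiable (at y)"
    proof -
      have "((\<lambda>z. Q z + d) has_derivative frechet_derivative (\<lambda>z. Q z + d) (at y)) (at y)"
        using dQ by (simp add: frechet_derivative_works)
      from has_derivative_compose[OF this F(2)[OF Q(2), unfolded has_field_derivative_def]]
      show ?thesis by (auto simp: differentiable_def)
    qed
    moreover have "pderiv_i i (\<lambda>z. F1 (Q z + d)) y = F2 (Q y + d) * pderiv_i i Q y"
      using pderiv_i_compose_real[of F1 _ "\<lambda>y. Q y + d" y i, OF F(2)[OF Q(2)] dQ] pQ by simp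
    ultimately show ?thesis using db by (simp add: pderiv_i_mult)
  qed
  have "divop a (\<lambda>y. F (Q y + d)) y = (\<Sum>i\<in>UNIV. pderiv_i i (\<lambda>z. F1 (Q z + d) * b i z) y)"
    unfolding divop_def 1 ..
  also have "\<dots> = F1 (Q y + d) * (\<Sum>i\<in>UNIV. pderiv_i i (b i) y) + F2 (Q y + d) * (\<Sum>i\<in>UNIV. pderiv_i i Q y * b i y)"
    unfolding 2 by (simp add: sum.distrib sum_distrib_left mult_ac)
  also have "(\<Sum>i\<in>UNIV. pderiv_i i (b i) y) = divop a Q y" by (simp add: divop_def b_def[abs_def])
  also have "(\<Sum>i\<in>UNIV. pderiv_i i Q y * b i y) = gradient_form a Q y"
    unfolding b_def sum_distrib_left by (intro sum.cong) auto
  finally show ?thesis by (simp add: mult_ac)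
qed

text \<open>The bump is \<open>F (Q + r^2)\<close> with \<open>Q\<close> frozen at the centre
  \<open>y1\<close>. It is subsolution-like except for a multiple of the kernel concentrated at
  \<open>y1\<close>. The constants must not depend on \<open>y1\<close> or \<open>r\<close>:
  \<open>r\<close> is sent to 0 later, and \<open>y1\<close> ranges over a whole ball.\<close>

lemma almost_subharmonic_bumps:
  assumes y0: "y0 \<in> \<Omega>" and dim: "2 \<le> CARD('n)"
  obtains R \<rho> r1 c C where "0 < R" "cball y0 R \<subseteq> \<Omega>" "0 < \<rho>" "\<rho> \<le> R" "0 < r1" "0 < c" "0 \<le> C"
    "\<And>y1 r. y1 \<in> ball y0 \<rho> \<Longrightarrow> 0 < r \<Longrightarrow> r < r1 \<Longrightarrow> \<exists>\<phi>. test_function (ball y0 R) \<phi> \<and> (\<forall>y. 0 \<le> \<phi> y) \<and>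
       (\<forall>y\<in>ball y0 \<rho>. c \<le> \<phi> y) \<and>
       (\<forall>y\<in>ball y0 R. c * indicator (ball y0 \<rho>) y - C * reg_kernel r (y - y1) \<le> divop a \<phi> y)"
proof -
  obtain R C1 \<mu> \<nu> where R: "0 < R" "cball y0 R \<subseteq> \<Omega>" and C1: "0 \<le> C1" and \<mu>: "0 < \<mu>" and \<nu>: "0 < \<nu>"
    and QQ: "\<And>y1. y1 \<in> cball y0 R \<Longrightarrow> \<exists>Q. smooth_on UNIV Q \<and>
       (\<forall>y. \<mu> * (norm (y - y1))\<^sup>2 \<le> Q y \<and> Q y \<le> \<nu> * (norm (y - y1))\<^sup>2) \<and>
       (\<forall>y\<in>cball y0 R. 0 \<le> gradient_form a Q y \<and>
          \<bar>gradient_form a Q y - 4 * Q y\<bar> \<le> C1 * (Q y * sqrt (Q y)) \<and>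
          \<bar>divop a Q y - 2 * real CARD('n)\<bar> \<le> C1 * sqrt (Q y))"
    by (rule frozen_quadratic_form[OF y0]) (rule that)
  let ?n = "real CARD('n)"
  have n: "2 \<le> ?n" using dim by simp
  obtain S1 where S1: "0 < S1" and prof: "\<And>S0. 0 < S0 \<Longrightarrow> S0 \<le> S1 \<Longrightarrow> \<exists>F F1 F2. is_radial_profile ?n C1 S0 F F1 F2"
    by (rule radial_profile[OF n C1]) (rule that)
  \<comment> \<open>The second bound makes the bump vanish at distance \<open>R / 4\<close> from
    \<open>y1\<close>, hence outside \<open>cball y0 (R / 2)\<close>, as \<open>y1\<close> lies
    within \<open>R / 4\<close> of \<open>y0\<close>.\<close>
  define S0 where "S0 = min S1 (\<mu> * (R / 4)\<^sup>2)"
  have S0: "0 < S0" "S0 \<le> S1" "S0 \<le> \<mu> * (R / 4)\<^sup>2" using S1 \<mu> R by (auto simp: S0_def)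
  obtain F F1 F2 where prof: "is_radial_profile ?n C1 S0 F F1 F2" using prof[OF S0(1,2)] by blast
  have smF: "smooth_on {0<..} F"
    and dF: "\<And>s. 0 < s \<Longrightarrow> (F has_real_derivative F1 s) (at s)"
      "\<And>s. 0 < s \<Longrightarrow> (F1 has_real_derivative F2 s) (at s)"
    and F0: "\<And>s. S0 \<le> s \<Longrightarrow> F s = 0" and Fnn: "\<And>s. 0 < s \<Longrightarrow> 0 \<le> F s" and Fpos: "0 < F (S0 / 2)"
    and Fmono: "\<And>s t. 0 < s \<Longrightarrow> s \<le> t \<Longrightarrow> F t \<le> F s"
    and Fineq: "\<And>Q r e l. 0 \<le> Q \<Longrightarrow> 0 < r \<Longrightarrow> 0 \<le> e \<Longrightarrow> \<bar>e - 4 * Q\<bar> \<le> C1 * (Q * sqrt Q) \<Longrightarrow> \<bar>l - 2 * ?n\<bar> \<le> C1 * sqrt Q \<Longrightarrow>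
       flat_exp 0 (S0 - (Q + r\<^sup>2)) - 2 * ?n * r\<^sup>2 * (Q + r\<^sup>2) powr (- ?n / 2 - 1)
         \<le> e * F2 (Q + r\<^sup>2) + l * F1 (Q + r\<^sup>2)"
    using prof unfolding is_radial_profile_def by simp_all
  \<comment> \<open>\<open>\<rho>\<close> and \<open>r1\<close> are chosen so that \<open>Q\<close>
    and \<open>r^2\<close> are each at most \<open>S0 / 4\<close> on \<open>ball y0 \<rho>\<close>.
    There the argument of \<open>F\<close> stays below \<open>S0 / 2\<close>, and \<open>c\<close>
    is read off at that point.\<close>
  define \<rho> where "\<rho> = min (R / 4) (sqrt (S0 / (16 * \<nu>)))"
  have \<rho>: "0 < \<rho>" "\<rho> \<le> R / 4" using R S0 \<nu> by (auto simp: \<rho>_def)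
  have \<rho>2: "\<nu> * (2 * \<rho>)\<^sup>2 \<le> S0 / 4"
  proof -
    have "\<rho>\<^sup>2 \<le> (sqrt (S0 / (16 * \<nu>)))\<^sup>2" using \<rho>(1) by (intro power_mono) (auto simp: \<rho>_def)
    also have "\<dots> = S0 / (16 * \<nu>)" using S0 \<nu> by simp
    finally show ?thesis using \<nu> by (simp add: power_mult_distrib field_simps)
  qed
  define r1 where "r1 = sqrt S0 / 2"
  have r1: "0 < r1" using S0 by (simp add: r1_def)
  define c where "c = min (F (S0 / 2)) (flat_exp 0 (S0 / 2))"
  have c: "0 < c" using Fpos S0 by (simp add: c_def)
  \<comment> \<open>Capping at 1 lets one factor bound both \<open>Q\<close> from below by the
    squared norm and \<open>r^2\<close> by itself, so that \<open>Q + r^2\<close> compares with the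
    argument of \<open>reg_kernel\<close>.\<close>
  define \<mu>' where "\<mu>' = min \<mu> 1"
  have \<mu>': "0 < \<mu>'" "\<mu>' \<le> \<mu>" "\<mu>' \<le> 1" using \<mu> by (auto simp: \<mu>'_def)
  define C where "C = 2 * ?n * \<mu>' powr (- ?n / 2 - 1)"
  have C: "0 \<le> C" by (simp add: C_def)
  show thesis
  proof (rule that[OF R \<rho>(1) _ r1 c C])
    show "\<rho> \<le> R" using \<rho> R by simp
    fix y1 r assume y1: "y1 \<in> ball y0 \<rho>" and r: "0 < r" "r < r1"
    then have "y1 \<in> cball y0 R" using \<rho> R by auto
    from QQ[OF this] obtain Q where Q: "smooth_on UNIV Q"
      "\<forall>y. \<mu> * (norm (y - y1))\<^sup>2 \<le> Q y \<and> Q y \<le> \<nu> * (norm (y - y1))\<^sup>2"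
      "\<forall>y\<in>cball y0 R. 0 \<le> gradient_form a Q y \<and>
          \<bar>gradient_form a Q y - 4 * Q y\<bar> \<le> C1 * (Q y * sqrt (Q y)) \<and>
          \<bar>divop a Q y - 2 * ?n\<bar> \<le> C1 * sqrt (Q y)"
      by (elim exE conjE) (rule that)
    have smQ: "smooth_on UNIV Q"
      and Qb: "\<And>y. \<mu> * (norm (y - y1))\<^sup>2 \<le> Q y" "\<And>y. Q y \<le> \<nu> * (norm (y - y1))\<^sup>2"
      and Qe: "\<And>y. y \<in> cball y0 R \<Longrightarrow> 0 \<le> gradient_form a Q y"
        "\<And>y. y \<in> cball y0 R \<Longrightarrow> \<bar>gradient_form a Q y - 4 * Q y\<bar> \<le> C1 * (Q y * sqrt (Q y))"
        "\<And>y. y \<in> cball y0 R \<Longrightarrow> \<bar>divop a Q y - 2 * ?n\<bar> \<le> C1 * sqrt (Q y)"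
      using Q by simp_all
    have Q0: "0 \<le> Q y" for y using order_trans[OF _ Qb(1)[of y]] \<mu> by simp
    have s0: "0 < Q y + r\<^sup>2" for y using Q0[of y] r by (simp add: add_nonneg_pos)
    have r2: "r\<^sup>2 \<le> S0 / 4"
    proof -
      have "r\<^sup>2 \<le> r1\<^sup>2" using r by (intro power_mono) auto
      then show ?thesis using S0 by (simp add: r1_def power_divide)
    qed
    have near: "Q y + r\<^sup>2 \<le> S0 / 2" if "y \<in> ball y0 \<rho>" for y
    proof -
      have "norm (y - y1) \<le> 2 * \<rho>"
        using that y1 dist_triangle2[of y y1 y0] by (simp add: dist_norm[symmetric] dist_commute)
      then have "\<nu> * (norm (y - y1))\<^sup>2 \<le> \<nu> * (2 * \<rho>)\<^sup>2" using \<nu> by (intro mult_left_mono power_mono) auto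
      then show ?thesis using \<rho>2 r2 Qb(2)[of y] by linarith
    qed
    define \<phi> where "\<phi> y = F (Q y + r\<^sup>2)" for y
    have test: "test_function (ball y0 R) \<phi>"
    proof (rule test_functionI[of _ "cball y0 (R / 2)"])
      show "smooth_on UNIV \<phi>"
        unfolding smooth_on_def
      proof
        fix k
        have "Ck_on k UNIV (\<lambda>y. Q y + r\<^sup>2)"
          by (rule Ck_on_add[OF open_UNIV _ Ck_on_const]) (use smQ in \<open>simp add: smooth_on_def\<close>)
        moreover have "Ck_on k {0<..} F" using smF by (simp add: smooth_on_def)
        ultimately have "Ck_on k UNIV (\<lambda>y. F (Q y + r\<^sup>2))"
          by (rule Ck_on_compose_real[OF open_UNIV]) (use s0 in auto)
        then show "Ck_on k UNIV \<phi>" by (simp add: \<phi>_def[abs_def])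
      qed
      show "cball y0 (R / 2) \<subseteq> ball y0 R" using R by auto
      show "\<phi> y = 0" if "y \<notin> cball y0 (R / 2)" for y
      proof -
        have "R / 4 \<le> norm (y - y1)"
          using that y1 \<rho> dist_triangle[of y0 y y1] by (simp add: dist_norm[symmetric] dist_commute)
        then have "\<mu> * (R / 4)\<^sup>2 \<le> \<mu> * (norm (y - y1))\<^sup>2" using \<mu> R by (intro mult_left_mono power_mono) auto
        then have "S0 \<le> Q y + r\<^sup>2" using S0(3) Qb(1)[of y] by (simp add: add_increasing2)
        then show ?thesis by (simp add: \<phi>_def F0)
      qed
    qed simp
    moreover have "0 \<le> \<phi> y" for y unfolding \<phi>_def by (rule Fnn[OF s0])
    moreover have "c \<le> \<phi> y" if "y \<in> ball y0 \<rho>" for y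
      using Fmono[OF s0 near[OF that]] by (simp add: \<phi>_def c_def)
    moreover have "c * indicator (ball y0 \<rho>) y - C * reg_kernel r (y - y1) \<le> divop a \<phi> y" if y: "y \<in> ball y0 R" for y
    proof -
      let ?s = "Q y + r\<^sup>2"
      have yc: "y \<in> cball y0 R" and y\<Omega>: "y \<in> \<Omega>" using y R by auto
      have "flat_exp 0 (S0 - ?s) - 2 * ?n * r\<^sup>2 * ?s powr (- ?n / 2 - 1) \<le> divop a \<phi> y"
      proof -
        have "divop a \<phi> y = gradient_form a Q y * F2 ?s
            + divop a Q y * F1 ?s"
          unfolding \<phi>_def by (rule divop_radial[OF smQ s0 dF y\<Omega>])
        then show ?thesis using Fineq[OF Q0 r(1) Qe[OF yc]] by simp
      qed
      moreover have "c * indicator (ball y0 \<rho>) y \<le> flat_exp 0 (S0 - ?s)"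
      proof (cases "y \<in> ball y0 \<rho>")
        case True
        have "flat_exp 0 (S0 / 2) \<le> flat_exp 0 (S0 - ?s)" using near[OF True] by (intro flat_exp_0_mono) simp
        then show ?thesis using True by (simp add: c_def)
      qed simp
      moreover have "2 * ?n * r\<^sup>2 * ?s powr (- ?n / 2 - 1) \<le> C * reg_kernel r (y - y1)"
      proof -
        have "\<mu>' * ((norm (y - y1))\<^sup>2 + r\<^sup>2) \<le> ?s"
        proof -
          have "\<mu>' * (norm (y - y1))\<^sup>2 \<le> \<mu> * (norm (y - y1))\<^sup>2" "\<mu>' * r\<^sup>2 \<le> 1 * r\<^sup>2"
            using \<mu>' by (intro mult_right_mono; simp)+
          then show ?thesis using Qb(1)[of y] by (simp add: distrib_left)
        qed
        moreover have "0 < \<mu>' * ((norm (y - y1))\<^sup>2 + r\<^sup>2)" using \<mu>' r by (intro mult_pos_pos add_nonneg_pos) auto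
        ultimately have "?s powr (- ?n / 2 - 1) \<le> (\<mu>' * ((norm (y - y1))\<^sup>2 + r\<^sup>2)) powr (- ?n / 2 - 1)"
          using n by (intro powr_mono2') auto
        also have "\<dots> = \<mu>' powr (- ?n / 2 - 1) * ((norm (y - y1))\<^sup>2 + r\<^sup>2) powr (- ?n / 2 - 1)"
          using \<mu>' by (simp add: powr_mult)
        finally have "2 * ?n * r\<^sup>2 * ?s powr (- ?n / 2 - 1) \<le>
            2 * ?n * r\<^sup>2 * (\<mu>' powr (- ?n / 2 - 1) * ((norm (y - y1))\<^sup>2 + r\<^sup>2) powr (- ?n / 2 - 1))"
          by (intro mult_left_mono) auto
        also have "\<dots> = C * reg_kernel r (y - y1)" by (simp add: C_def reg_kernel_def mult_ac)
        finally show ?thesis .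
      qed
      ultimately show ?thesis by linarith
    qed
    ultimately show "\<exists>\<phi>. test_function (ball y0 R) \<phi> \<and> (\<forall>y. 0 \<le> \<phi> y) \<and> (\<forall>y\<in>ball y0 \<rho>. c \<le> \<phi> y) \<and>
       (\<forall>y\<in>ball y0 R. c * indicator (ball y0 \<rho>) y - C * reg_kernel r (y - y1) \<le> divop a \<phi> y)"
      by (intro exI[of _ \<phi>]) blast
  qed
qed

text \<open>A weak Harnack inequality for distributional supersolutions \<open>q\<close>; \<open>\<Lambda>\<close> is the mass of a
  point source of \<open>q\<close> at \<open>y0\<close>.\<close>

lemma mean_value_inequality:
  assumes y0: "y0 \<in> \<Omega>" and dim: "2 \<le> CARD('n)"
  obtains R \<rho> c C where "0 < R" "cball y0 R \<subseteq> \<Omega>" "0 < \<rho>" "\<rho> \<le> R" "0 < c" "0 \<le> C"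
    "\<forall>q y1 \<Lambda>. y1 \<in> ball y0 \<rho> \<longrightarrow> set_integrable lborel (ball y0 R) q \<longrightarrow>
       (AE y in lborel. y \<in> ball y0 R \<longrightarrow> 0 \<le> q y) \<longrightarrow> isCont q y1 \<longrightarrow> 0 \<le> q y1 \<longrightarrow> 0 \<le> \<Lambda> \<longrightarrow>
       (\<forall>\<phi>. test_function (ball y0 R) \<phi> \<longrightarrow> (\<forall>y. 0 \<le> \<phi> y) \<longrightarrow>
          (LINT y:ball y0 R|lborel. q y * divop a \<phi> y) \<le> - (\<Lambda> * \<phi> y0)) \<longrightarrow>
       c * \<Lambda> + c * (LINT y:ball y0 \<rho>|lborel. q y) \<le> C * q y1"
proof -
  obtain R \<rho> r1 c C where R: "0 < R" "cball y0 R \<subseteq> \<Omega>" and \<rho>: "0 < \<rho>" "\<rho> \<le> R" and r1: "0 < r1"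
    and c: "0 < c" and C: "0 \<le> C"
    and bump: "\<And>y1 r. y1 \<in> ball y0 \<rho> \<Longrightarrow> 0 < r \<Longrightarrow> r < r1 \<Longrightarrow> \<exists>\<phi>. test_function (ball y0 R) \<phi> \<and> (\<forall>y. 0 \<le> \<phi> y) \<and>
       (\<forall>y\<in>ball y0 \<rho>. c \<le> \<phi> y) \<and>
       (\<forall>y\<in>ball y0 R. c * indicator (ball y0 \<rho>) y - C * reg_kernel r (y - y1) \<le> divop a \<phi> y)"
    by (rule almost_subharmonic_bumps[OF y0 dim]) (rule that)
  obtain C0 where C0: "0 \<le> C0" "\<And>r (x :: real^'n). 0 < r \<Longrightarrow> integrable lborel (\<lambda>y. reg_kernel r (y - x))"
    "\<And>r (x :: real^'n). 0 < r \<Longrightarrow> (LINT y|lborel. reg_kernel r (y - x)) \<le> C0"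
    by (rule reg_kernel_mass) (rule that)
  show thesis
  proof (rule that[OF R \<rho> c mult_nonneg_nonneg[OF C C0(1)]], intro allI impI)
    fix q y1 \<Lambda>
    assume y1: "y1 \<in> ball y0 \<rho>" and qi: "set_integrable lborel (ball y0 R) q"
      and qn: "AE y in lborel. y \<in> ball y0 R \<longrightarrow> 0 \<le> q y" and qc: "isCont q y1" "0 \<le> q y1" and \<Lambda>: "0 \<le> \<Lambda>"
      and super: "\<forall>\<phi>. test_function (ball y0 R) \<phi> \<longrightarrow> (\<forall>y. 0 \<le> \<phi> y) \<longrightarrow>
          (LINT y:ball y0 R|lborel. q y * divop a \<phi> y) \<le> - (\<Lambda> * \<phi> y0)"
    \<comment> \<open>Extension by zero, as \<open>reg_kernel_limit\<close> works on the whole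
      space; continuity at \<open>y1\<close> survives because \<open>y1\<close> is interior to the
      ball.\<close>
    define g where "g y = indicator (ball y0 R) y * q y" for y
    have gi: "integrable lborel g" using qi by (simp add: g_def[abs_def] set_integrable_def)
    have gn: "AE y in lborel. 0 \<le> g y" using qn by eventually_elim (auto simp: g_def indicator_def)
    have y1R: "y1 \<in> ball y0 R" using y1 \<rho> by auto
    have gq: "g y1 = q y1" using y1R by (simp add: g_def)
    have gy: "0 \<le> g y1" using gq qc(2) by simp
    have gc: "isCont g y1"
    proof -
      have "\<forall>\<^sub>F y in nhds y1. y \<in> ball y0 R" using y1R by (intro eventually_nhds_in_open) auto
      then have "\<forall>\<^sub>F y in nhds y1. g y = q y" by eventually_elim (simp add: g_def)
      then show ?thesis using isCont_cong[of g q y1] qc(1) by blast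
    qed
    have g\<rho>: "set_integrable lborel (ball y0 \<rho>) q" using qi \<rho> by (auto intro: set_integrable_subset)
    let ?I = "LINT y:ball y0 \<rho>|lborel. q y"
    have key: "c * \<Lambda> + c * ?I \<le> C * (C0 * (q y1 + \<eta>) + \<eta>)" if \<eta>: "0 < \<eta>" for \<eta>
    proof -
      obtain r0 where r0: "0 < r0" "\<And>r. 0 < r \<Longrightarrow> r < r0 \<Longrightarrow> integrable lborel (\<lambda>y. g y * reg_kernel r (y - y1))"
        "\<And>r. 0 < r \<Longrightarrow> r < r0 \<Longrightarrow> (LINT y|lborel. g y * reg_kernel r (y - y1)) \<le> C0 * (g y1 + \<eta>) + \<eta>"
        by (rule reg_kernel_limit[OF C0 gi gn gc gy \<eta>]) (assumption, assumption, rule that)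
      define r where "r = min r0 r1 / 2"
      have r: "0 < r" "r < r0" "r < r1" using r0(1) r1 by (auto simp: r_def)
      obtain \<phi> where \<phi>: "test_function (ball y0 R) \<phi>" "\<And>y. 0 \<le> \<phi> y" "\<And>y. y \<in> ball y0 \<rho> \<Longrightarrow> c \<le> \<phi> y"
        "\<And>y. y \<in> ball y0 R \<Longrightarrow> c * indicator (ball y0 \<rho>) y - C * reg_kernel r (y - y1) \<le> divop a \<phi> y"
        using bump[OF y1 r(1,3)] by blast
      have "test_function \<Omega> \<phi>" by (rule test_function_mono[OF \<phi>(1)]) (use R in auto)
      from test_divop[OF this] obtain K where K: "compact K" "\<And>y. y \<notin> K \<Longrightarrow> divop a \<phi> y = 0"
        and Dc: "continuous_on UNIV (divop a \<phi>)"
        by (metis test_function_support test_function_smooth smooth_on_continuous_on)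
      obtain B where B: "\<And>y. \<bar>divop a \<phi> y\<bar> \<le> B"
        using bounded_continuous_compact_support[OF Dc K] by blast
      have Di: "integrable lborel (\<lambda>y. g y * divop a \<phi> y)"
      proof (rule Bochner_Integration.integrable_bound)
        show "integrable lborel (\<lambda>y. B * g y)" using gi by simp
        show "(\<lambda>y. g y * divop a \<phi> y) \<in> borel_measurable lborel"
          using Dc by (intro borel_measurable_times[OF borel_measurable_integrable[OF gi]])
            (simp add: borel_measurable_continuous_onI)
        show "AE y in lborel. norm (g y * divop a \<phi> y) \<le> norm (B * g y)"
        proof (rule AE_I2)
          fix y
          have "\<bar>g y\<bar> * \<bar>divop a \<phi> y\<bar> \<le> \<bar>g y\<bar> * \<bar>B\<bar>"
            using B[of y] by (intro mult_left_mono) auto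
          then show "norm (g y * divop a \<phi> y) \<le> norm (B * g y)" by (simp add: abs_mult mult.commute)
        qed
      qed
      have i\<rho>: "integrable lborel (\<lambda>y. indicator (ball y0 \<rho>) y * q y)"
        using g\<rho> by (simp add: set_integrable_def)
      \<comment> \<open>The bump inequality is multiplied by \<open>g >= 0\<close> and integrated.
        The supersolution property bounds the result by the mass term, and the kernel integral is
        almost a multiple of \<open>q y1\<close>.\<close>
      have "(LINT y|lborel. c * (indicator (ball y0 \<rho>) y * q y) - C * (g y * reg_kernel r (y - y1)))
          \<le> (LINT y|lborel. g y * divop a \<phi> y)"
      proof (rule integral_mono_AE[OF _ Di])
        show "integrable lborel (\<lambda>y. c * (indicator (ball y0 \<rho>) y * q y) - C * (g y * reg_kernel r (y - y1)))"
          using i\<rho> r0(2)[OF r(1,2)] by simp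
        show "AE y in lborel. c * (indicator (ball y0 \<rho>) y * q y) - C * (g y * reg_kernel r (y - y1)) \<le> g y * divop a \<phi> y"
          using gn
        proof eventually_elim
          case (elim y)
          show ?case
          proof (cases "y \<in> ball y0 R")
            case True
            have "g y * (c * indicator (ball y0 \<rho>) y - C * reg_kernel r (y - y1)) \<le> g y * divop a \<phi> y"
              using \<phi>(4)[OF True] elim by (rule mult_left_mono)
            then show ?thesis using True by (simp add: g_def algebra_simps)
          next
            case False
            then have "y \<notin> ball y0 \<rho>" using \<rho> by auto
            then show ?thesis using False by (simp add: g_def)
          qed
        qed
      qed
      also have "(LINT y|lborel. g y * divop a \<phi> y) = (LINT y:ball y0 R|lborel. q y * divop a \<phi> y)"
        by (simp add: set_lebesgue_integral_def g_def mult.assoc)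
      also have "\<dots> \<le> - (\<Lambda> * \<phi> y0)" using super \<phi>(1,2) by blast
      also have "\<dots> \<le> - (c * \<Lambda>)" using \<phi>(3)[of y0] \<rho>(1) \<Lambda> by (simp add: mult.commute mult_left_mono)
      finally have "c * ?I - C * (LINT y|lborel. g y * reg_kernel r (y - y1)) \<le> - (c * \<Lambda>)"
        using i\<rho> r0(2)[OF r(1,2)] by (simp add: set_lebesgue_integral_def)
      moreover have "C * (LINT y|lborel. g y * reg_kernel r (y - y1)) \<le> C * (C0 * (q y1 + \<eta>) + \<eta>)"
        using r0(3)[OF r(1,2)] C gq by (intro mult_left_mono) auto
      ultimately show ?thesis by linarith
    qed
    \<comment> \<open>Only the estimate \<open>key\<close> depends on \<open>\<eta>\<close>, so its
      error can be made smaller than any \<open>e\<close>.\<close>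
    show "c * \<Lambda> + c * ?I \<le> C * C0 * q y1"
    proof (rule field_le_epsilon)
      fix e :: real assume e: "0 < e"
      define \<eta> where "\<eta> = e / (C * C0 + C + 1)"
      have D: "0 < C * C0 + C + 1" using C C0(1) by (simp add: add_nonneg_pos)
      then have \<eta>: "0 < \<eta>" using e by (simp add: \<eta>_def)
      have "C * (C0 * (q y1 + \<eta>) + \<eta>) = C * C0 * q y1 + (C * C0 + C) * \<eta>" by (simp add: algebra_simps)
      also have "(C * C0 + C) * \<eta> \<le> (C * C0 + C + 1) * \<eta>" using \<eta> by (intro mult_right_mono) auto
      also have "(C * C0 + C + 1) * \<eta> = e" using D by (simp add: \<eta>_def)
      finally show "c * \<Lambda> + c * ?I \<le> C * C0 * q y1 + e" using key[OF \<eta>] by simp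
    qed
  qed
qed

end

section \<open>Riemannian volume and covectors in charts\<close>

lemma Ck_on_inner:
  assumes "open S" "Ck_on k S f"
  shows "Ck_on k S (\<lambda>x. f x \<bullet> b)"
  using assms(2)
proof (induction k arbitrary: f)
  case 0
  then show ?case by (simp add: continuous_on_inner)
next
  case (Suc k)
  note f = Ck_on_SucE[OF Suc.prems]
  show ?case
    by (rule Ck_on_SucI[OF assms(1) has_derivative_inner_left[OF f(1)] Suc.IH[OF f(2)]])
qed

lemma smooth_on_compose:
  fixes f :: "'b::euclidean_space \<Rightarrow> real" and h :: "'a::euclidean_space \<Rightarrow> 'b"
  assumes "open S" "smooth_on S h" "smooth_on T f" "h ` S \<subseteq> T"
  shows "smooth_on S (\<lambda>x. f (h x))"
  unfolding smooth_on_def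
proof
  fix k
  show "Ck_on k S (\<lambda>x. f (h x))"
    using assms(2,3) unfolding smooth_on_def
    by (intro Ck_on_compose[OF assms(1) Ck_on_inner[OF assms(1)] _ assms(4)]) simp_all
qed

lemma smooth_on_real_compose:
  fixes f :: "real \<Rightarrow> real" and h :: "'a::euclidean_space \<Rightarrow> real"
  assumes "open S" "smooth_on S h" "\<And>k. Ck_on k T f" "h ` S \<subseteq> T"
  shows "smooth_on S (\<lambda>x. f (h x))"
  using assms unfolding smooth_on_def by (blast intro: Ck_on_compose_real)

section \<open>Determinants and inverses of positive definite matrices\<close>

lemma smooth_on_det:
  fixes M :: "real^'m \<Rightarrow> real^'n^'n"
  assumes "open S" "\<And>i j. smooth_on S (\<lambda>y. M y $ i $ j)"
  shows "smooth_on S (\<lambda>y. det (M y))"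
  using assms unfolding det_def smooth_on_def
  by (intro allI Ck_on_sum Ck_on_mult Ck_on_const Ck_on_prod) simp_all

text \<open>Cramer's rule. It presents the entries of the inverse as determinants over a
  determinant, from which their smooth dependence on the matrix can be read off.\<close>

lemma matrix_inv_entry:
  fixes A :: "real^'n^'n"
  assumes "det A \<noteq> 0"
  shows "matrix_inv A $ i $ j = det (\<chi> p q. if q = i then axis j 1 $ p else A $ p $ q) * (det A) powi -1"
proof -
  have inv: "invertible A" using assms by (simp add: invertible_det_nz)
  have "A *v (matrix_inv A *v axis j 1) = axis j 1"
    using matrix_inv_mult(1)[OF inv] by (simp add: matrix_vector_mul_assoc)
  then have "matrix_inv A *v axis j 1 = (\<chi> k. det (\<chi> p q. if q = k then axis j 1 $ p else A $ p $ q) / det A)"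
    using cramer[OF assms] by blast
  then have "(matrix_inv A *v axis j 1) $ i = det (\<chi> p q. if q = i then axis j 1 $ p else A $ p $ q) / det A"
    by simp
  then show ?thesis by (simp add: matrix_vector_mult_basis column_def divide_inverse)
qed

lemma smooth_on_matrix_inv:
  fixes M :: "real^'m \<Rightarrow> real^'n^'n"
  assumes S: "open S" and M: "\<And>i j. smooth_on S (\<lambda>y. M y $ i $ j)" and pos: "\<And>y. y \<in> S \<Longrightarrow> 0 < det (M y)"
  shows "smooth_on S (\<lambda>y. matrix_inv (M y) $ i $ j)"
proof -
  have "smooth_on S (\<lambda>y. det (\<chi> p q. if q = i then axis j 1 $ p else M y $ p $ q))"
  proof (rule smooth_on_det[OF S])
    fix p q
    show "smooth_on S (\<lambda>y. (\<chi> p q. if q = i then axis j 1 $ p else M y $ p $ q) $ p $ q)"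
      by (cases "q = i") (simp_all add: M smooth_on_const)
  qed
  moreover have "smooth_on S (\<lambda>y. det (M y) powr -1)"
    by (rule smooth_on_real_compose[OF S smooth_on_det[OF S M] Ck_on_powr]) (use pos in auto)
  ultimately have "smooth_on S (\<lambda>y. det (\<chi> p q. if q = i then axis j 1 $ p else M y $ p $ q) * det (M y) powr -1)"
    by (rule smooth_on_mult[OF S])
  moreover have "matrix_inv (M y) $ i $ j = det (\<chi> p q. if q = i then axis j 1 $ p else M y $ p $ q) * det (M y) powr -1"
    if "y \<in> S" for y
  proof -
    have "det (M y) powr -1 = det (M y) powi -1" using pos[OF that] by (simp add: powr_minus power_int_minus)
    then show ?thesis using pos[OF that] by (subst matrix_inv_entry) auto
  qed
  ultimately show ?thesis using smooth_on_cong[OF S] by (metis (no_types, lifting))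
qed

text \<open>The segment from the identity to \<open>A\<close> consists of invertible matrices, being
  positive definite, so the determinant cannot change sign along it.\<close>

lemma pos_def_det_pos:
  fixes A :: "real^'n^'n"
  assumes "\<And>v. v \<noteq> 0 \<Longrightarrow> 0 < v \<bullet> (A *v v)"
  shows "0 < det A"
proof (rule ccontr)
  assume "\<not> 0 < det A"
  define B where "B t = (\<chi> i j. t * A $ i $ j + (1 - t) * (mat 1 :: real^'n^'n) $ i $ j)" for t
  have B_eq: "B t = t *\<^sub>R A + (1 - t) *\<^sub>R mat 1" for t
    by (simp add: B_def vec_eq_iff)
  have "continuous_on {0..1} (\<lambda>t. det (B t))"
    unfolding det_def B_def by (auto intro!: continuous_intros)
  moreover have "det (B 0) = 1" "det (B 1) = det A" by (simp_all add: B_eq)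
  ultimately obtain t where t: "0 \<le> t" "t \<le> 1" "det (B t) = 0"
    using IVT2'[of "\<lambda>t. det (B t)" 1 0 0] \<open>\<not> 0 < det A\<close> by auto
  have "0 < v \<bullet> (B t *v v)" if "v \<noteq> 0" for v
  proof -
    have "v \<bullet> (B t *v v) = t * (v \<bullet> (A *v v)) + (1 - t) * (v \<bullet> v)"
      by (simp add: B_eq matrix_vector_mult_add_rdistrib scaleR_matrix_vector_assoc[symmetric] inner_add_right)
    moreover have "0 < t * (v \<bullet> (A *v v)) \<or> 0 < (1 - t) * (v \<bullet> v)"
      using assms[OF that] that t by (cases "t = 0") auto
    moreover have "0 \<le> t * (v \<bullet> (A *v v))" "0 \<le> (1 - t) * (v \<bullet> v)"
      using assms[OF that] t by (auto intro: mult_nonneg_nonneg less_imp_le)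
    ultimately show ?thesis by linarith
  qed
  then have "invertible (B t)" by (rule pos_def_imp_invertible)
  then show False using t(3) by (simp add: invertible_det_nz)
qed

lemma matrix_inv_symmetric:
  fixes A :: "real^'n^'n"
  assumes "invertible A" "transpose A = A"
  shows "transpose (matrix_inv A) = matrix_inv A"
proof -
  have "transpose (matrix_inv A) ** A = mat 1"
    using matrix_inv_mult(1)[OF assms(1)] assms(2) by (metis matrix_transpose_mul transpose_mat)
  then have "transpose (matrix_inv A) ** A ** matrix_inv A = matrix_inv A" by simp
  then show ?thesis using matrix_inv_mult(1)[OF assms(1)] by (simp add: matrix_mul_assoc[symmetric])
qed

lemma matrix_inv_pos_def:
  fixes A :: "real^'n^'n"
  assumes "\<And>v. v \<noteq> 0 \<Longrightarrow> 0 < v \<bullet> (A *v v)" "v \<noteq> 0"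
  shows "0 < v \<bullet> (matrix_inv A *v v)"
proof -
  have "invertible A" by (rule pos_def_imp_invertible) (rule assms(1))
  then have v: "A *v (matrix_inv A *v v) = v" by (simp add: matrix_vector_mul_assoc matrix_inv_mult)
  then have "matrix_inv A *v v \<noteq> 0" using assms(2) by (metis matrix_vector_mult_0_right)
  from assms(1)[OF this] show ?thesis unfolding v by (simp add: inner_commute)
qed

text \<open>Local integrability gives measurability on each compact subset; an increasing exhaustion
  of \<open>\<Omega>\<close> by compact sets gives it in the limit.\<close>

lemma borel_measurable_locally_integrable:
  assumes "open \<Omega>" "locally_integrable \<Omega> f"
  shows "(\<lambda>y. indicator \<Omega> y * f y) \<in> borel_measurable borel"
proof -
  obtain C where C: "\<And>n. compact (C n)" "\<And>n. C n \<subseteq> \<Omega>" "\<And>n. C n \<subseteq> interior (C (Suc n))" "\<Union> (range C) = \<Omega>"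
    using open_Union_compact_subsets[OF assms(1)] by metis
  have mono: "incseq C" using C(3) interior_subset by (intro incseq_SucI) blast
  have lim: "(\<lambda>n. indicator (C n) y * f y) \<longlonglongrightarrow> indicator \<Omega> y * f y" for y
  proof (cases "y \<in> \<Omega>")
    case True
    then obtain m where "y \<in> C m" using C(4) by auto
    have "indicator (C n) y * f y = indicator \<Omega> y * f y" if "m \<le> n" for n
    proof -
      have "y \<in> C n" using incseqD[OF mono that] \<open>y \<in> C m\<close> by blast
      then show ?thesis using True by simp
    qed
    then have "\<forall>\<^sub>F n in sequentially. indicator (C n) y * f y = indicator \<Omega> y * f y"
      by (rule eventually_sequentiallyI)
    then show ?thesis by (rule tendsto_eventually)
  next
    case False
    then have "y \<notin> C n" for n using C(2) by blast
    then show ?thesis using False by simp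
  qed
  have meas: "(\<lambda>y. indicator (C n) y * f y) \<in> borel_measurable lborel" for n
    using assms(2) C(1,2)[of n] unfolding locally_integrable_def set_integrable_def
    by (auto intro: borel_measurable_integrable)
  have "(\<lambda>y. indicator \<Omega> y * f y) \<in> borel_measurable lborel"
    by (rule borel_measurable_LIMSEQ_real[where u = "\<lambda>n y. indicator (C n) y * f y"]) (rule lim, rule meas)
  then show ?thesis by simp
qed

section \<open>Functions, covectors and coefficients read in charts\<close>

definition ext_chart :: "('a, 'n) chart \<Rightarrow> (real^'n \<Rightarrow> real) \<Rightarrow> 'a \<Rightarrow> real" where
  "ext_chart c \<psi> x = (if x \<in> fst c then \<psi> (snd c x) else 0)"

definition dfield :: "('a \<Rightarrow> real) \<Rightarrow> ('a, 'n::finite) covector_field" where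
  "dfield f c x = (\<chi> i. pderiv_i i (f \<circ> cinv c) (snd c x))"

definition covector_inner ::
  "('a, 'n::finite) chart set \<Rightarrow> ('a, 'n) metric_tensor \<Rightarrow> ('a, 'n) covector_field
     \<Rightarrow> ('a, 'n) covector_field \<Rightarrow> 'a \<Rightarrow> real" where
  "covector_inner A g v w x = (let c = chart_at A x in v c x \<bullet> (matrix_inv (g c x) *v w c x))"

text \<open>The density is absorbed into the coefficients so that integrals against the volume
  become plain Lebesgue integrals in coordinates.\<close>

definition principal_coeff :: "('a, 'n::finite) metric_tensor \<Rightarrow> ('a, 'n) chart \<Rightarrow> real^'n \<Rightarrow> real^'n^'n" where
  "principal_coeff g c y = vol_density g c y *\<^sub>R matrix_inv (g c (cinv c y))"

text \<open>\<open>measure\<close> is 0 for a set of infinite mass, so the last assumption encodes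
  both finiteness and positivity of the total volume.\<close>

locale riemannian =
  fixes A :: "('a::{t2_space, second_countable_topology}, 'n::finite) chart set"
    and g :: "('a, 'n) metric_tensor"
    and vol :: "'a measure"
  assumes manifold: "compact_connected_riemannian_manifold A g"
    and volume: "riemannian_volume A g vol"
    and finite_volume: "0 < measure vol UNIV"
begin

abbreviation chart_div :: "('a, 'n) chart \<Rightarrow> (real^'n \<Rightarrow> real) \<Rightarrow> real^'n \<Rightarrow> real" where
  "chart_div c \<equiv> divop (principal_coeff g c)"

lemma compact_UNIV: "compact (UNIV :: 'a set)" and connected_UNIV: "connected (UNIV :: 'a set)"
  using manifold by (simp_all add: compact_connected_riemannian_manifold_def)

lemma chart_covers: obtains c where "c \<in> A" "x \<in> fst c"
proof -
  have "(\<Union>c\<in>A. fst c) = UNIV"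
    using manifold by (simp add: compact_connected_riemannian_manifold_def smooth_atlas_def)
  then show ?thesis using that by blast
qed

lemma transition_smooth:
  "c \<in> A \<Longrightarrow> d \<in> A \<Longrightarrow> smooth_on (snd c ` (fst c \<inter> fst d)) (snd d \<circ> cinv c)"
  using manifold by (simp add: compact_connected_riemannian_manifold_def smooth_atlas_def)

context
  fixes c assumes c: "c \<in> A"
begin

lemma open_chart: "open (fst c)" and open_cimage: "open (cimage c)"
  and homeo_chart: "homeomorphism (fst c) (cimage c) (snd c) (cinv c)"
  using manifold c by (auto simp: compact_connected_riemannian_manifold_def smooth_atlas_def is_chart_def)

lemma cinv_snd: "x \<in> fst c \<Longrightarrow> cinv c (snd c x) = x" and snd_cinv: "y \<in> cimage c \<Longrightarrow> snd c (cinv c y) = y"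
  and cinv_mem: "y \<in> cimage c \<Longrightarrow> cinv c y \<in> fst c" and snd_mem: "x \<in> fst c \<Longrightarrow> snd c x \<in> cimage c"
  and continuous_cinv: "continuous_on (cimage c) (cinv c)" and continuous_snd: "continuous_on (fst c) (snd c)"
  using homeo_chart by (auto simp: homeomorphism_def)

lemma open_cinv_preimage:
  assumes "open W"
  shows "open {y \<in> cimage c. cinv c y \<in> W}"
  using continuous_open_preimage[OF continuous_cinv open_cimage assms] by (simp add: vimage_def Int_def)

lemma overlap_image: "snd c ` (fst c \<inter> W) = {y \<in> cimage c. cinv c y \<in> W}"
  using cinv_snd snd_cinv cinv_mem snd_mem by force

lemma open_overlap_image: "open W \<Longrightarrow> open (snd c ` (fst c \<inter> W))"
  unfolding overlap_image by (rule open_cinv_preimage)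

lemma metric_smooth: "smooth_on (cimage c) (\<lambda>y. g c (cinv c y) $ i $ j)"
  and metric_symmetric: "x \<in> fst c \<Longrightarrow> transpose (g c x) = g c x"
  and metric_pos: "x \<in> fst c \<Longrightarrow> v \<noteq> 0 \<Longrightarrow> 0 < v \<bullet> (g c x *v v)"
proof -
  have "riemannian_metric A g" using manifold by (simp add: compact_connected_riemannian_manifold_def)
  note m = bspec[OF this[unfolded riemannian_metric_def, THEN conjunct1] c]
  show "smooth_on (cimage c) (\<lambda>y. g c (cinv c y) $ i $ j)" using m by blast
  show "x \<in> fst c \<Longrightarrow> transpose (g c x) = g c x" using m by blast
  show "x \<in> fst c \<Longrightarrow> v \<noteq> 0 \<Longrightarrow> 0 < v \<bullet> (g c x *v v)" using m by blast
qed

lemma metric_det_pos: "x \<in> fst c \<Longrightarrow> 0 < det (g c x)"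
  by (rule pos_def_det_pos) (rule metric_pos)

lemma metric_invertible: "x \<in> fst c \<Longrightarrow> invertible (g c x)"
  by (rule pos_def_imp_invertible) (rule metric_pos)

lemma vol_density_pos: "y \<in> cimage c \<Longrightarrow> 0 < vol_density g c y"
  using metric_det_pos[OF cinv_mem] by (simp add: vol_density_def)

lemma smooth_vol_density: "smooth_on (cimage c) (vol_density g c)"
proof -
  have "smooth_on (cimage c) (\<lambda>y. det (g c (cinv c y)) powr (1 / 2))"
    using metric_det_pos[OF cinv_mem]
    by (intro smooth_on_real_compose[OF open_cimage smooth_on_det[OF open_cimage metric_smooth] Ck_on_powr]) auto
  moreover have "det (g c (cinv c y)) powr (1 / 2) = vol_density g c y" if "y \<in> cimage c" for y
    using metric_det_pos[OF cinv_mem[OF that]] by (simp add: vol_density_def powr_half_sqrt)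
  ultimately show ?thesis using smooth_on_cong[OF open_cimage] by (metis (no_types, lifting))
qed

lemma smooth_metric_inv: "smooth_on (cimage c) (\<lambda>y. matrix_inv (g c (cinv c y)) $ i $ j)"
  by (rule smooth_on_matrix_inv[OF open_cimage metric_smooth metric_det_pos[OF cinv_mem]])

lemma elliptic_chart: "elliptic (cimage c) (principal_coeff g c)"
proof
  show "open (cimage c)" by (rule open_cimage)
  show "smooth_on (cimage c) (\<lambda>y. principal_coeff g c y $ i $ j)" for i j
    unfolding principal_coeff_def using smooth_on_mult[OF open_cimage smooth_vol_density smooth_metric_inv] by simp
  fix y assume y: "y \<in> cimage c"
  show "transpose (principal_coeff g c y) = principal_coeff g c y"
    using matrix_inv_symmetric[OF metric_invertible metric_symmetric] cinv_mem[OF y]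
    by (simp add: principal_coeff_def transpose_scalar)
  show "0 < v \<bullet> (principal_coeff g c y *v v)" if "v \<noteq> 0" for v
    using matrix_inv_pos_def[OF metric_pos that, OF cinv_mem[OF y]] vol_density_pos[OF y]
    by (simp add: principal_coeff_def scaleR_matrix_vector_assoc[symmetric])
qed

lemma chart_laplacian_eq:
  "chart_laplacian g c f x = - (1 / vol_density g c (snd c x)) * chart_div c (f \<circ> cinv c) (snd c x)"
  by (simp add: chart_laplacian_def divop_def principal_coeff_def sum_distrib_left mult.assoc)

lemma ext_chart_cinv: "y \<in> cimage c \<Longrightarrow> ext_chart c \<psi> (cinv c y) = \<psi> y"
  by (simp add: ext_chart_def cinv_mem snd_cinv)

end

text \<open>The support has compact, hence closed, image in the Hausdorff manifold. Around a point
  outside it the function vanishes; around a point of \<open>fst c\<close> a transition map composed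
  with \<open>\<psi>\<close> describes it in the other chart.\<close>

lemma smooth_fun_ext_chart:
  assumes c: "c \<in> A" and \<psi>: "test_function (cimage c) \<psi>"
  shows "smooth_fun A (ext_chart c \<psi>)"
  unfolding smooth_fun_def
proof
  fix d assume d: "d \<in> A"
  obtain K where K: "compact K" "K \<subseteq> cimage c" "\<And>y. y \<notin> K \<Longrightarrow> \<psi> y = 0"
    using \<psi> by (rule test_function_support) (rule that)
  define K' where "K' = cinv c ` K"
  have "compact K'" unfolding K'_def
    by (rule compact_continuous_image[OF continuous_on_subset[OF continuous_cinv[OF c] K(2)] K(1)])
  then have cl: "open (- K')" using compact_imp_closed by blast
  have K'c: "K' \<subseteq> fst c" using K(2) cinv_mem[OF c] by (auto simp: K'_def)
  have z: "ext_chart c \<psi> x = 0" if "x \<notin> K'" for x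
  proof (cases "x \<in> fst c")
    case True
    then have "snd c x \<notin> K" using that cinv_snd[OF c True] by (metis K'_def image_eqI)
    then show ?thesis using K(3) by (simp add: ext_chart_def)
  qed (simp add: ext_chart_def)
  show "smooth_on (cimage d) (ext_chart c \<psi> \<circ> cinv d)"
  proof (rule smooth_on_local)
    fix y assume y: "y \<in> cimage d"
    show "\<exists>T. open T \<and> y \<in> T \<and> smooth_on T (ext_chart c \<psi> \<circ> cinv d)"
    proof (cases "cinv d y \<in> fst c")
      case True
      let ?T = "{y \<in> cimage d. cinv d y \<in> fst c}"
      have oT: "open ?T" by (rule open_cinv_preimage[OF d open_chart[OF c]])
      have "smooth_on ?T (\<lambda>z. \<psi> ((snd c \<circ> cinv d) z))"
        using transition_smooth[OF d c] unfolding overlap_image[OF d]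
        by (rule smooth_on_compose[OF oT _ test_function_smooth[OF \<psi>]]) simp
      also have "smooth_on ?T (\<lambda>z. \<psi> ((snd c \<circ> cinv d) z)) \<longleftrightarrow> smooth_on ?T (ext_chart c \<psi> \<circ> cinv d)"
        by (rule smooth_on_cong[OF oT]) (simp add: ext_chart_def)
      finally show ?thesis using oT True y by blast
    next
      case False
      let ?T = "{y \<in> cimage d. cinv d y \<in> - K'}"
      have oT: "open ?T" by (rule open_cinv_preimage[OF d cl])
      have "smooth_on ?T (ext_chart c \<psi> \<circ> cinv d) \<longleftrightarrow> smooth_on ?T (\<lambda>z. 0 :: real)"
        by (rule smooth_on_cong[OF oT]) (simp add: z)
      then have "smooth_on ?T (ext_chart c \<psi> \<circ> cinv d)" using smooth_on_const by blast
      then show ?thesis using oT False y K'c by blast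
    qed
  qed
qed

lemma finite_charts: obtains \<C> where "finite \<C>" "\<C> \<subseteq> A" "(\<Union>c\<in>\<C>. fst c) = UNIV"
proof -
  have "UNIV \<subseteq> (\<Union>c\<in>A. fst c)" using chart_covers by blast
  then show ?thesis
    using compactE_image[OF compact_UNIV, of A fst] open_chart that by (metis top.extremum_uniqueI)
qed

lemma metric_transform:
  "c \<in> A \<Longrightarrow> d \<in> A \<Longrightarrow> x \<in> fst c \<Longrightarrow> x \<in> fst d \<Longrightarrow>
    g c x = transpose (transition_jacobian c d x) ** g d x ** transition_jacobian c d x"
  using manifold unfolding compact_connected_riemannian_manifold_def riemannian_metric_def by blast

text \<open>The vector \<open>\<xi>\<close> is the covector \<open>w\<close> with its index raised,
  and the Jacobian \<open>J\<close> carries it to the raised covector in the other chart. Cancelling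
  the transposed Jacobian is justified because the determinant of \<open>g c x\<close>, which
  contains it as a factor, is nonzero.\<close>

lemma covector_inner_invariant:
  assumes "c \<in> A" "d \<in> A" "x \<in> fst c" "x \<in> fst d" "covector_field A v" "covector_field A w"
  shows "v c x \<bullet> (matrix_inv (g c x) *v w c x) = v d x \<bullet> (matrix_inv (g d x) *v w d x)"
proof -
  define J where "J = transition_jacobian c d x"
  have gc: "g c x = transpose J ** g d x ** J" unfolding J_def using assms by (intro metric_transform)
  have vw: "v c x = transpose J *v v d x" "w c x = transpose J *v w d x"
    using assms unfolding covector_field_def J_def by blast+
  have "det (g c x) \<noteq> 0" using metric_det_pos[OF assms(1,3)] by simp
  then have "invertible (transpose J)" unfolding gc by (simp add: det_mul invertible_det_nz)
  then have inj: "p = q" if "transpose J *v p = transpose J *v q" for p q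
    using that by (metis matrix_inv_mult(2) matrix_vector_mul_assoc matrix_vector_mul_lid)
  define \<xi> where "\<xi> = matrix_inv (g c x) *v w c x"
  have "g c x *v \<xi> = w c x"
    using matrix_inv_mult(1)[OF metric_invertible[OF assms(1,3)]] by (simp add: \<xi>_def matrix_vector_mul_assoc)
  then have "transpose J *v (g d x *v (J *v \<xi>)) = transpose J *v w d x"
    unfolding gc vw by (simp only: matrix_vector_mul_assoc matrix_mul_assoc)
  then have "g d x *v (J *v \<xi>) = w d x" by (rule inj)
  then have J\<xi>: "J *v \<xi> = matrix_inv (g d x) *v w d x"
    using matrix_inv_mult(2)[OF metric_invertible[OF assms(2,4)]]
    by (metis matrix_vector_mul_assoc matrix_vector_mul_lid)
  have "v c x \<bullet> \<xi> = v d x \<bullet> (J *v \<xi>)"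
    unfolding vw by (metis dot_lmul_matrix transpose_matrix_vector)
  then show ?thesis using J\<xi> by (simp add: \<xi>_def)
qed

lemma chart_at_mem: "chart_at A x \<in> A" "x \<in> fst (chart_at A x)"
proof -
  have "\<exists>c. c \<in> A \<and> x \<in> fst c" using chart_covers by metis
  from someI_ex[OF this] show "chart_at A x \<in> A" "x \<in> fst (chart_at A x)" by (simp_all add: chart_at_def)
qed

lemma covector_inner_eq:
  assumes "c \<in> A" "x \<in> fst c" "covector_field A v" "covector_field A w"
  shows "covector_inner A g v w x = v c x \<bullet> (matrix_inv (g c x) *v w c x)"
  unfolding covector_inner_def Let_def
  by (rule covector_inner_invariant[OF chart_at_mem(1) assms(1) chart_at_mem(2) assms(2-4)])

lemma covector_norm2_eq_inner: "covector_norm2 A g w = covector_inner A g w w"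
  by (simp add: covector_norm2_def covector_inner_def fun_eq_iff)

lemma covector_norm2_add:
  "covector_norm2 A g (\<lambda>c x. v c x + e *\<^sub>R w c x) x =
     covector_norm2 A g v x + 2 * e * covector_inner A g v w x + e\<^sup>2 * covector_norm2 A g w x"
proof -
  let ?c = "chart_at A x"
  let ?P = "matrix_inv (g ?c x)"
  have "transpose ?P = ?P"
    by (rule matrix_inv_symmetric[OF metric_invertible metric_symmetric]) (rule chart_at_mem)+
  then have "w ?c x \<bullet> (?P *v v ?c x) = v ?c x \<bullet> (?P *v w ?c x)"
    by (metis inner_symmetric_matrix inner_commute)
  then show ?thesis
    by (simp add: covector_norm2_def covector_inner_def Let_def matrix_vector_right_distrib
        matrix_vector_mult_scaleR inner_add_left inner_add_right power2_eq_square algebra_simps)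
qed

lemma dfield_covector:
  assumes f: "smooth_fun A f"
  shows "covector_field A (dfield f)"
  unfolding covector_field_def
proof (intro ballI)
  fix c d x assume c: "c \<in> A" and d: "d \<in> A" and x: "x \<in> fst c \<inter> fst d"
  define \<tau> where "\<tau> = snd d \<circ> cinv c"
  let ?T = "snd c ` (fst c \<inter> fst d)"
  have oT: "open ?T" by (rule open_overlap_image[OF c open_chart[OF d]])
  have xT: "snd c x \<in> ?T" using x by blast
  have \<tau>x: "\<tau> (snd c x) = snd d x" using cinv_snd[OF c] x by (simp add: \<tau>_def)
  have "(\<tau> has_derivative frechet_derivative \<tau> (at (snd c x))) (at (snd c x))"
    using smooth_on_differentiable[OF transition_smooth[OF c d] xT] by (simp add: \<tau>_def frechet_derivative_works)
  moreover have fd: "f \<circ> cinv d differentiable (at (snd d x))"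
    using f d snd_mem[OF d] x by (auto simp: smooth_fun_def intro: smooth_on_differentiable)
  then have "(f \<circ> cinv d has_derivative frechet_derivative (f \<circ> cinv d) (at (\<tau> (snd c x)))) (at (\<tau> (snd c x)))"
    by (simp add: \<tau>x frechet_derivative_works)
  ultimately have "((\<lambda>y. (f \<circ> cinv d) (\<tau> y)) has_derivative
      (\<lambda>v. frechet_derivative (f \<circ> cinv d) (at (\<tau> (snd c x))) (frechet_derivative \<tau> (at (snd c x)) v))) (at (snd c x))"
    by (rule has_derivative_compose)
  then have "((f \<circ> cinv c) has_derivative
      (\<lambda>v. frechet_derivative (f \<circ> cinv d) (at (snd d x)) (frechet_derivative \<tau> (at (snd c x)) v))) (at (snd c x))"
    unfolding \<tau>x
    by (rule has_derivative_transform_within_open[OF _ oT xT])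
      (use cinv_snd[OF c] cinv_snd[OF d] in \<open>auto simp: \<tau>_def\<close>)
  from pderiv_i_eqI[OF this]
  have "pderiv_i i (f \<circ> cinv c) (snd c x) =
      (\<Sum>k\<in>UNIV. frechet_derivative \<tau> (at (snd c x)) (axis i 1) $ k * pderiv_i k (f \<circ> cinv d) (snd d x))" for i
    by (simp add: frechet_derivative_eq_sum_pderiv_i[OF fd])
  then show "dfield f c x = transpose (transition_jacobian c d x) *v dfield f d x"
    by (simp add: vec_eq_iff dfield_def matrix_vector_mult_def transpose_def transition_jacobian_def
        jacobian_def matrix_def \<tau>_def)
qed

lemma dfield_zero:
  assumes "c \<in> A" "open W" "x \<in> W" "x \<in> fst c" "\<And>z. z \<in> W \<Longrightarrow> f z = 0"
  shows "dfield f c x = 0"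
proof -
  have "pderiv_i i (f \<circ> cinv c) (snd c x) = pderiv_i i (\<lambda>_. 0) (snd c x)" for i
    using assms snd_mem cinv_snd
    by (intro pderiv_i_cong[OF open_cinv_preimage[OF assms(1,2)]]) auto
  then show ?thesis by (simp add: dfield_def vec_eq_iff)
qed

section \<open>Integration against the Riemannian volume in charts\<close>

lemma sets_vol [measurable_cong]: "sets vol = sets borel" and space_vol: "space vol = UNIV"
  using volume sets_eq_imp_space_eq[of vol borel] by (auto simp: riemannian_volume_def)

lemma finite_measure_vol: "finite_measure vol"
proof
  show "emeasure vol (space vol) \<noteq> \<infinity>"
    using finite_volume by (auto simp: measure_def space_vol)
qed

text \<open>\<open>cinv\<close> is known to be continuous on the chart image only; a constant value
  elsewhere makes it Borel measurable on the whole space.\<close>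

definition chart_inverse :: "('a, 'n) chart \<Rightarrow> real^'n \<Rightarrow> 'a" where
  "chart_inverse c y = (if y \<in> cimage c then cinv c y else undefined)"

lemma measurable_chart_inverse: "c \<in> A \<Longrightarrow> chart_inverse c \<in> borel_measurable borel"
  unfolding chart_inverse_def[abs_def]
  by (rule borel_measurable_continuous_on_if)
    (auto intro: borel_open open_cimage continuous_cinv)

lemma measurable_vol_density: "c \<in> A \<Longrightarrow> (\<lambda>y. indicator (cimage c) y * vol_density g c y) \<in> borel_measurable borel"
  using borel_measurable_continuous_on_indicator[OF _ smooth_on_continuous_on[OF smooth_vol_density]] open_cimage
  by (simp add: borel_open)

text \<open>The volume formula for Borel sets is recast as an identity between measures, so that the
  general rules for image measures and densities yield the change of variables for
  integrals.\<close>

lemma chart_measure: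
  assumes c: "c \<in> A"
  shows "density vol (indicator (fst c)) =
    distr (density lborel (\<lambda>y. ennreal (indicator (cimage c) y * vol_density g c y))) borel (chart_inverse c)"
proof (rule measure_eqI)
  show "sets (density vol (indicator (fst c))) =
      sets (distr (density lborel (\<lambda>y. ennreal (indicator (cimage c) y * vol_density g c y))) borel (chart_inverse c))"
    by (simp add: sets_vol)
  fix B assume "B \<in> sets (density vol (indicator (fst c)))"
  then have B: "B \<in> sets borel" by (simp add: sets_vol)
  have U: "fst c \<in> sets borel" by (rule borel_open[OF open_chart[OF c]])
  note [measurable] = measurable_chart_inverse[OF c] measurable_vol_density[OF c]
  have "emeasure (density vol (indicator (fst c))) B = emeasure vol (fst c \<inter> B)"
    using B U by (subst emeasure_density) (auto simp: sets_vol indicator_inter_arith[symmetric])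
  also have "\<dots> = (\<integral>\<^sup>+y. ennreal (vol_density g c y) * indicator (snd c ` (fst c \<inter> B)) y \<partial>lborel)"
    using volume c B U by (auto simp: riemannian_volume_def)
  also have "\<dots> = (\<integral>\<^sup>+y. ennreal (indicator (cimage c) y * vol_density g c y) * indicator (chart_inverse c -` B) y \<partial>lborel)"
    unfolding overlap_image[OF c]
    by (intro nn_integral_cong) (auto simp: indicator_def chart_inverse_def)
  also have "\<dots> = emeasure (density lborel (\<lambda>y. ennreal (indicator (cimage c) y * vol_density g c y))) (chart_inverse c -` B \<inter> space (density lborel (\<lambda>y. ennreal (indicator (cimage c) y * vol_density g c y))))"
    using B by (subst emeasure_density) (auto intro!: measurable_sets_borel[OF measurable_chart_inverse[OF c]])
  also have "\<dots> = emeasure (distr (density lborel (\<lambda>y. ennreal (indicator (cimage c) y * vol_density g c y))) borel (chart_inverse c)) B"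
    using B by (subst emeasure_distr) auto
  finally show "emeasure (density vol (indicator (fst c))) B =
      emeasure (distr (density lborel (\<lambda>y. ennreal (indicator (cimage c) y * vol_density g c y))) borel (chart_inverse c)) B" .
qed

lemma chart_integral:
  fixes f :: "'a \<Rightarrow> real"
  assumes c: "c \<in> A" and f: "f \<in> borel_measurable borel"
  shows "integrable vol (\<lambda>x. indicator (fst c) x * f x) \<longleftrightarrow>
      set_integrable lborel (cimage c) (\<lambda>y. vol_density g c y * f (cinv c y))"
    and "(LINT x|vol. indicator (fst c) x * f x) = (LINT y:cimage c|lborel. vol_density g c y * f (cinv c y))"
proof -
  note [measurable] = measurable_chart_inverse[OF c] measurable_vol_density[OF c] f
  have U [measurable]: "fst c \<in> sets borel" by (rule borel_open[OF open_chart[OF c]])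
  let ?d = "\<lambda>y. indicator (cimage c) y * vol_density g c y"
  have d0: "0 \<le> ?d y" for y using vol_density_pos[OF c, of y] by (auto simp: indicator_def)
  have i: "density vol (\<lambda>x. ennreal (indicator (fst c) x)) = density vol (indicator (fst c))"
    by (rule arg_cong[of _ _ "density vol"]) (auto simp: indicator_def)
  have fv: "f \<in> borel_measurable vol" by measurable
  have iv: "(indicator (fst c) :: 'a \<Rightarrow> real) \<in> borel_measurable vol" by measurable
  have e: "(\<lambda>y. ?d y *\<^sub>R f (chart_inverse c y)) = (\<lambda>y. indicator (cimage c) y *\<^sub>R (vol_density g c y * f (cinv c y)))"
    by (auto simp: chart_inverse_def indicator_def)
  have "integrable vol (\<lambda>x. indicator (fst c) x * f x) \<longleftrightarrow> integrable (density vol (\<lambda>x. ennreal (indicator (fst c) x))) f"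
    using integrable_density[OF fv iv] by simp
  also have "\<dots> \<longleftrightarrow> integrable (density lborel (\<lambda>y. ennreal (?d y))) (\<lambda>y. f (chart_inverse c y))"
    unfolding i chart_measure[OF c] by (rule integrable_distr_eq) measurable
  also have "\<dots> \<longleftrightarrow> integrable lborel (\<lambda>y. ?d y *\<^sub>R f (chart_inverse c y))"
    by (rule integrable_density) (use d0 in auto)
  finally show "integrable vol (\<lambda>x. indicator (fst c) x * f x) \<longleftrightarrow>
      set_integrable lborel (cimage c) (\<lambda>y. vol_density g c y * f (cinv c y))"
    unfolding e set_integrable_def .
  have "(LINT x|vol. indicator (fst c) x * f x) = integral\<^sup>L (density vol (\<lambda>x. ennreal (indicator (fst c) x))) f"
    using integral_density[OF fv iv] by simp
  also have "\<dots> = integral\<^sup>L (density lborel (\<lambda>y. ennreal (?d y))) (\<lambda>y. f (chart_inverse c y))"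
    unfolding i chart_measure[OF c] by (rule integral_distr) measurable
  also have "\<dots> = (LINT y|lborel. ?d y *\<^sub>R f (chart_inverse c y))"
    by (rule integral_density) (use d0 in auto)
  finally show "(LINT x|vol. indicator (fst c) x * f x) = (LINT y:cimage c|lborel. vol_density g c y * f (cinv c y))"
    unfolding e set_lebesgue_integral_def .
qed

lemma measurable_ext_chart:
  assumes c: "c \<in> A" and h: "(\<lambda>y. indicator (cimage c) y * h y) \<in> borel_measurable borel"
  shows "ext_chart c h \<in> borel_measurable borel"
proof -
  define s where "s x = (if x \<in> fst c then snd c x else 0)" for x
  have U [measurable]: "fst c \<in> sets borel" by (rule borel_open[OF open_chart[OF c]])
  have [measurable]: "s \<in> borel_measurable borel" unfolding s_def[abs_def]
    by (rule borel_measurable_continuous_on_if[OF U continuous_snd[OF c]]) simp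
  note [measurable] = h
  have "(\<lambda>x. indicator (fst c) x * (indicator (cimage c) (s x) * h (s x))) \<in> borel_measurable borel"
    by measurable
  also have "(\<lambda>x. indicator (fst c) x * (indicator (cimage c) (s x) * h (s x))) = ext_chart c h"
    using snd_mem[OF c] by (auto simp: ext_chart_def s_def indicator_def)
  finally show ?thesis .
qed

lemma ext_chart_integral:
  assumes c: "c \<in> A" and h: "(\<lambda>y. indicator (cimage c) y * h y) \<in> borel_measurable borel"
  shows "integrable vol (ext_chart c h) \<longleftrightarrow> set_integrable lborel (cimage c) (\<lambda>y. vol_density g c y * h y)"
    and "(LINT x|vol. ext_chart c h x) = (LINT y:cimage c|lborel. vol_density g c y * h y)"
proof -
  have e: "(\<lambda>x. indicator (fst c) x * ext_chart c h x) = ext_chart c h"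
    by (auto simp: ext_chart_def indicator_def)
  have e2: "(\<lambda>y. indicator (cimage c) y *\<^sub>R (vol_density g c y * ext_chart c h (cinv c y))) =
      (\<lambda>y. indicator (cimage c) y *\<^sub>R (vol_density g c y * h y))"
    using ext_chart_cinv[OF c] by (auto simp: indicator_def)
  show "integrable vol (ext_chart c h) \<longleftrightarrow> set_integrable lborel (cimage c) (\<lambda>y. vol_density g c y * h y)"
    using chart_integral(1)[OF c measurable_ext_chart[OF c h]] unfolding e set_integrable_def e2 .
  show "(LINT x|vol. ext_chart c h x) = (LINT y:cimage c|lborel. vol_density g c y * h y)"
    using chart_integral(2)[OF c measurable_ext_chart[OF c h]] unfolding e set_lebesgue_integral_def e2 .
qed

text \<open>The coordinate preimage of a Lebesgue null set has volume 0 by the defining formula of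
  the volume.\<close>

lemma chart_AE:
  assumes c: "c \<in> A" and P: "AE y in lborel. y \<in> cimage c \<longrightarrow> P (cinv c y)"
  shows "AE x in vol. x \<in> fst c \<longrightarrow> P x"
proof -
  obtain N where N: "{y. \<not> (y \<in> cimage c \<longrightarrow> P (cinv c y))} \<subseteq> N" "N \<in> null_sets lborel"
    using P by (auto elim!: AE_E simp: null_sets_def)
  define s where "s x = (if x \<in> fst c then snd c x else 0)" for x
  have U [measurable]: "fst c \<in> sets borel" by (rule borel_open[OF open_chart[OF c]])
  have s: "s \<in> borel_measurable borel" unfolding s_def[abs_def]
    by (rule borel_measurable_continuous_on_if[OF U continuous_snd[OF c]]) simp
  define B where "B = fst c \<inter> s -` N"
  have "s -` N \<in> sets borel" using N(2) by (intro measurable_sets_borel[OF s]) auto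
  then have B: "B \<in> sets borel" unfolding B_def using U by blast
  have "snd c ` B \<subseteq> N" by (auto simp: B_def s_def)
  have "emeasure vol B = (\<integral>\<^sup>+y. ennreal (vol_density g c y) * indicator (snd c ` B) y \<partial>lborel)"
    using volume c B by (auto simp: riemannian_volume_def B_def)
  also have "\<dots> = (\<integral>\<^sup>+(y::real^'n). 0 \<partial>lborel)"
  proof (rule nn_integral_cong_AE)
    have "AE y in lborel. y \<notin> N" using N(2) by (rule AE_not_in)
    then show "AE y in lborel. ennreal (vol_density g c y) * indicator (snd c ` B) y = 0"
      using \<open>snd c ` B \<subseteq> N\<close> by (auto elim!: eventually_mono simp: indicator_def)
  qed
  finally have "B \<in> null_sets vol" using B by (auto simp: null_sets_def sets_vol)
  then have "AE x in vol. x \<notin> B" by (rule AE_not_in)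
  then show ?thesis
  proof eventually_elim
    case (elim x)
    show ?case
    proof
      assume x: "x \<in> fst c"
      then have "snd c x \<notin> N" using elim by (simp add: B_def s_def)
      then show "P x" using N(1) snd_mem[OF c x] cinv_snd[OF c x] by force
    qed
  qed
qed

end

section \<open>First variation of the obstacle functional\<close>

lemma locally_integrable_cong:
  assumes "\<And>y. y \<in> \<Omega> \<Longrightarrow> p y = q y"
  shows "locally_integrable \<Omega> p \<longleftrightarrow> locally_integrable \<Omega> q"
proof -
  have "set_integrable lborel K p \<longleftrightarrow> set_integrable lborel K q" if "K \<subseteq> \<Omega>" for K
    using that assms by (intro set_integrable_cong) auto
  then show ?thesis by (auto simp: locally_integrable_def)
qed

lemma locally_integrable_add:
  assumes "locally_integrable \<Omega> p" "locally_integrable \<Omega> q"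
  shows "locally_integrable \<Omega> (\<lambda>y. p y + e * q y)"
  unfolding locally_integrable_def
proof (intro allI impI)
  fix K assume K: "compact K \<and> K \<subseteq> \<Omega>"
  have p: "set_integrable lborel K p" and q: "set_integrable lborel K q"
    using assms K unfolding locally_integrable_def by blast+
  show "set_integrable lborel K (\<lambda>y. p y + e * q y)"
    by (rule set_integral_add(1)[OF p]) (simp add: q)
qed

definition euclidean_gradient :: "(real^'n \<Rightarrow> real) \<Rightarrow> real^'n \<Rightarrow> real^'n" where
  "euclidean_gradient \<psi> y = (\<chi> i. pderiv_i i \<psi> y)"

context riemannian
begin

lemma ext_chart_support:
  assumes c: "c \<in> A" and \<psi>: "test_function \<Omega> \<psi>" "\<Omega> \<subseteq> cimage c"
  obtains K' where "compact K'" "K' \<subseteq> fst c" "snd c ` K' \<subseteq> \<Omega>" "open (- K')" "\<And>x. x \<notin> K' \<Longrightarrow> ext_chart c \<psi> x = 0"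
proof -
  obtain K where K: "compact K" "K \<subseteq> \<Omega>" "\<And>y. y \<notin> K \<Longrightarrow> \<psi> y = 0"
    using \<psi>(1) by (rule test_function_support) (rule that)
  have Kc: "K \<subseteq> cimage c" using K(2) \<psi>(2) by blast
  show thesis
  proof (rule that[of "cinv c ` K"])
    show *: "compact (cinv c ` K)"
      by (rule compact_continuous_image[OF continuous_on_subset[OF continuous_cinv[OF c] Kc] K(1)])
    then show "open (- cinv c ` K)" using compact_imp_closed by blast
    show "cinv c ` K \<subseteq> fst c" using Kc cinv_mem[OF c] by blast
    show "snd c ` cinv c ` K \<subseteq> \<Omega>" using snd_cinv[OF c] Kc K(2) by fastforce
    show "ext_chart c \<psi> x = 0" if "x \<notin> cinv c ` K" for x
    proof (cases "x \<in> fst c")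
      case True
      then have "snd c x \<notin> K" using that cinv_snd[OF c True] by (metis image_eqI)
      then show ?thesis using K(3) by (simp add: ext_chart_def)
    qed (simp add: ext_chart_def)
  qed
qed

lemma dfield_ext_chart:
  assumes c: "c \<in> A" and x: "x \<in> fst c"
  shows "dfield (ext_chart c \<psi>) c x = euclidean_gradient \<psi> (snd c x)"
proof -
  have "pderiv_i i (ext_chart c \<psi> \<circ> cinv c) (snd c x) = pderiv_i i \<psi> (snd c x)" for i
    by (rule pderiv_i_cong[OF open_cimage[OF c] snd_mem[OF c x]]) (simp add: ext_chart_cinv[OF c])
  then show ?thesis by (simp add: dfield_def euclidean_gradient_def)
qed

text \<open>The factors are measurable only after restriction to the chart image, so the indicator
  is distributed over all three of them.\<close>

lemma measurable_chart_pairing: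
  assumes c: "c \<in> A" and v: "\<And>i. (\<lambda>y. indicator (cimage c) y * v y $ i) \<in> borel_measurable borel"
    and w: "\<And>i. (\<lambda>y. indicator (cimage c) y * w y $ i) \<in> borel_measurable borel"
  shows "(\<lambda>y. indicator (cimage c) y * (v y \<bullet> (matrix_inv (g c (cinv c y)) *v w y))) \<in> borel_measurable borel"
proof -
  let ?I = "indicator (cimage c) :: real^'n \<Rightarrow> real"
  have m: "(\<lambda>y. ?I y * matrix_inv (g c (cinv c y)) $ i $ j) \<in> borel_measurable borel" for i j
    using borel_measurable_continuous_on_indicator[OF _ smooth_on_continuous_on[OF smooth_metric_inv[OF c]]]
      open_cimage[OF c] by (simp add: borel_open)
  have "(\<lambda>y. \<Sum>i\<in>UNIV. \<Sum>j\<in>UNIV. (?I y * v y $ i) * (?I y * matrix_inv (g c (cinv c y)) $ i $ j) * (?I y * w y $ j))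
      \<in> borel_measurable borel"
    by (intro borel_measurable_sum borel_measurable_times v w m)
  also have "(\<lambda>y. \<Sum>i\<in>UNIV. \<Sum>j\<in>UNIV. (?I y * v y $ i) * (?I y * matrix_inv (g c (cinv c y)) $ i $ j) * (?I y * w y $ j)) =
      (\<lambda>y. ?I y * (v y \<bullet> (matrix_inv (g c (cinv c y)) *v w y)))"
  proof
    fix y
    show "(\<Sum>i\<in>UNIV. \<Sum>j\<in>UNIV. (?I y * v y $ i) * (?I y * matrix_inv (g c (cinv c y)) $ i $ j) * (?I y * w y $ j)) =
        ?I y * (v y \<bullet> (matrix_inv (g c (cinv c y)) *v w y))"
      by (cases "y \<in> cimage c") (simp_all add: inner_matrix_vector)
  qed
  finally show ?thesis .
qed

section \<open>Weak differentials, their uniqueness and their norms\<close>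

lemma weak_differentialD:
  assumes "weak_differential A u w"
  shows "covector_field A w"
    and "c \<in> A \<Longrightarrow> locally_integrable (cimage c) (u \<circ> cinv c)"
    and "c \<in> A \<Longrightarrow> locally_integrable (cimage c) (\<lambda>y. w c (cinv c y) $ i)"
    and "c \<in> A \<Longrightarrow> test_function (cimage c) \<psi> \<Longrightarrow>
      (LINT y:cimage c|lborel. u (cinv c y) * pderiv_i i \<psi> y) = - (LINT y:cimage c|lborel. w c (cinv c y) $ i * \<psi> y)"
  using assms unfolding weak_differential_def by blast+

text \<open>The chart chosen by \<open>chart_at\<close> may vary with the point in an uncontrolled
  way. On each chart of a finite cover, invariance replaces it by a fixed chart, where measurability
  is visible.\<close>

lemma measurable_covector_norm2:
  assumes w: "weak_differential A u w"
  shows "covector_norm2 A g w \<in> borel_measurable borel"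
proof -
  obtain \<C> where \<C>: "finite \<C>" "\<C> \<subseteq> A" "(\<Union>c\<in>\<C>. fst c) = UNIV" by (rule finite_charts)
  show ?thesis
  proof (rule measurable_piecewise_restrict[where C = "fst ` \<C>"])
    show "countable (fst ` \<C>)" using \<C>(1) by (simp add: countable_finite)
    show "U \<inter> space borel \<in> sets borel" if "U \<in> fst ` \<C>" for U
      using that open_chart \<C>(2) by (auto intro: borel_open)
    show "space borel \<subseteq> \<Union> (fst ` \<C>)" using \<C>(3) by simp
    fix U assume "U \<in> fst ` \<C>"
    then obtain c where U: "U = fst c" and c: "c \<in> A" using \<C>(2) by auto
    let ?h = "\<lambda>y. w c (cinv c y) \<bullet> (matrix_inv (g c (cinv c y)) *v w c (cinv c y))"
    have i: "(\<lambda>y. indicator (cimage c) y * w c (cinv c y) $ i) \<in> borel_measurable borel" for i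
      by (rule borel_measurable_locally_integrable[OF open_cimage[OF c] weak_differentialD(3)[OF w c]])
    have "ext_chart c ?h \<in> borel_measurable borel"
      by (rule measurable_ext_chart[OF c measurable_chart_pairing[OF c i i]])
    also have "ext_chart c ?h = (\<lambda>x. covector_norm2 A g w x * indicator U x)"
      using covector_inner_eq[OF c _ weak_differentialD(1)[OF w] weak_differentialD(1)[OF w]] cinv_snd[OF c]
      by (auto simp: ext_chart_def U covector_norm2_eq_inner indicator_def)
    finally show "covector_norm2 A g w \<in> borel_measurable (restrict_space borel U)"
      by (subst borel_measurable_restrict_space_iff) (use open_chart[OF c] U in \<open>simp_all add: mult.commute borel_open\<close>)
  qed
qed

text \<open>In each chart the components of the two differentials pair equally with all test
  functions, so they agree almost everywhere by \<open>du_Bois_Reymond\<close>; finitely many charts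
  suffice.\<close>

lemma covector_norm2_unique:
  assumes w: "weak_differential A u w" and w': "weak_differential A u w'"
  shows "AE x in vol. covector_norm2 A g w x = covector_norm2 A g w' x"
proof -
  obtain \<C> where \<C>: "finite \<C>" "\<C> \<subseteq> A" "(\<Union>c\<in>\<C>. fst c) = UNIV" by (rule finite_charts)
  have "AE x in vol. x \<in> fst c \<longrightarrow> covector_norm2 A g w x = covector_norm2 A g w' x" if "c \<in> \<C>" for c
  proof -
    have c: "c \<in> A" using that \<C>(2) by auto
    have "AE y in lborel. y \<in> cimage c \<longrightarrow> w c (cinv c y) $ i + (-1) * w' c (cinv c y) $ i = 0" for i
    proof (rule du_Bois_Reymond[OF open_cimage[OF c]])
      show "locally_integrable (cimage c) (\<lambda>y. w c (cinv c y) $ i + (-1) * w' c (cinv c y) $ i)"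
        by (rule locally_integrable_add[OF weak_differentialD(3)[OF w c] weak_differentialD(3)[OF w' c]])
      fix \<psi> assume \<psi>: "test_function (cimage c) \<psi>"
      obtain K where K: "compact K" "K \<subseteq> cimage c" "\<And>y. y \<notin> K \<Longrightarrow> \<psi> y = 0"
        using \<psi> by (rule test_function_support) (rule that)
      note s = smooth_on_continuous_on[OF test_function_smooth[OF \<psi>]]
      note i1 = set_integrable_mult_test[OF open_cimage[OF c] weak_differentialD(3)[OF w c, of i] s K]
      note i2 = set_integrable_mult_test[OF open_cimage[OF c] weak_differentialD(3)[OF w' c, of i] s K]
      have "(LINT y:cimage c|lborel. (w c (cinv c y) $ i + (-1) * w' c (cinv c y) $ i) * \<psi> y) =
          (LINT y:cimage c|lborel. w c (cinv c y) $ i * \<psi> y - w' c (cinv c y) $ i * \<psi> y)"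
        by (simp add: algebra_simps)
      also have "\<dots> = (LINT y:cimage c|lborel. w c (cinv c y) $ i * \<psi> y) - (LINT y:cimage c|lborel. w' c (cinv c y) $ i * \<psi> y)"
        by (rule set_integral_diff(2)[OF i1 i2])
      also have "\<dots> = 0"
        using weak_differentialD(4)[OF w c \<psi>, of i] weak_differentialD(4)[OF w' c \<psi>, of i] by simp
      finally show "(LINT y:cimage c|lborel. (w c (cinv c y) $ i + (-1) * w' c (cinv c y) $ i) * \<psi> y) = 0" .
    qed
    then have "AE y in lborel. \<forall>i\<in>UNIV. y \<in> cimage c \<longrightarrow> w c (cinv c y) $ i + (-1) * w' c (cinv c y) $ i = 0"
      by (subst AE_finite_all) simp_all
    then have "AE y in lborel. y \<in> cimage c \<longrightarrow> w c (cinv c y) = w' c (cinv c y)"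
      by (auto elim!: eventually_mono simp: vec_eq_iff)
    from chart_AE[where P = "\<lambda>x. w c x = w' c x", OF c this] show ?thesis
    proof eventually_elim
      case (elim x)
      show ?case
      proof
        assume x: "x \<in> fst c"
        with elim show "covector_norm2 A g w x = covector_norm2 A g w' x"
          using covector_inner_eq[OF c x weak_differentialD(1)[OF w] weak_differentialD(1)[OF w]]
            covector_inner_eq[OF c x weak_differentialD(1)[OF w'] weak_differentialD(1)[OF w']]
          by (simp add: covector_norm2_eq_inner)
      qed
    qed
  qed
  then have "AE x in vol. \<forall>c\<in>\<C>. x \<in> fst c \<longrightarrow> covector_norm2 A g w x = covector_norm2 A g w' x"
    by (subst AE_finite_all[OF \<C>(1)]) blast
  then show ?thesis by eventually_elim (use \<C>(3) in blast)
qed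

text \<open>\<open>grad_norm2\<close> uses a choice among weak differentials; this allows it to be
  computed with any differential at hand.\<close>

lemma W12_grad_norm2:
  assumes u: "u \<in> W12 A g vol" and w: "weak_differential A u w"
  shows "integrable vol (covector_norm2 A g w)" "integrable vol (grad_norm2 A g u)"
    and "(LINT x|vol. grad_norm2 A g u x) = (LINT x|vol. covector_norm2 A g w x)"
proof -
  obtain w1 where w1: "weak_differential A u w1" "integrable vol (covector_norm2 A g w1)"
    using u unfolding W12_def by blast
  have w0: "weak_differential A u (SOME w. weak_differential A u w)" 
    by (rule someI[where P = "weak_differential A u", OF w1(1)])
  have m: "covector_norm2 A g v \<in> borel_measurable vol" if "weak_differential A u v" for v
    using measurable_covector_norm2[OF that] by measurable
  show i: "integrable vol (covector_norm2 A g w)"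
    using integrable_cong_AE[OF m[OF w1(1)] m[OF w] covector_norm2_unique[OF w1(1) w]] w1(2) by blast
  show "integrable vol (grad_norm2 A g u)"
    unfolding grad_norm2_def
    using integrable_cong_AE[OF m[OF w] m[OF w0] covector_norm2_unique[OF w w0]] i by blast
  show "(LINT x|vol. grad_norm2 A g u x) = (LINT x|vol. covector_norm2 A g w x)"
    unfolding grad_norm2_def
    by (rule integral_cong_AE[OF m[OF w0] m[OF w] covector_norm2_unique[OF w0 w]])
qed

lemma weak_differential_add_smooth:
  assumes w: "weak_differential A u w" and f: "smooth_fun A f"
  shows "weak_differential A (\<lambda>x. u x + e * f x) (\<lambda>c x. w c x + e *\<^sub>R dfield f c x)"
  unfolding weak_differential_def
proof (intro conjI ballI allI impI)
  show "covector_field A (\<lambda>c x. w c x + e *\<^sub>R dfield f c x)"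
    unfolding covector_field_def
  proof (intro ballI)
    fix c d x assume a: "c \<in> A" "d \<in> A" "x \<in> fst c \<inter> fst d"
    have "w c x = transpose (transition_jacobian c d x) *v w d x"
      "dfield f c x = transpose (transition_jacobian c d x) *v dfield f d x"
      using a weak_differentialD(1)[OF w] dfield_covector[OF f] unfolding covector_field_def by blast+
    then show "w c x + e *\<^sub>R dfield f c x =
        transpose (transition_jacobian c d x) *v (w d x + e *\<^sub>R dfield f d x)"
      by (simp only: matrix_vector_right_distrib matrix_vector_mult_scaleR)
  qed
  fix c assume c: "c \<in> A"
  define F where "F = f \<circ> cinv c"
  have F: "smooth_on (cimage c) F" using f c by (simp add: smooth_fun_def F_def)
  have dF: "dfield f c (cinv c y) $ i = pderiv_i i F y" if "y \<in> cimage c" for y i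
    using snd_cinv[OF c that] by (simp add: dfield_def F_def)
  have lF: "locally_integrable (cimage c) F" "locally_integrable (cimage c) (pderiv_i i F)" for i
    by (intro locally_integrable_continuous smooth_on_continuous_on F smooth_on_pderiv_i)+
  show "locally_integrable (cimage c) ((\<lambda>x. u x + e * f x) \<circ> cinv c)"
    using locally_integrable_add[OF weak_differentialD(2)[OF w c] lF(1), of e] by (simp add: F_def o_def)
  fix i
  have "locally_integrable (cimage c) (\<lambda>y. w c (cinv c y) $ i + e * pderiv_i i F y)"
    by (rule locally_integrable_add[OF weak_differentialD(3)[OF w c] lF(2)])
  then show "locally_integrable (cimage c) (\<lambda>y. (w c (cinv c y) + e *\<^sub>R dfield f c (cinv c y)) $ i)"
    by (subst locally_integrable_cong[of _ _ "\<lambda>y. w c (cinv c y) $ i + e * pderiv_i i F y"]) (simp_all add: dF)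
  fix \<psi> assume \<psi>: "test_function (cimage c) \<psi>"
  obtain K where K: "compact K" "K \<subseteq> cimage c" "\<And>y. y \<notin> K \<Longrightarrow> \<psi> y = 0"
    "\<And>i y. y \<notin> K \<Longrightarrow> pderiv_i i \<psi> y = 0"
    using \<psi> by (rule test_functionE) (rule that)
  note O = open_cimage[OF c]
  note s = smooth_on_continuous_on[OF test_function_smooth[OF \<psi>]]
  note s' = smooth_on_continuous_on[OF smooth_on_pderiv_i[OF test_function_smooth[OF \<psi>], of i]]
  have i1: "set_integrable lborel (cimage c) (\<lambda>y. u (cinv c y) * pderiv_i i \<psi> y)"
    using set_integrable_mult_test[OF O weak_differentialD(2)[OF w c] s' K(1,2,4)] by simp
  have i2: "set_integrable lborel (cimage c) (\<lambda>y. e * (F y * pderiv_i i \<psi> y))"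
    using set_integrable_mult_test[OF O lF(1) s' K(1,2,4)] by simp
  have i3: "set_integrable lborel (cimage c) (\<lambda>y. w c (cinv c y) $ i * \<psi> y)"
    by (rule set_integrable_mult_test[OF O weak_differentialD(3)[OF w c] s K(1,2,3)])
  have i4: "set_integrable lborel (cimage c) (\<lambda>y. e * (pderiv_i i F y * \<psi> y))"
    using set_integrable_mult_test[OF O lF(2) s K(1,2,3)] by simp
  have "(LINT y:cimage c|lborel. (u (cinv c y) + e * f (cinv c y)) * pderiv_i i \<psi> y) =
      (LINT y:cimage c|lborel. u (cinv c y) * pderiv_i i \<psi> y + e * (F y * pderiv_i i \<psi> y))"
    by (simp add: F_def algebra_simps)
  also have "\<dots> = (LINT y:cimage c|lborel. u (cinv c y) * pderiv_i i \<psi> y) + e * (LINT y:cimage c|lborel. F y * pderiv_i i \<psi> y)"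
    using set_integral_add(2)[OF i1 i2] by simp
  also have "\<dots> = - ((LINT y:cimage c|lborel. w c (cinv c y) $ i * \<psi> y) + e * (LINT y:cimage c|lborel. pderiv_i i F y * \<psi> y))"
    using weak_differentialD(4)[OF w c \<psi>] integral_by_parts[OF O F \<psi>] by simp
  also have "\<dots> = - (LINT y:cimage c|lborel. w c (cinv c y) $ i * \<psi> y + e * (pderiv_i i F y * \<psi> y))"
    using set_integral_add(2)[OF i3 i4] by simp
  also have "(LINT y:cimage c|lborel. w c (cinv c y) $ i * \<psi> y + e * (pderiv_i i F y * \<psi> y)) =
      (LINT y:cimage c|lborel. (w c (cinv c y) + e *\<^sub>R dfield f c (cinv c y)) $ i * \<psi> y)"
    by (rule set_lebesgue_integral_cong) (use O dF in \<open>auto simp: algebra_simps borel_open\<close>)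
  finally show "(LINT y:cimage c|lborel. (u (cinv c y) + e * f (cinv c y)) * pderiv_i i \<psi> y) =
      - (LINT y:cimage c|lborel. (w c (cinv c y) + e *\<^sub>R dfield f c (cinv c y)) $ i * \<psi> y)" .
qed

text \<open>With the density absorbed, the pairing is \<open>v\<close> against the flux
  \<open>fl\<close> of \<open>\<psi>\<close>. Each \<open>fl i\<close> is itself a test function, so
  the defining identity of a weak derivative can later be applied with it.\<close>

lemma chart_pairing_integral:
  assumes c: "c \<in> A" and v: "\<And>i. locally_integrable (cimage c) (\<lambda>y. v y $ i)" and \<psi>: "test_function (cimage c) \<psi>"
  defines "P \<equiv> \<lambda>y. v y \<bullet> (matrix_inv (g c (cinv c y)) *v euclidean_gradient \<psi> y)"
    and "fl \<equiv> \<lambda>i y. \<Sum>j\<in>UNIV. principal_coeff g c y $ i $ j * pderiv_i j \<psi> y"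
  shows "integrable vol (ext_chart c P)"
    and "(LINT x|vol. ext_chart c P x) = (\<Sum>i\<in>UNIV. LINT y:cimage c|lborel. v y $ i * fl i y)"
proof -
  interpret elliptic "cimage c" "principal_coeff g c" by (rule elliptic_chart[OF c])
  have t: "test_function (cimage c) (fl i)" for i unfolding fl_def by (rule test_flux[OF \<psi>])
  have i: "set_integrable lborel (cimage c) (\<lambda>y. v y $ i * fl i y)" for i
  proof -
    obtain K where K: "compact K" "K \<subseteq> cimage c" "\<And>y. y \<notin> K \<Longrightarrow> fl i y = 0"
      using t[of i] by (rule test_function_support) (rule that)
    show ?thesis
      by (rule set_integrable_mult_test[OF open_\<Omega> v smooth_on_continuous_on[OF test_function_smooth[OF t]] K])
  qed
  have e: "vol_density g c y * P y = (\<Sum>i\<in>UNIV. v y $ i * fl i y)" for y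
  proof -
    have "vol_density g c y * P y = v y \<bullet> (principal_coeff g c y *v euclidean_gradient \<psi> y)"
      by (simp add: P_def principal_coeff_def scaleR_matrix_vector_assoc[symmetric])
    then show ?thesis by (simp add: inner_vec_def matrix_vector_mult_def fl_def euclidean_gradient_def)
  qed
  have m: "(\<lambda>y. indicator (cimage c) y * P y) \<in> borel_measurable borel"
    unfolding P_def
  proof (rule measurable_chart_pairing[OF c])
    show "(\<lambda>y. indicator (cimage c) y * v y $ i) \<in> borel_measurable borel" for i
      by (rule borel_measurable_locally_integrable[OF open_\<Omega> v])
    show "(\<lambda>y. indicator (cimage c) y * euclidean_gradient \<psi> y $ i) \<in> borel_measurable borel" for i
      using smooth_on_continuous_on[OF smooth_on_pderiv_i[OF test_function_smooth[OF \<psi>], of i]]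
      unfolding euclidean_gradient_def vec_lambda_beta
      by (intro borel_measurable_times borel_measurable_indicator borel_measurable_continuous_onI borel_open open_\<Omega>)
  qed
  have "integrable lborel (\<lambda>y. \<Sum>i\<in>UNIV. indicator (cimage c) y *\<^sub>R (v y $ i * fl i y))"
    using i by (intro Bochner_Integration.integrable_sum) (simp add: set_integrable_def)
  then show "integrable vol (ext_chart c P)"
    unfolding ext_chart_integral(1)[OF c m] e set_integrable_def scaleR_sum_right .
  have "(LINT x|vol. ext_chart c P x) = (LINT y|lborel. (\<Sum>i\<in>UNIV. indicator (cimage c) y *\<^sub>R (v y $ i * fl i y)))"
    unfolding ext_chart_integral(2)[OF c m] e set_lebesgue_integral_def scaleR_sum_right ..
  also have "\<dots> = (\<Sum>i\<in>UNIV. LINT y:cimage c|lborel. v y $ i * fl i y)"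
    unfolding set_lebesgue_integral_def
    using i by (intro Bochner_Integration.integral_sum) (simp add: set_integrable_def)
  finally show "(LINT x|vol. ext_chart c P x) = (\<Sum>i\<in>UNIV. LINT y:cimage c|lborel. v y $ i * fl i y)" .
qed

text \<open>Invariance settles the points of \<open>fst c\<close>, where \<open>chart_at\<close> may
  have picked another chart. Off \<open>fst c\<close> the function vanishes in a neighbourhood,
  namely off its closed support.\<close>

lemma covector_inner_ext_chart:
  assumes c: "c \<in> A" and \<psi>: "test_function (cimage c) \<psi>" and v: "covector_field A v"
  shows "covector_inner A g v (dfield (ext_chart c \<psi>)) =
    ext_chart c (\<lambda>y. v c (cinv c y) \<bullet> (matrix_inv (g c (cinv c y)) *v euclidean_gradient \<psi> y))"
proof
  fix x
  show "covector_inner A g v (dfield (ext_chart c \<psi>)) x =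
    ext_chart c (\<lambda>y. v c (cinv c y) \<bullet> (matrix_inv (g c (cinv c y)) *v euclidean_gradient \<psi> y)) x"
  proof (cases "x \<in> fst c")
    case True
    then show ?thesis
      using covector_inner_eq[OF c True v dfield_covector[OF smooth_fun_ext_chart[OF c \<psi>]]]
        dfield_ext_chart[OF c True] cinv_snd[OF c True] by (simp add: ext_chart_def)
  next
    case False
    obtain K' where K': "K' \<subseteq> fst c" "open (- K')" "\<And>x. x \<notin> K' \<Longrightarrow> ext_chart c \<psi> x = 0"
      by (rule ext_chart_support[OF c \<psi> order_refl]) (rule that)
    have "dfield (ext_chart c \<psi>) (chart_at A x) x = 0"
      by (rule dfield_zero[OF chart_at_mem(1) K'(2) _ chart_at_mem(2)]) (use K' False in auto)
    then show ?thesis using False by (simp add: ext_chart_def covector_inner_def Let_def)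
  qed
qed

lemma integrable_ext_chart_test:
  assumes c: "c \<in> A" and \<psi>: "test_function (cimage c) \<psi>"
  shows "integrable vol (ext_chart c \<psi>)"
    and "(LINT x|vol. ext_chart c \<psi> x) = (LINT y:cimage c|lborel. vol_density g c y * \<psi> y)"
proof -
  obtain K where K: "compact K" "K \<subseteq> cimage c" "\<And>y. y \<notin> K \<Longrightarrow> \<psi> y = 0"
    using \<psi> by (rule test_function_support) (rule that)
  note s = smooth_on_continuous_on[OF test_function_smooth[OF \<psi>]]
  have m: "(\<lambda>y. indicator (cimage c) y * \<psi> y) \<in> borel_measurable borel"
    by (intro borel_measurable_times borel_measurable_indicator borel_measurable_continuous_onI[OF s]
        borel_open open_cimage[OF c])
  show "integrable vol (ext_chart c \<psi>)"
    unfolding ext_chart_integral(1)[OF c m]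
    by (rule set_integrable_mult_test[OF open_cimage[OF c] locally_integrable_continuous[OF
         smooth_on_continuous_on[OF smooth_vol_density[OF c]]] s K])
  show "(LINT x|vol. ext_chart c \<psi> x) = (LINT y:cimage c|lborel. vol_density g c y * \<psi> y)"
    by (rule ext_chart_integral(2)[OF c m])
qed

lemma W12_integrable:
  assumes "u \<in> W12 A g vol"
  shows "integrable vol u"
proof -
  have "u \<in> borel_measurable vol" "integrable vol (\<lambda>x. (u x)\<^sup>2)" using assms unfolding W12_def by blast+
  then show ?thesis by (rule finite_measure.square_integrable_imp_integrable[OF finite_measure_vol])
qed

text \<open>The functional is exactly quadratic in \<open>e\<close>. In its linear coefficient all
  derivatives are moved onto \<open>\<psi>\<close>, so that the result mentions \<open>u\<close> but
  not its weak differential.\<close>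

lemma obstacle_functional_variation:
  assumes c: "c \<in> A" and u: "u \<in> W12 A g vol" and \<psi>: "test_function (cimage c) \<psi>"
  obtains B where "\<And>e. (\<lambda>x. u x + e * ext_chart c \<psi> x) \<in> W12 A g vol"
    "\<And>e. obstacle_functional A g vol a (\<lambda>x. u x + e * ext_chart c \<psi> x) = obstacle_functional A g vol a u
       - 2 * e * ((LINT y:cimage c|lborel. u (cinv c y) * chart_div c \<psi> y)
           + (1 - a / measure vol UNIV) * (LINT y:cimage c|lborel. vol_density g c y * \<psi> y)) + e\<^sup>2 * B"
proof -
  interpret finite_measure vol by (rule finite_measure_vol)
  interpret elliptic "cimage c" "principal_coeff g c" by (rule elliptic_chart[OF c])
  obtain w where w: "weak_differential A u w" using u unfolding W12_def by blast
  define \<phi> where "\<phi> = ext_chart c \<psi>"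
  have s\<phi>: "smooth_fun A \<phi>" unfolding \<phi>_def by (rule smooth_fun_ext_chart[OF c \<psi>])
  note cw = weak_differentialD(1)[OF w] and cd = dfield_covector[OF s\<phi>]
  have lw: "locally_integrable (cimage c) (\<lambda>y. w c (cinv c y) $ i)" for i by (rule weak_differentialD(3)[OF w c])
  define H where "H = covector_inner A g w (dfield \<phi>)"
  define N where "N = covector_norm2 A g (dfield \<phi>)"
  define B where "B = (LINT x|vol. N x)"
  have H: "H = ext_chart c (\<lambda>y. w c (cinv c y) \<bullet> (matrix_inv (g c (cinv c y)) *v euclidean_gradient \<psi> y))"
    unfolding H_def \<phi>_def by (rule covector_inner_ext_chart[OF c \<psi> cw])
  have Hi: "integrable vol H" unfolding H by (rule chart_pairing_integral(1)[OF c lw \<psi>])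
  have N: "N = ext_chart c (\<lambda>y. euclidean_gradient \<psi> y \<bullet> (matrix_inv (g c (cinv c y)) *v euclidean_gradient \<psi> y))"
    unfolding N_def covector_norm2_eq_inner \<phi>_def
      covector_inner_ext_chart[OF c \<psi> cd[unfolded \<phi>_def]]
    by (rule ext) (simp add: ext_chart_def dfield_ext_chart[OF c] cinv_snd[OF c])
  have Ni: "integrable vol N"
    unfolding N
  proof (rule chart_pairing_integral(1)[OF c _ \<psi>])
    show "locally_integrable (cimage c) (\<lambda>y. euclidean_gradient \<psi> y $ i)" for i
      using smooth_on_continuous_on[OF smooth_on_pderiv_i[OF test_function_smooth[OF \<psi>], of i]]
      by (intro locally_integrable_continuous) (auto simp: euclidean_gradient_def intro: continuous_on_subset)
  qed
  have Hint: "(LINT x|vol. H x) = - (LINT y:cimage c|lborel. u (cinv c y) * chart_div c \<psi> y)"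
  proof -
    define fl where "fl i y = (\<Sum>j\<in>UNIV. principal_coeff g c y $ i $ j * pderiv_i j \<psi> y)" for i y
    have t: "test_function (cimage c) (fl i)" for i unfolding fl_def by (rule test_flux[OF \<psi>])
    have i: "set_integrable lborel (cimage c) (\<lambda>y. u (cinv c y) * pderiv_i i (fl i) y)" for i
    proof -
      obtain K where K: "compact K" "K \<subseteq> cimage c" "\<And>y. y \<notin> K \<Longrightarrow> pderiv_i i (fl i) y = 0"
        using test_function_pderiv_i[OF t[of i], of i] by (rule test_function_support) (rule that)
      have "set_integrable lborel (cimage c) (\<lambda>y. (u \<circ> cinv c) y * pderiv_i i (fl i) y)"
        by (rule set_integrable_mult_test[OF open_\<Omega> weak_differentialD(2)[OF w c]
              smooth_on_continuous_on[OF test_function_smooth[OF test_function_pderiv_i[OF t]]] K])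
      then show ?thesis by simp
    qed
    have "(LINT x|vol. H x) = (\<Sum>i\<in>UNIV. LINT y:cimage c|lborel. w c (cinv c y) $ i * fl i y)"
      unfolding H fl_def by (rule chart_pairing_integral(2)[OF c lw \<psi>])
    \<comment> \<open>The weak derivative is tested with the flux components \<open>fl i\<close> in
      place of \<open>\<psi>\<close>; summing their divergence produces
      \<open>chart_div c \<psi>\<close>.\<close>
    also have "\<dots> = (\<Sum>i\<in>UNIV. - (LINT y:cimage c|lborel. u (cinv c y) * pderiv_i i (fl i) y))"
      using weak_differentialD(4)[OF w c t] by simp
    also have "\<dots> = - (LINT y|lborel. (\<Sum>i\<in>UNIV. indicator (cimage c) y *\<^sub>R (u (cinv c y) * pderiv_i i (fl i) y)))"
      unfolding sum_negf set_lebesgue_integral_def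
      using i by (subst Bochner_Integration.integral_sum) (simp_all add: set_integrable_def)
    also have "(\<lambda>y. \<Sum>i\<in>UNIV. indicator (cimage c) y *\<^sub>R (u (cinv c y) * pderiv_i i (fl i) y)) =
        (\<lambda>y. indicator (cimage c) y *\<^sub>R (u (cinv c y) * chart_div c \<psi> y))"
      by (simp add: divop_def fl_def[abs_def] sum_distrib_left)
    finally show ?thesis by (simp add: set_lebesgue_integral_def)
  qed
  note \<phi>i = integrable_ext_chart_test[OF c \<psi>, folded \<phi>_def]
  have um: "u \<in> borel_measurable vol" and u2: "integrable vol (\<lambda>x. (u x)\<^sup>2)" using u unfolding W12_def by blast+
  have ui: "integrable vol u" by (rule W12_integrable[OF u])
  have \<phi>m: "\<phi> \<in> borel_measurable vol" by (rule borel_measurable_integrable[OF \<phi>i(1)])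
  obtain M where M: "\<And>x. \<bar>\<phi> x\<bar> \<le> M"
  proof -
    obtain K where K: "compact K" "K \<subseteq> cimage c" "\<And>y. y \<notin> K \<Longrightarrow> \<psi> y = 0"
      using \<psi> by (rule test_function_support) (rule that)
    obtain M where M: "\<And>y. \<bar>\<psi> y\<bar> \<le> M"
      using bounded_continuous_compact_support[OF smooth_on_continuous_on[OF test_function_smooth[OF \<psi>]] K(1,3)] by blast
    have "\<bar>\<phi> x\<bar> \<le> M" for x using M order_trans[OF abs_ge_zero M] by (simp add: \<phi>_def ext_chart_def)
    then show ?thesis using that by blast
  qed
  have \<phi>2: "integrable vol (\<lambda>x. (\<phi> x)\<^sup>2)"
  proof (rule integrable_const_bound[of _ "M\<^sup>2"])
    show "AE x in vol. norm ((\<phi> x)\<^sup>2) \<le> M\<^sup>2"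
    proof (rule AE_I2)
      fix x
      have "\<bar>\<phi> x\<bar>\<^sup>2 \<le> M\<^sup>2" by (intro power_mono M) simp
      then show "norm ((\<phi> x)\<^sup>2) \<le> M\<^sup>2" by simp
    qed
    show "(\<lambda>x. (\<phi> x)\<^sup>2) \<in> borel_measurable vol" using \<phi>m by measurable
  qed
  have u\<phi>: "integrable vol (\<lambda>x. u x * \<phi> x)"
  proof (rule Bochner_Integration.integrable_bound)
    show "integrable vol (\<lambda>x. M * u x)" using ui by simp
    show "(\<lambda>x. u x * \<phi> x) \<in> borel_measurable vol" using um \<phi>m by measurable
    show "AE x in vol. norm (u x * \<phi> x) \<le> norm (M * u x)"
    proof (rule AE_I2)
      fix x
      have "\<bar>u x\<bar> * \<bar>\<phi> x\<bar> \<le> \<bar>u x\<bar> * \<bar>M\<bar>" using M[of x] by (intro mult_left_mono) auto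
      then show "norm (u x * \<phi> x) \<le> norm (M * u x)" by (simp add: abs_mult mult.commute)
    qed
  qed
  have we: "weak_differential A (\<lambda>x. u x + e * \<phi> x) (\<lambda>c x. w c x + e *\<^sub>R dfield \<phi> c x)" for e
    by (rule weak_differential_add_smooth[OF w s\<phi>])
  have wi: "integrable vol (covector_norm2 A g w)" by (rule W12_grad_norm2(1)[OF u w])
  have exp: "covector_norm2 A g (\<lambda>c x. w c x + e *\<^sub>R dfield \<phi> c x) =
      (\<lambda>x. covector_norm2 A g w x + 2 * e * H x + e\<^sup>2 * N x)" for e
    by (rule ext) (simp only: covector_norm2_add H_def N_def)
  have ve: "(\<lambda>x. u x + e * \<phi> x) \<in> W12 A g vol" for e
  proof -
    have "integrable vol (\<lambda>x. (u x)\<^sup>2 + 2 * e * (u x * \<phi> x) + e\<^sup>2 * (\<phi> x)\<^sup>2)" using u2 u\<phi> \<phi>2 by simp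
    also have "(\<lambda>x. (u x)\<^sup>2 + 2 * e * (u x * \<phi> x) + e\<^sup>2 * (\<phi> x)\<^sup>2) = (\<lambda>x. (u x + e * \<phi> x)\<^sup>2)"
      by (auto simp: power2_eq_square algebra_simps)
    finally have "integrable vol (\<lambda>x. (u x + e * \<phi> x)\<^sup>2)" .
    moreover have "integrable vol (covector_norm2 A g (\<lambda>c x. w c x + e *\<^sub>R dfield \<phi> c x))"
      unfolding exp using wi Hi Ni by simp
    moreover have "(\<lambda>x. u x + e * \<phi> x) \<in> borel_measurable vol" using um \<phi>m by measurable
    ultimately show ?thesis using we[of e] unfolding W12_def by blast
  qed
  let ?t = "1 - a / measure vol UNIV"
  have J: "obstacle_functional A g vol a v = (LINT x|vol. covector_norm2 A g w' x) - 2 * ?t * (LINT x|vol. v x)"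
    if "v \<in> W12 A g vol" "weak_differential A v w'" for v w'
    unfolding obstacle_functional_def Let_def
    using W12_grad_norm2[OF that] W12_integrable[OF that(1)] by simp
  have "obstacle_functional A g vol a (\<lambda>x. u x + e * \<phi> x) = obstacle_functional A g vol a u
      - 2 * e * ((LINT y:cimage c|lborel. u (cinv c y) * chart_div c \<psi> y)
           + ?t * (LINT y:cimage c|lborel. vol_density g c y * \<psi> y)) + e\<^sup>2 * B" for e
    unfolding J[OF ve we] J[OF u w] exp
    using wi Hi Ni ui \<phi>i(1) Hint \<phi>i(2) by (simp add: B_def algebra_simps)
  with ve show thesis using that unfolding \<phi>_def by blast
qed

end

section \<open>The Laplacian and the Green function in charts\<close>

lemma set_lebesgue_integral_sum:
  fixes f :: "'i \<Rightarrow> 'a \<Rightarrow> real"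
  assumes "\<And>i. i \<in> I \<Longrightarrow> set_integrable M S (f i)"
  shows "(LINT y:S|M. (\<Sum>i\<in>I. f i y)) = (\<Sum>i\<in>I. LINT y:S|M. f i y)"
proof -
  have "(LINT y|M. (\<Sum>i\<in>I. indicator S y *\<^sub>R f i y)) = (\<Sum>i\<in>I. LINT y|M. indicator S y *\<^sub>R f i y)"
    using assms by (intro Bochner_Integration.integral_sum) (simp add: set_integrable_def)
  then show ?thesis by (simp add: set_lebesgue_integral_def scaleR_sum_right sum_distrib_left)
qed

context elliptic
begin

lemma set_integrable_mult_test_function:
  assumes "locally_integrable \<Omega> w" "test_function \<Omega> \<psi>"
  shows "set_integrable lborel \<Omega> (\<lambda>y. w y * \<psi> y)"
proof -
  obtain K where K: "compact K" "K \<subseteq> \<Omega>" "\<And>y. y \<notin> K \<Longrightarrow> \<psi> y = 0"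
    using assms(2) by (rule test_function_support) (rule that)
  show ?thesis
    by (rule set_integrable_mult_test[OF open_\<Omega> assms(1)
          smooth_on_continuous_on[OF test_function_smooth[OF assms(2)]] K])
qed

text \<open>After one integration by parts, symmetry of the coefficients attaches them to the
  gradient of \<open>\<psi>\<close>; this is the form produced by
  \<open>chart_pairing_integral\<close>.\<close>

lemma divop_by_parts:
  assumes F: "smooth_on \<Omega> F" and \<psi>: "test_function \<Omega> \<psi>"
  shows "(LINT y:\<Omega>|lborel. divop a F y * \<psi> y) =
    - (\<Sum>i\<in>UNIV. LINT y:\<Omega>|lborel. pderiv_i i F y * (\<Sum>j\<in>UNIV. a y $ i $ j * pderiv_i j \<psi> y))"
proof -
  define b where "b i y = (\<Sum>j\<in>UNIV. a y $ i $ j * pderiv_i j F y)" for i y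
  have sb: "smooth_on \<Omega> (b i)" for i unfolding b_def by (rule smooth_flux[OF F])
  have lb: "locally_integrable \<Omega> (b i)" "locally_integrable \<Omega> (pderiv_i i (b i))" for i
    by (intro locally_integrable_continuous smooth_on_continuous_on smooth_on_pderiv_i sb)+
  have lF: "locally_integrable \<Omega> (pderiv_i i F)" for i
    by (intro locally_integrable_continuous smooth_on_continuous_on smooth_on_pderiv_i F)
  have "(LINT y:\<Omega>|lborel. divop a F y * \<psi> y) = (LINT y:\<Omega>|lborel. (\<Sum>i\<in>UNIV. pderiv_i i (b i) y * \<psi> y))"
    by (simp add: divop_def b_def[abs_def] sum_distrib_right)
  also have "\<dots> = (\<Sum>i\<in>UNIV. LINT y:\<Omega>|lborel. pderiv_i i (b i) y * \<psi> y)"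
    by (intro set_lebesgue_integral_sum set_integrable_mult_test_function lb \<psi>)
  also have "\<dots> = - (\<Sum>i\<in>UNIV. LINT y:\<Omega>|lborel. b i y * pderiv_i i \<psi> y)"
    using integral_by_parts[OF open_\<Omega> sb \<psi>] by (simp add: sum_negf)
  also have "(\<Sum>i\<in>UNIV. LINT y:\<Omega>|lborel. b i y * pderiv_i i \<psi> y) = (LINT y:\<Omega>|lborel. (\<Sum>i\<in>UNIV. b i y * pderiv_i i \<psi> y))"
    by (intro set_lebesgue_integral_sum[symmetric] set_integrable_mult_test_function lb test_function_pderiv_i \<psi>)
  also have "\<dots> = (LINT y:\<Omega>|lborel. (\<Sum>i\<in>UNIV. pderiv_i i F y * (\<Sum>j\<in>UNIV. a y $ i $ j * pderiv_i j \<psi> y)))"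
  proof (rule set_lebesgue_integral_cong)
    show "\<Omega> \<in> sets lborel" using open_\<Omega> by (simp add: borel_open)
    show "\<forall>y. y \<in> \<Omega> \<longrightarrow> (\<Sum>i\<in>UNIV. b i y * pderiv_i i \<psi> y) =
        (\<Sum>i\<in>UNIV. pderiv_i i F y * (\<Sum>j\<in>UNIV. a y $ i $ j * pderiv_i j \<psi> y))"
    proof (intro allI impI)
      fix y assume y: "y \<in> \<Omega>"
      have "(\<Sum>i\<in>UNIV. b i y * pderiv_i i \<psi> y) = (a y *v euclidean_gradient F y) \<bullet> euclidean_gradient \<psi> y"
        by (simp add: b_def inner_vec_def matrix_vector_mult_def euclidean_gradient_def)
      also have "\<dots> = euclidean_gradient F y \<bullet> (a y *v euclidean_gradient \<psi> y)"
        using inner_symmetric_matrix[OF sym_a[OF y]] by simp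
      finally show "(\<Sum>i\<in>UNIV. b i y * pderiv_i i \<psi> y) =
          (\<Sum>i\<in>UNIV. pderiv_i i F y * (\<Sum>j\<in>UNIV. a y $ i $ j * pderiv_i j \<psi> y))"
        by (simp add: inner_vec_def matrix_vector_mult_def euclidean_gradient_def)
    qed
  qed
  also have "\<dots> = (\<Sum>i\<in>UNIV. LINT y:\<Omega>|lborel. pderiv_i i F y * (\<Sum>j\<in>UNIV. a y $ i $ j * pderiv_i j \<psi> y))"
    by (intro set_lebesgue_integral_sum set_integrable_mult_test_function lF test_flux \<psi>)
  finally show ?thesis .
qed

text \<open>Integration by parts against the constant 1.\<close>

lemma integral_divop_test:
  assumes "test_function \<Omega> \<psi>"
  shows "(LINT y:\<Omega>|lborel. divop a \<psi> y) = 0"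
proof -
  define b where "b i y = (\<Sum>j\<in>UNIV. a y $ i $ j * pderiv_i j \<psi> y)" for i y
  have b: "test_function \<Omega> (b i)" for i unfolding b_def by (rule test_flux[OF assms])
  have l: "locally_integrable \<Omega> (\<lambda>y. 1)" by (intro locally_integrable_continuous continuous_on_const)
  have "(LINT y:\<Omega>|lborel. divop a \<psi> y) = (LINT y:\<Omega>|lborel. (\<Sum>i\<in>UNIV. 1 * pderiv_i i (b i) y))"
    by (simp add: divop_def b_def[abs_def])
  also have "\<dots> = (\<Sum>i\<in>UNIV. LINT y:\<Omega>|lborel. 1 * pderiv_i i (b i) y)"
    by (intro set_lebesgue_integral_sum set_integrable_mult_test_function l test_function_pderiv_i b)
  also have "\<dots> = 0"
    by (simp only: integral_by_parts[OF open_\<Omega> smooth_on_const b]) (simp add: set_lebesgue_integral_def)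
  finally show ?thesis .
qed

end

context riemannian
begin

lemma smooth_inverse_vol_density:
  assumes "c \<in> A"
  shows "smooth_on (cimage c) (\<lambda>y. 1 / vol_density g c y)"
proof -
  have "smooth_on (cimage c) (\<lambda>y. vol_density g c y powr -1)"
    by (rule smooth_on_real_compose[OF open_cimage[OF assms] smooth_vol_density[OF assms] Ck_on_powr])
      (use vol_density_pos[OF assms] in auto)
  moreover have "vol_density g c y powr -1 = 1 / vol_density g c y" if "y \<in> cimage c" for y
    using vol_density_pos[OF assms that] by (simp add: powr_minus_divide)
  ultimately show ?thesis using smooth_on_cong[OF open_cimage[OF assms]] by (metis (no_types, lifting))
qed

lemma continuous_chart_laplacian:
  assumes c: "c \<in> A" and f: "smooth_fun A f"
  shows "continuous_on (cimage c) (\<lambda>y. chart_laplacian g c f (cinv c y))"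
proof -
  interpret elliptic "cimage c" "principal_coeff g c" by (rule elliptic_chart[OF c])
  have "smooth_on (cimage c) (f \<circ> cinv c)" using f c by (simp add: smooth_fun_def)
  then have "continuous_on (cimage c) (\<lambda>y. - ((1 / vol_density g c y) * chart_div c (f \<circ> cinv c) y))"
    by (intro continuous_on_minus continuous_on_mult smooth_on_continuous_on smooth_inverse_vol_density[OF c]
        smooth_divop)
  then show ?thesis
    by (rule continuous_on_eq) (simp add: chart_laplacian_eq[OF c] snd_cinv[OF c])
qed

text \<open>The right-hand side of the second identity depends on \<open>\<psi>\<close> only through
  the function \<open>ext_chart c \<psi>\<close> on the manifold, which makes it suitable for
  comparing two charts.\<close>

lemma chart_laplacian_weak:
  assumes c: "c \<in> A" and f: "smooth_fun A f" and \<psi>: "test_function (cimage c) \<psi>"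
  defines "h \<equiv> \<lambda>y. chart_laplacian g c f (cinv c y) * \<psi> y"
  shows "integrable vol (ext_chart c h)"
    and "(LINT x|vol. ext_chart c h x) = (LINT x|vol. covector_inner A g (dfield f) (dfield (ext_chart c \<psi>)) x)"
proof -
  interpret elliptic "cimage c" "principal_coeff g c" by (rule elliptic_chart[OF c])
  define F where "F = f \<circ> cinv c"
  have F: "smooth_on (cimage c) F" using f c by (simp add: smooth_fun_def F_def)
  have "continuous_on (cimage c) h"
    unfolding h_def
    using smooth_on_continuous_on[OF test_function_smooth[OF \<psi>]]
    by (intro continuous_on_mult continuous_chart_laplacian[OF c f]) (auto intro: continuous_on_subset)
  then have m: "(\<lambda>y. indicator (cimage c) y * h y) \<in> borel_measurable borel"
    using borel_measurable_continuous_on_indicator[of "cimage c" h] open_\<Omega> by (simp add: borel_open)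
  have e: "vol_density g c y * h y = - (chart_div c F y * \<psi> y)" if "y \<in> cimage c" for y
    using vol_density_pos[OF c that] snd_cinv[OF c that] by (simp add: h_def chart_laplacian_eq[OF c] F_def)
  have lD: "locally_integrable (cimage c) (chart_div c F)"
    by (intro locally_integrable_continuous smooth_on_continuous_on smooth_divop F)
  have i: "set_integrable lborel (cimage c) (\<lambda>y. - (chart_div c F y * \<psi> y))"
    using set_integrable_mult_test_function[OF lD \<psi>] by (simp add: set_integrable_def)
  have "set_integrable lborel (cimage c) (\<lambda>y. vol_density g c y * h y) \<longleftrightarrow>
      set_integrable lborel (cimage c) (\<lambda>y. - (chart_div c F y * \<psi> y))"
    by (intro set_integrable_cong) (simp_all add: e)
  with i show "integrable vol (ext_chart c h)" unfolding ext_chart_integral(1)[OF c m] by blast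
  have "(LINT x|vol. ext_chart c h x) = (LINT y:cimage c|lborel. - (chart_div c F y * \<psi> y))"
    unfolding ext_chart_integral(2)[OF c m]
    by (rule set_lebesgue_integral_cong) (use open_\<Omega> e in \<open>simp_all add: borel_open\<close>)
  also have "\<dots> = - (LINT y:cimage c|lborel. chart_div c F y * \<psi> y)"
    by (simp add: set_lebesgue_integral_def)
  also have "\<dots> = (\<Sum>i\<in>UNIV. LINT y:cimage c|lborel. pderiv_i i F y * (\<Sum>j\<in>UNIV. principal_coeff g c y $ i $ j * pderiv_i j \<psi> y))"
    by (simp add: divop_by_parts[OF F \<psi>])
  also have "\<dots> = (LINT x|vol. ext_chart c (\<lambda>y. euclidean_gradient F y \<bullet> (matrix_inv (g c (cinv c y)) *v euclidean_gradient \<psi> y)) x)"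
  proof -
    have "locally_integrable (cimage c) (\<lambda>y. euclidean_gradient F y $ i)" for i
      using smooth_on_continuous_on[OF smooth_on_pderiv_i[OF F, of i]]
      by (intro locally_integrable_continuous) (simp add: euclidean_gradient_def)
    from chart_pairing_integral(2)[OF c this \<psi>] show ?thesis by (simp add: euclidean_gradient_def)
  qed
  also have "ext_chart c (\<lambda>y. euclidean_gradient F y \<bullet> (matrix_inv (g c (cinv c y)) *v euclidean_gradient \<psi> y)) =
      covector_inner A g (dfield f) (dfield (ext_chart c \<psi>))"
    unfolding covector_inner_ext_chart[OF c \<psi> dfield_covector[OF f]]
    by (rule ext) (simp add: ext_chart_def dfield_def euclidean_gradient_def F_def cinv_snd[OF c])
  finally show "(LINT x|vol. ext_chart c h x) = (LINT x|vol. covector_inner A g (dfield f) (dfield (ext_chart c \<psi>)) x)" .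
qed

text \<open>A test function supported in the coordinates of an overlap can be rewritten in the other
  chart without changing the function on the manifold.\<close>

lemma ext_chart_transfer:
  assumes c: "c \<in> A" and d: "d \<in> A" and \<psi>: "test_function (snd c ` (fst c \<inter> fst d)) \<psi>"
  obtains \<psi>' where "test_function (cimage d) \<psi>'" "ext_chart d \<psi>' = ext_chart c \<psi>"
proof -
  have sub: "snd c ` (fst c \<inter> fst d) \<subseteq> cimage c" using snd_mem[OF c] by blast
  obtain K' where K': "compact K'" "K' \<subseteq> fst c" "snd c ` K' \<subseteq> snd c ` (fst c \<inter> fst d)"
    "open (- K')" "\<And>x. x \<notin> K' \<Longrightarrow> ext_chart c \<psi> x = 0"
    by (rule ext_chart_support[OF c \<psi> sub]) (rule that)
  have K'd: "K' \<subseteq> fst d"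
  proof
    fix x assume x: "x \<in> K'"
    then obtain x' where "x' \<in> fst c" "x' \<in> fst d" "snd c x = snd c x'" using K'(3) by blast
    then show "x \<in> fst d" using cinv_snd[OF c] x K'(2) by (metis subsetD)
  qed
  define \<phi> where "\<phi> = ext_chart c \<psi>"
  define \<psi>' where "\<psi>' y = (if y \<in> cimage d then \<phi> (cinv d y) else 0)" for y
  have s\<phi>: "smooth_on (cimage d) (\<phi> \<circ> cinv d)"
    using smooth_fun_ext_chart[OF c test_function_mono[OF \<psi> sub]] d by (simp add: smooth_fun_def \<phi>_def)
  have z: "\<psi>' y = 0" if "y \<notin> snd d ` K'" for y
  proof (cases "y \<in> cimage d")
    case True
    then have "cinv d y \<notin> K'" using that snd_cinv[OF d True] by (metis image_eqI)
    then show ?thesis using K'(5) by (simp add: \<psi>'_def \<phi>_def)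
  qed (simp add: \<psi>'_def)
  have cK: "compact (snd d ` K')"
    by (rule compact_continuous_image[OF continuous_on_subset[OF continuous_snd[OF d] K'd] K'(1)])
  show thesis
  proof (rule that[of \<psi>'])
    show "test_function (cimage d) \<psi>'"
    proof (rule test_functionI[OF _ cK _ z])
      show "snd d ` K' \<subseteq> cimage d" using K'd snd_mem[OF d] by blast
      show "smooth_on UNIV \<psi>'"
      proof (rule smooth_on_local)
        fix y
        show "\<exists>T. open T \<and> y \<in> T \<and> smooth_on T \<psi>'"
        proof (cases "y \<in> cimage d")
          case True
          have "smooth_on (cimage d) \<psi>' \<longleftrightarrow> smooth_on (cimage d) (\<phi> \<circ> cinv d)"
            by (rule smooth_on_cong[OF open_cimage[OF d]]) (simp add: \<psi>'_def)
          then show ?thesis using s\<phi> True open_cimage[OF d] by blast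
        next
          case False
          have o: "open (- snd d ` K')" using cK compact_imp_closed by blast
          have "smooth_on (- snd d ` K') \<psi>' \<longleftrightarrow> smooth_on (- snd d ` K') (\<lambda>_. 0 :: real)"
            by (rule smooth_on_cong[OF o]) (simp add: z)
          moreover have "y \<in> - snd d ` K'" using False K'd snd_mem[OF d] by blast
          ultimately show ?thesis using o smooth_on_const by blast
        qed
      qed
    qed
    show "ext_chart d \<psi>' = ext_chart c \<psi>"
    proof
      fix x
      show "ext_chart d \<psi>' x = ext_chart c \<psi> x"
      proof (cases "x \<in> fst d")
        case True
        then show ?thesis using snd_mem[OF d True] cinv_snd[OF d True]
          by (simp add: ext_chart_def[of d] \<psi>'_def \<phi>_def)
      next
        case False
        then have "ext_chart c \<psi> x = 0" using K'd by (intro K'(5)) blast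
        then show ?thesis using False by (simp add: ext_chart_def[of d])
      qed
    qed
  qed
qed

text \<open>Both chart expressions represent the same weak Laplacian, so they agree almost everywhere and
  hence, being continuous, everywhere. This avoids differentiating the determinant of the metric.\<close>

lemma chart_laplacian_invariant:
  assumes c: "c \<in> A" and d: "d \<in> A" and f: "smooth_fun A f" and x: "x \<in> fst c" "x \<in> fst d"
  shows "chart_laplacian g c f x = chart_laplacian g d f x"
proof -
  define \<Omega> where "\<Omega> = snd c ` (fst c \<inter> fst d)"
  have o: "open \<Omega>" unfolding \<Omega>_def by (rule open_overlap_image[OF c open_chart[OF d]])
  have sub: "\<Omega> \<subseteq> cimage c" unfolding \<Omega>_def using snd_mem[OF c] by blast
  have \<Omega>d: "cinv c y \<in> fst d" if "y \<in> \<Omega>" for y using that cinv_snd[OF c] by (auto simp: \<Omega>_def)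
  \<comment> \<open>The weight turns the volume integral of the difference into a Lebesgue integral
    in coordinates, and it can be divided out at the end because it is positive.\<close>
  define D where "D y = vol_density g c y * (chart_laplacian g c f (cinv c y) - chart_laplacian g d f (cinv c y))" for y
  have cD: "continuous_on \<Omega> D"
  proof -
    have "continuous_on \<Omega> (snd d \<circ> cinv c)"
      using smooth_on_continuous_on[OF transition_smooth[OF c d]] by (simp add: \<Omega>_def)
    then have "continuous_on \<Omega> (\<lambda>y. chart_laplacian g d f (cinv d ((snd d \<circ> cinv c) y)))"
      using \<Omega>d snd_mem[OF d] by (intro continuous_on_compose2[OF continuous_chart_laplacian[OF d f]]) auto
    then have "continuous_on \<Omega> (\<lambda>y. chart_laplacian g d f (cinv c y))"
      by (rule continuous_on_eq) (simp add: \<Omega>d cinv_snd[OF d])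
    moreover have "continuous_on \<Omega> (\<lambda>y. chart_laplacian g c f (cinv c y))"
      by (rule continuous_on_subset[OF continuous_chart_laplacian[OF c f] sub])
    moreover have "continuous_on \<Omega> (vol_density g c)"
      by (rule continuous_on_subset[OF smooth_on_continuous_on[OF smooth_vol_density[OF c]] sub])
    ultimately show ?thesis unfolding D_def by (intro continuous_on_mult continuous_on_diff)
  qed
  have "AE y in lborel. y \<in> \<Omega> \<longrightarrow> D y = 0"
  proof (rule du_Bois_Reymond[OF o locally_integrable_continuous[OF cD]])
    fix \<psi> assume \<psi>: "test_function \<Omega> \<psi>"
    then have \<psi>c: "test_function (cimage c) \<psi>" using sub by (rule test_function_mono)
    obtain \<psi>' where \<psi>': "test_function (cimage d) \<psi>'" "ext_chart d \<psi>' = ext_chart c \<psi>"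
      by (rule ext_chart_transfer[OF c d \<psi>[unfolded \<Omega>_def]]) (rule that)
    define p where "p = ext_chart c (\<lambda>y. chart_laplacian g c f (cinv c y) * \<psi> y)"
    define q where "q = ext_chart d (\<lambda>y. chart_laplacian g d f (cinv d y) * \<psi>' y)"
    note P = chart_laplacian_weak[OF c f \<psi>c, folded p_def]
    note Q = chart_laplacian_weak[OF d f \<psi>'(1), folded q_def, unfolded \<psi>'(2)]
    obtain K where K: "\<And>y. y \<notin> K \<Longrightarrow> \<psi> y = 0" "K \<subseteq> \<Omega>"
      using \<psi> by (rule test_function_support) (rule that)
    \<comment> \<open>Off \<open>fst c\<close> both terms vanish, since the transferred test
      function is the same function on the manifold.\<close>
    have pq: "p x - q x = indicator (fst c) x * (p x - q x)" for x
    proof (cases "x \<in> fst c")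
      case False
      then have "p x = 0" "ext_chart d \<psi>' x = 0" unfolding p_def \<psi>'(2) by (simp_all add: ext_chart_def)
      then show ?thesis using False by (cases "x \<in> fst d") (auto simp: q_def ext_chart_def split: if_splits)
    qed simp
    have pm: "(\<lambda>x. p x - q x) \<in> borel_measurable borel"
    proof -
      have "(\<lambda>x. p x - q x) \<in> borel_measurable vol"
        using borel_measurable_integrable[OF P(1)] borel_measurable_integrable[OF Q(1)] by measurable
      then show ?thesis by measurable
    qed
    have val: "vol_density g c y * (p (cinv c y) - q (cinv c y)) = D y * \<psi> y" if y: "y \<in> cimage c" for y
    proof -
      have 1: "ext_chart d \<psi>' (cinv c y) = \<psi> y" unfolding \<psi>'(2) by (rule ext_chart_cinv[OF c y])
      have 2: "p (cinv c y) = chart_laplacian g c f (cinv c y) * \<psi> y"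
        unfolding p_def by (rule ext_chart_cinv[OF c y])
      have 3: "q (cinv c y) = chart_laplacian g d f (cinv c y) * \<psi> y"
      proof (cases "cinv c y \<in> fst d")
        case True
        then have "\<psi>' (snd d (cinv c y)) = \<psi> y" using 1 by (simp add: ext_chart_def)
        then show ?thesis using True cinv_snd[OF d True] by (simp add: q_def ext_chart_def)
      next
        case False
        then have "\<psi> y = 0" using 1 by (simp add: ext_chart_def)
        then show ?thesis using False by (simp add: q_def ext_chart_def)
      qed
      show ?thesis by (simp add: 2 3 D_def algebra_simps)
    qed
    have "0 = (LINT x|vol. p x - q x)" using P Q by simp
    also have "\<dots> = (LINT x|vol. indicator (fst c) x * (p x - q x))"
      by (rule Bochner_Integration.integral_cong[OF refl]) (rule pq)
    also have "\<dots> = (LINT y:cimage c|lborel. vol_density g c y * (p (cinv c y) - q (cinv c y)))"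
      by (rule chart_integral(2)[OF c pm])
    also have "\<dots> = (LINT y:cimage c|lborel. D y * \<psi> y)"
      by (rule set_lebesgue_integral_cong) (use open_cimage[OF c] val in \<open>simp_all add: borel_open\<close>)
    also have "\<dots> = (LINT y:\<Omega>|lborel. D y * \<psi> y)"
      unfolding set_lebesgue_integral_def
    proof (rule Bochner_Integration.integral_cong[OF refl])
      fix y
      show "indicator (cimage c) y *\<^sub>R (D y * \<psi> y) = indicator \<Omega> y *\<^sub>R (D y * \<psi> y)"
      proof (cases "y \<in> K")
        case True
        then have "y \<in> \<Omega>" "y \<in> cimage c" using K(2) sub by blast+
        then show ?thesis by simp
      qed (simp add: K(1))
    qed
    finally show "(LINT y:\<Omega>|lborel. D y * \<psi> y) = 0" by simp
  qed
  then have "D (snd c x) = 0"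
    by (rule continuous_AE_zero_imp_zero[OF o cD]) (use x in \<open>auto simp: \<Omega>_def\<close>)
  then show ?thesis using vol_density_pos[OF c snd_mem[OF c x(1)]] cinv_snd[OF c x(1)] by (simp add: D_def)
qed

text \<open>\<open>laplacian\<close> evaluates in the chart picked by \<open>chart_at\<close>.
  Invariance moves it to \<open>c\<close>; at points off \<open>fst c\<close> the function vanishes
  in a neighbourhood.\<close>

lemma laplacian_ext_chart:
  assumes c: "c \<in> A" and \<psi>: "test_function (cimage c) \<psi>"
  shows "laplacian A g (ext_chart c \<psi>) =
    ext_chart c (\<lambda>y. - (1 / vol_density g c y) * chart_div c \<psi> y)"
proof
  fix x
  note s = smooth_fun_ext_chart[OF c \<psi>]
  show "laplacian A g (ext_chart c \<psi>) x =
    ext_chart c (\<lambda>y. - (1 / vol_density g c y) * chart_div c \<psi> y) x"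
  proof (cases "x \<in> fst c")
    case True
    have o: "open (cimage c)" by (rule open_cimage[OF c])
    have "pderiv_i j (ext_chart c \<psi> \<circ> cinv c) z = pderiv_i j \<psi> z" if "z \<in> cimage c" for j z
      by (rule pderiv_i_cong[OF o that]) (simp add: ext_chart_cinv[OF c])
    then have "pderiv_i i (\<lambda>z. \<Sum>j\<in>UNIV. principal_coeff g c z $ i $ j * pderiv_i j (ext_chart c \<psi> \<circ> cinv c) z) (snd c x) =
        pderiv_i i (\<lambda>z. \<Sum>j\<in>UNIV. principal_coeff g c z $ i $ j * pderiv_i j \<psi> z) (snd c x)" for i
      by (intro pderiv_i_cong[OF o snd_mem[OF c True]]) simp
    then have "chart_div c (ext_chart c \<psi> \<circ> cinv c) (snd c x) = chart_div c \<psi> (snd c x)"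
      by (simp add: divop_def)
    then show ?thesis
      using chart_laplacian_invariant[OF chart_at_mem(1) c s chart_at_mem(2) True] True
      by (simp add: laplacian_def chart_laplacian_eq[OF c] ext_chart_def[of c])
  next
    case False
    obtain K' where K': "K' \<subseteq> fst c" "open (- K')" "\<And>x. x \<notin> K' \<Longrightarrow> ext_chart c \<psi> x = 0"
      by (rule ext_chart_support[OF c \<psi> order_refl]) (rule that)
    let ?d = "chart_at A x"
    let ?W = "{y \<in> cimage ?d. cinv ?d y \<in> - K'}"
    have o: "open ?W" by (rule open_cinv_preimage[OF chart_at_mem(1) K'(2)])
    have xW: "snd ?d x \<in> ?W"
      using False K'(1) snd_mem[OF chart_at_mem] cinv_snd[OF chart_at_mem] by auto
    have "pderiv_i j (ext_chart c \<psi> \<circ> cinv ?d) z = 0" if "z \<in> ?W" for j z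
      using pderiv_i_cong[OF o that, of "ext_chart c \<psi> \<circ> cinv ?d" "\<lambda>_. 0"] K'(3) by simp
    then have "pderiv_i i (\<lambda>z. \<Sum>j\<in>UNIV. principal_coeff g ?d z $ i $ j * pderiv_i j (ext_chart c \<psi> \<circ> cinv ?d) z) (snd ?d x) =
        pderiv_i i (\<lambda>_. 0) (snd ?d x)" for i
      by (intro pderiv_i_cong[OF o xW]) simp
    then have "chart_div ?d (ext_chart c \<psi> \<circ> cinv ?d) (snd ?d x) = 0"
      by (simp add: divop_def)
    then show ?thesis using False by (simp add: laplacian_def chart_laplacian_eq[OF chart_at_mem(1)] ext_chart_def[of c])
  qed
qed

text \<open>The change of variables gives integrability only with the weight
  \<open>vol_density\<close>, whose reciprocal is bounded on compact subsets of the chart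
  image.\<close>

lemma chart_locally_integrable:
  assumes c: "c \<in> A" and f: "integrable vol f"
  shows "locally_integrable (cimage c) (\<lambda>y. f (cinv c y))"
proof -
  have fm: "f \<in> borel_measurable borel" using borel_measurable_integrable[OF f] by measurable
  have U: "fst c \<in> sets vol" using open_chart[OF c] by (simp add: sets_vol borel_open)
  have "integrable vol (\<lambda>x. indicator (fst c) x * f x)"
    using integrable_mult_indicator[OF U f] by simp
  then have i: "set_integrable lborel (cimage c) (\<lambda>y. vol_density g c y * f (cinv c y))"
    using chart_integral(1)[OF c fm] by blast
  note s = smooth_on_continuous_on[OF smooth_inverse_vol_density[OF c]]
  show ?thesis
    unfolding locally_integrable_def
  proof (intro allI impI)
    fix K assume K: "compact K \<and> K \<subseteq> cimage c"
    then have Ks: "K \<in> sets lborel" by (simp add: borel_compact)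
    have iK: "integrable lborel (\<lambda>y. indicator K y * (vol_density g c y * f (cinv c y)))"
      using set_integrable_subset[OF i Ks] K by (simp add: set_integrable_def)
    have "bounded ((\<lambda>y. 1 / vol_density g c y) ` K)"
      using K s by (intro compact_imp_bounded compact_continuous_image) (auto intro: continuous_on_subset)
    then obtain M where M: "\<And>y. y \<in> K \<Longrightarrow> \<bar>1 / vol_density g c y\<bar> \<le> M" by (auto simp: bounded_iff)
    have m: "(\<lambda>y. indicator (cimage c) y * (1 / vol_density g c y)) \<in> borel_measurable borel"
      using borel_measurable_continuous_on_indicator[OF _ s] open_cimage[OF c] by (simp add: borel_open)
    have e: "(\<lambda>y. (indicator K y * (vol_density g c y * f (cinv c y))) * (indicator (cimage c) y * (1 / vol_density g c y))) =
        (\<lambda>y. indicator K y *\<^sub>R f (cinv c y))"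
    proof
      fix y
      show "(indicator K y * (vol_density g c y * f (cinv c y))) * (indicator (cimage c) y * (1 / vol_density g c y)) =
          indicator K y *\<^sub>R f (cinv c y)"
      proof (cases "y \<in> K")
        case True
        then have "y \<in> cimage c" using K by blast
        then show ?thesis using True vol_density_pos[OF c \<open>y \<in> cimage c\<close>] by simp
      qed simp
    qed
    have "integrable lborel (\<lambda>y. (indicator K y * (vol_density g c y * f (cinv c y))) * (indicator (cimage c) y * (1 / vol_density g c y)))"
    proof (rule Bochner_Integration.integrable_bound)
      show "integrable lborel (\<lambda>y. M * (indicator K y * (vol_density g c y * f (cinv c y))))" using iK by simp
      show "(\<lambda>y. (indicator K y * (vol_density g c y * f (cinv c y))) * (indicator (cimage c) y * (1 / vol_density g c y))) \<in> borel_measurable lborel"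
        using m by (intro borel_measurable_times[OF borel_measurable_integrable[OF iK]]) simp
      show "AE y in lborel. norm ((indicator K y * (vol_density g c y * f (cinv c y))) * (indicator (cimage c) y * (1 / vol_density g c y)))
          \<le> norm (M * (indicator K y * (vol_density g c y * f (cinv c y))))"
      proof (rule AE_I2)
        fix y
        let ?r = "vol_density g c y * f (cinv c y)"
        show "norm ((indicator K y * ?r) * (indicator (cimage c) y * (1 / vol_density g c y))) \<le> norm (M * (indicator K y * ?r))"
        proof (cases "y \<in> K")
          case True
          then have "\<bar>?r\<bar> * \<bar>1 / vol_density g c y\<bar> \<le> \<bar>?r\<bar> * \<bar>M\<bar>" using M[OF True] by (intro mult_left_mono) auto
          then show ?thesis using True K by (auto simp: abs_mult mult_ac)
        qed simp
      qed
    qed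
    then show "set_integrable lborel K (\<lambda>y. f (cinv c y))" unfolding e set_integrable_def .
  qed
qed

text \<open>The distributional equation of \<open>G\<close> tested with
  \<open>ext_chart c \<psi>\<close>. The density cancels against the one in the Laplacian, and the
  opposite sign convention of \<open>divop\<close> reverses the signs.\<close>

lemma green_chart_identity:
  assumes G: "greens_function A g vol G" and c: "c \<in> A" and \<psi>: "test_function (cimage c) \<psi>"
  shows "(LINT y:cimage c|lborel. G x (cinv c y) * chart_div c \<psi> y) =
    (LINT y:cimage c|lborel. vol_density g c y * \<psi> y) / measure vol UNIV - ext_chart c \<psi> x"
proof -
  interpret elliptic "cimage c" "principal_coeff g c" by (rule elliptic_chart[OF c])
  have Gi: "integrable vol (G x)" using G unfolding greens_function_def by blast
  have Gm: "G x \<in> borel_measurable borel" using borel_measurable_integrable[OF Gi] by measurable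
  have eq: "(LINT y|vol. G x y * laplacian A g (ext_chart c \<psi>) y) =
      ext_chart c \<psi> x - (LINT y|vol. ext_chart c \<psi> y) / measure vol UNIV"
    using G smooth_fun_ext_chart[OF c \<psi>] unfolding greens_function_def by blast
  define h where "h y = G x (cinv c y) * (- (1 / vol_density g c y) * chart_div c \<psi> y)" for y
  have m: "(\<lambda>y. indicator (cimage c) y * h y) \<in> borel_measurable borel"
  proof -
    have co: "continuous_on (cimage c) (\<lambda>y. - ((1 / vol_density g c y) * chart_div c \<psi> y))"
      using smooth_on_continuous_on[OF test_function_smooth[OF test_divop[OF \<psi>]]]
      by (intro continuous_on_minus continuous_on_mult smooth_on_continuous_on[OF smooth_inverse_vol_density[OF c]])
        (auto intro: continuous_on_subset)
    have 1: "(\<lambda>y. indicator (cimage c) y * - ((1 / vol_density g c y) * chart_div c \<psi> y)) \<in> borel_measurable borel"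
      using borel_measurable_continuous_on_indicator[OF _ co] open_\<Omega> by (simp add: borel_open)
    have 2: "(\<lambda>y. G x (chart_inverse c y)) \<in> borel_measurable borel"
      by (rule measurable_compose[OF measurable_chart_inverse[OF c] Gm])
    have "(\<lambda>y. G x (chart_inverse c y) * (indicator (cimage c) y * - ((1 / vol_density g c y) * chart_div c \<psi> y))) \<in> borel_measurable borel"
      by (rule borel_measurable_times[OF 2 1])
    also have "(\<lambda>y. G x (chart_inverse c y) * (indicator (cimage c) y * - ((1 / vol_density g c y) * chart_div c \<psi> y))) =
        (\<lambda>y. indicator (cimage c) y * h y)"
      by (rule ext) (simp add: h_def chart_inverse_def indicator_def)
    finally show ?thesis .
  qed
  have "(\<lambda>y. G x y * laplacian A g (ext_chart c \<psi>) y) = ext_chart c h"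
    unfolding laplacian_ext_chart[OF c \<psi>] by (rule ext) (simp add: ext_chart_def h_def cinv_snd[OF c])
  then have "(LINT y|vol. G x y * laplacian A g (ext_chart c \<psi>) y) = (LINT y:cimage c|lborel. vol_density g c y * h y)"
    using ext_chart_integral(2)[OF c m] by simp
  also have "\<dots> = (LINT y:cimage c|lborel. - (G x (cinv c y) * chart_div c \<psi> y))"
  proof (rule set_lebesgue_integral_cong)
    show "cimage c \<in> sets lborel" using open_\<Omega> by (simp add: borel_open)
    show "\<forall>y. y \<in> cimage c \<longrightarrow> vol_density g c y * h y = - (G x (cinv c y) * chart_div c \<psi> y)"
      using vol_density_pos[OF c] by (auto simp: h_def less_imp_neq[symmetric])
  qed
  also have "\<dots> = - (LINT y:cimage c|lborel. G x (cinv c y) * chart_div c \<psi> y)"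
    by (simp add: set_lebesgue_integral_def)
  finally show ?thesis using eq integrable_ext_chart_test(2)[OF c \<psi>] by simp
qed

end

section \<open>Minimizing configurations\<close>

lemma quadratic_nonneg_imp_linear_zero:
  fixes L B :: real
  assumes "0 < e0" "\<And>e. \<bar>e\<bar> \<le> e0 \<Longrightarrow> 0 \<le> - 2 * e * L + e\<^sup>2 * B"
  shows "L = 0"
proof (rule ccontr)
  assume "L \<noteq> 0"
  \<comment> \<open>So small that the quadratic term cannot outweigh the linear one; the sign of
    \<open>L\<close> then selects the direction in which the form would become negative.\<close>
  define d where "d = min e0 (\<bar>L\<bar> / (\<bar>B\<bar> + 1))"
  have d: "0 < d" "d \<le> e0" "d \<le> \<bar>L\<bar> / (\<bar>B\<bar> + 1)"
    using assms(1) \<open>L \<noteq> 0\<close> by (auto simp: d_def intro!: divide_pos_pos add_nonneg_pos)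
  then have d3: "d * (\<bar>B\<bar> + 1) \<le> \<bar>L\<bar>" by (simp add: pos_le_divide_eq add_nonneg_pos)
  have "0 \<le> - 2 * (sgn L * d) * L + (sgn L * d)\<^sup>2 * B"
    using d \<open>L \<noteq> 0\<close> by (intro assms(2)) (simp add: abs_mult abs_sgn_eq)
  also have "\<dots> = d * (d * B - 2 * \<bar>L\<bar>)"
    using \<open>L \<noteq> 0\<close> by (simp add: power2_eq_square sgn_if abs_if algebra_simps)
  finally have "2 * \<bar>L\<bar> \<le> d * B" using d(1) by (simp add: zero_le_mult_iff)
  also have "\<dots> \<le> d * (\<bar>B\<bar> + 1)" using d(1) by (intro mult_left_mono) auto
  finally show False using d3 \<open>L \<noteq> 0\<close> by simp
qed

lemma isCont_eventually_less:
  fixes f :: "'a::t2_space \<Rightarrow> real"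
  assumes "isCont f y" "f y < b"
  obtains W where "open W" "y \<in> W" "\<And>x. x \<in> W \<Longrightarrow> f x < b"
proof -
  have "\<forall>\<^sub>F x in nhds y. f x < b"
    using assms by (intro order_tendstoD(2)[of f "f y"]) (simp_all add: isCont_def tendsto_nhds_iff)
  then show ?thesis using that by (auto simp: eventually_nhds)
qed

lemma isCont_eventually_greater:
  fixes f :: "'a::t2_space \<Rightarrow> real"
  assumes "isCont f y" "b < f y"
  obtains W where "open W" "y \<in> W" "\<And>x. x \<in> W \<Longrightarrow> b < f x"
proof -
  have "\<forall>\<^sub>F x in nhds y. b < f x"
    using assms by (intro order_tendstoD(1)[of f "f y"]) (simp_all add: isCont_def tendsto_nhds_iff)
  then show ?thesis using that by (auto simp: eventually_nhds)
qed

text \<open>The point \<open>z i\<close> occurs in each of its pairs twice, once in either order,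
  whence the factor 2 by symmetry.\<close>

lemma green_energy_split:
  assumes "i \<in> {1..N}" "\<And>p q. G p q = G q p"
  defines "I \<equiv> {1..N} - {i}"
  shows "green_energy G N z = (\<Sum>k\<in>I. \<Sum>l\<in>I - {k}. G (z k) (z l)) + 2 * (\<Sum>k\<in>I. G (z k) (z i))"
proof -
  have I: "{1..N} = insert i I" "i \<notin> I" "finite I" using assms(1) by (auto simp: I_def)
  have "(\<Sum>l\<in>insert i I - {k}. G (z k) (z l)) = G (z k) (z i) + (\<Sum>l\<in>I - {k}. G (z k) (z l))" if "k \<in> I" for k
  proof -
    have "insert i I - {k} = insert i (I - {k})" using that I(2) by auto
    then show ?thesis using I by simp
  qed
  then have "(\<Sum>k\<in>I. \<Sum>l\<in>insert i I - {k}. G (z k) (z l)) =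
      (\<Sum>k\<in>I. G (z k) (z i)) + (\<Sum>k\<in>I. \<Sum>l\<in>I - {k}. G (z k) (z l))"
    by (simp add: sum.distrib)
  moreover have "(\<Sum>l\<in>insert i I - {i}. G (z i) (z l)) = (\<Sum>k\<in>I. G (z k) (z i))"
    using I(2) assms(2) by (simp add: insert_Diff_if)
  ultimately show ?thesis unfolding green_energy_def I(1) using I(2,3) by simp
qed

text \<open>Moving the single point \<open>x i\<close> changes only the interaction with the others, so \<open>x i\<close> minimizes
  the potential of the remaining points.\<close>

lemma minimizing_configuration_potential:
  assumes min: "minimizing_configuration G N x" and i: "i \<in> {1..N}" and sym: "\<And>p q. G p q = G q p"
    and y: "y \<notin> x ` ({1..N} - {i})"
  shows "(\<Sum>k\<in>{1..N} - {i}. G (x k) (x i)) \<le> (\<Sum>k\<in>{1..N} - {i}. G (x k) y)"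
proof -
  let ?I = "{1..N} - {i}"
  define z where "z = x(i := y)"
  have zI: "z k = x k" if "k \<in> ?I" for k using that by (simp add: z_def)
  have "inj_on x {1..N}" using min by (simp add: minimizing_configuration_def)
  then have "inj_on x ?I" by (rule inj_on_subset) blast
  then have "inj_on z ?I" using inj_on_cong[of ?I z x, OF zI] by simp
  moreover have "z i \<notin> z ` (?I - {i})"
    using y image_cong[OF refl zI, of ?I] by (simp add: z_def)
  ultimately have "inj_on z (insert i ?I)" by (simp only: inj_on_insert) blast
  moreover have "insert i ?I = {1..N}" using i by blast
  ultimately have "inj_on z {1..N}" by (simp only:)
  then have "green_energy G N x \<le> green_energy G N z" using min by (simp add: minimizing_configuration_def)
  moreover have "(\<Sum>k\<in>?I. \<Sum>l\<in>?I - {k}. G (z k) (z l)) = (\<Sum>k\<in>?I. \<Sum>l\<in>?I - {k}. G (x k) (x l))"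
    by (intro sum.cong refl) (simp add: zI)
  moreover have "(\<Sum>k\<in>?I. G (z k) (z i)) = (\<Sum>k\<in>?I. G (x k) y)"
    by (intro sum.cong refl) (simp add: zI z_def)
  ultimately show ?thesis unfolding green_energy_split[OF i sym] by simp
qed

section \<open>The equation off the contact set and the Harnack inequality on the manifold\<close>

context riemannian
begin

text \<open>Joint smoothness off the diagonal is restricted to the slice on which the first argument
  has the coordinates of \<open>z\<close>.\<close>

lemma green_isCont:
  assumes G: "greens_function A g vol G" and "y \<noteq> z"
  shows "isCont (G z) y"
proof -
  obtain c where c: "c \<in> A" "z \<in> fst c" by (rule chart_covers)
  obtain d where d: "d \<in> A" "y \<in> fst d" by (rule chart_covers)
  define S where "S = {(p, q). p \<in> cimage c \<and> q \<in> cimage d \<and> cinv c p \<noteq> cinv d q}"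
  have "smooth_on S (\<lambda>(p, q). G (cinv c p) (cinv d q))"
    using G c(1) d(1) unfolding greens_function_def smooth_off_diagonal_def S_def by blast
  then have cS: "continuous_on S (\<lambda>(p, q). G (cinv c p) (cinv d q))" by (rule smooth_on_continuous_on)
  define W where "W = fst d - {z}"
  have W: "open W" "y \<in> W" using open_chart[OF d(1)] d(2) assms(2) by (auto simp: W_def)
  have "continuous_on W (\<lambda>y. (snd c z, snd d y))"
    by (intro continuous_on_Pair continuous_on_const continuous_on_subset[OF continuous_snd[OF d(1)]])
      (auto simp: W_def)
  moreover have "(\<lambda>y. (snd c z, snd d y)) ` W \<subseteq> S"
    using snd_mem[OF c(1)] c(2) snd_mem[OF d(1)] cinv_snd[OF c(1)] cinv_snd[OF d(1)]
    by (auto simp: S_def W_def)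
  ultimately have "continuous_on W (\<lambda>y'. (\<lambda>(p, q). G (cinv c p) (cinv d q)) (snd c z, snd d y'))"
    by (rule continuous_on_compose2[OF cS])
  then have "continuous_on W (G z)"
    by (rule continuous_on_eq) (auto simp: W_def cinv_snd[OF c(1) c(2)] cinv_snd[OF d(1)])
  then show ?thesis using W by (simp add: continuous_on_eq_continuous_at)
qed

text \<open>Where a gap \<open>\<gamma>\<close> separates \<open>u\<close> from the obstacle, small
  variations of either sign stay admissible, so the first variation vanishes. At \<open>p\<close>
  the obstacle is infinite and constrains nothing, hence the exception in
  \<open>gap\<close>.\<close>

lemma obstacle_equation:
  assumes sol: "obstacle_solution A g vol G p a u" and a: "0 < a" and c: "c \<in> A" and \<gamma>: "0 < \<gamma>"
    and gap: "\<And>x. x \<in> W \<Longrightarrow> x \<noteq> p \<Longrightarrow> u x + \<gamma> \<le> a * G p x"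
    and \<psi>: "test_function (snd c ` (fst c \<inter> W)) \<psi>"
  shows "(LINT y:cimage c|lborel. u (cinv c y) * chart_div c \<psi> y) =
    - ((1 - a / measure vol UNIV) * (LINT y:cimage c|lborel. vol_density g c y * \<psi> y))"
proof -
  have sub: "snd c ` (fst c \<inter> W) \<subseteq> cimage c" using snd_mem[OF c] by blast
  have \<psi>c: "test_function (cimage c) \<psi>" by (rule test_function_mono[OF \<psi> sub])
  have u: "u \<in> W12 A g vol" and uAE: "AE x in vol. ereal (u x) \<le> ereal a * green_ext G p x"
    and umin: "\<And>v. v \<in> obstacle_class A g vol G p a \<Longrightarrow>
      obstacle_functional A g vol a u \<le> obstacle_functional A g vol a v"
    using sol unfolding obstacle_solution_def obstacle_class_def by blast+
  obtain B where B: "\<And>e. (\<lambda>x. u x + e * ext_chart c \<psi> x) \<in> W12 A g vol"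
    "\<And>e. obstacle_functional A g vol a (\<lambda>x. u x + e * ext_chart c \<psi> x) = obstacle_functional A g vol a u
       - 2 * e * ((LINT y:cimage c|lborel. u (cinv c y) * chart_div c \<psi> y)
           + (1 - a / measure vol UNIV) * (LINT y:cimage c|lborel. vol_density g c y * \<psi> y)) + e\<^sup>2 * B"
    by (rule obstacle_functional_variation[OF c u \<psi>c]) (rule that)
  obtain K where K: "compact K" "K \<subseteq> snd c ` (fst c \<inter> W)" "\<And>y. y \<notin> K \<Longrightarrow> \<psi> y = 0"
    using \<psi> by (rule test_function_support) (rule that)
  obtain M where M: "\<And>y. \<bar>\<psi> y\<bar> \<le> M"
    using bounded_continuous_compact_support[OF smooth_on_continuous_on[OF test_function_smooth[OF \<psi>]] K(1,3)] by blast
  have M0: "0 \<le> M" using order_trans[OF abs_ge_zero M] .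
  let ?L = "(LINT y:cimage c|lborel. u (cinv c y) * chart_div c \<psi> y)
           + (1 - a / measure vol UNIV) * (LINT y:cimage c|lborel. vol_density g c y * \<psi> y)"
  have "?L = 0"
  proof (rule quadratic_nonneg_imp_linear_zero)
    \<comment> \<open>With this bound on \<open>e\<close> the perturbation stays within
      \<open>\<gamma>\<close>; adding 1 covers the case that \<open>\<psi>\<close> vanishes and
      \<open>M\<close> is 0.\<close>
    show "0 < \<gamma> / (M + 1)" using \<gamma> M0 by simp
    fix e assume e: "\<bar>e\<bar> \<le> \<gamma> / (M + 1)"
    have small: "\<bar>e * \<psi> y\<bar> \<le> \<gamma>" for y
    proof -
      have "\<bar>e * \<psi> y\<bar> \<le> \<gamma> / (M + 1) * (M + 1)"
        unfolding abs_mult using e M[of y] M0 \<gamma> by (intro mult_mono) auto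
      then show ?thesis using M0 by simp
    qed
    have "AE x in vol. ereal (u x + e * ext_chart c \<psi> x) \<le> ereal a * green_ext G p x"
      using uAE
    proof eventually_elim
      case (elim x)
      show ?case
      proof (cases "x = p")
        case True
        then show ?thesis using a by (simp add: green_ext_def)
      next
        case False
        then have le: "u x \<le> a * G p x" using elim by (simp add: green_ext_def)
        have "u x + e * ext_chart c \<psi> x \<le> a * G p x"
        proof (cases "x \<in> fst c \<and> snd c x \<in> K")
          case True
          then obtain x' where "x' \<in> fst c" "x' \<in> W" "snd c x = snd c x'" using K(2) by blast
          then have "x \<in> W" using cinv_snd[OF c] True by metis
          then show ?thesis using gap[OF _ False] small[of "snd c x"] True by (simp add: ext_chart_def)
        next
          case False
          then have "ext_chart c \<psi> x = 0" using K(3) by (auto simp: ext_chart_def)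
          then show ?thesis using le by simp
        qed
        then show ?thesis using False by (simp add: green_ext_def)
      qed
    qed
    then have "(\<lambda>x. u x + e * ext_chart c \<psi> x) \<in> obstacle_class A g vol G p a"
      using B(1) unfolding obstacle_class_def by blast
    from umin[OF this] show "0 \<le> - 2 * e * ?L + e\<^sup>2 * B" unfolding B(2) by simp
  qed
  then show ?thesis by linarith
qed

text \<open>\<open>mean_value_inequality\<close> carried over to a chart. On the finite set
  \<open>S\<close> the values of \<open>q\<close> are uncontrolled, because they involve the
  arbitrary values of \<open>G\<close> on the diagonal; in coordinates \<open>S\<close> is a null
  set, and pointwise conclusions exclude it.\<close>

lemma local_harnack:
  assumes c: "c \<in> A" and y0: "y0 \<in> fst c" "y0 \<in> W" and W: "open W" and dim: "2 \<le> CARD('n)"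
    and q: "integrable vol q" and S: "finite S" and nn: "\<forall>x. x \<notin> S \<longrightarrow> 0 \<le> q x"
    and cont: "\<forall>x. x \<notin> S \<longrightarrow> isCont q x" and \<Lambda>: "0 \<le> \<Lambda>"
    and super: "\<forall>\<phi>. test_function (snd c ` (fst c \<inter> W)) \<phi> \<longrightarrow> (\<forall>y. 0 \<le> \<phi> y) \<longrightarrow>
      (LINT y:cimage c|lborel. q (cinv c y) * chart_div c \<phi> y) \<le> - (\<Lambda> * \<phi> (snd c y0))"
  obtains \<rho> c0 C where "0 < \<rho>" "0 < c0" "0 \<le> C" "ball (snd c y0) \<rho> \<subseteq> cimage c"
    "set_integrable lborel (ball (snd c y0) \<rho>) (\<lambda>y. q (cinv c y))"
    "AE y in lborel. y \<in> ball (snd c y0) \<rho> \<longrightarrow> 0 \<le> q (cinv c y)"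
    "\<forall>y1\<in>ball (snd c y0) \<rho>. cinv c y1 \<notin> S \<longrightarrow> isCont (\<lambda>y. q (cinv c y)) y1"
    "\<forall>y1\<in>ball (snd c y0) \<rho>. cinv c y1 \<notin> S \<longrightarrow>
       c0 * \<Lambda> + c0 * (LINT y:ball (snd c y0) \<rho>|lborel. q (cinv c y)) \<le> C * q (cinv c y1)"
proof -
  define \<Omega> where "\<Omega> = snd c ` (fst c \<inter> W)"
  have sub: "\<Omega> \<subseteq> cimage c" unfolding \<Omega>_def using snd_mem[OF c] by blast
  have o: "open \<Omega>" unfolding \<Omega>_def by (rule open_overlap_image[OF c W])
  interpret E: elliptic \<Omega> "principal_coeff g c"
    by (rule elliptic.elliptic_subset[OF elliptic_chart[OF c] o sub])
  let ?z = "snd c y0"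
  have z: "?z \<in> \<Omega>" using y0 by (simp add: \<Omega>_def)
  obtain R \<rho> c0 C where R: "0 < R" "cball ?z R \<subseteq> \<Omega>" and \<rho>: "0 < \<rho>" "\<rho> \<le> R" and c0: "0 < c0" and C: "0 \<le> C"
    and mv: "\<forall>q y1 \<Lambda>. y1 \<in> ball ?z \<rho> \<longrightarrow> set_integrable lborel (ball ?z R) q \<longrightarrow>
       (AE y in lborel. y \<in> ball ?z R \<longrightarrow> 0 \<le> q y) \<longrightarrow> isCont q y1 \<longrightarrow> 0 \<le> q y1 \<longrightarrow> 0 \<le> \<Lambda> \<longrightarrow>
       (\<forall>\<phi>. test_function (ball ?z R) \<phi> \<longrightarrow> (\<forall>y. 0 \<le> \<phi> y) \<longrightarrow>
          (LINT y:ball ?z R|lborel. q y * chart_div c \<phi> y) \<le> - (\<Lambda> * \<phi> ?z)) \<longrightarrow>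
       c0 * \<Lambda> + c0 * (LINT y:ball ?z \<rho>|lborel. q y) \<le> C * q y1"
    by (rule E.mean_value_inequality[OF z dim]) (rule that)
  have bR: "ball ?z R \<subseteq> \<Omega>" "ball ?z R \<subseteq> cimage c" using R(2) sub ball_subset_cball[of ?z R] by blast+
  have b\<rho>: "ball ?z \<rho> \<subseteq> ball ?z R" using \<rho> by auto
  have "set_integrable lborel (cball ?z R) (\<lambda>y. q (cinv c y))"
    using chart_locally_integrable[OF c q] R(2) sub unfolding locally_integrable_def by (meson compact_cball order_trans)
  then have iR: "set_integrable lborel (ball ?z R) (\<lambda>y. q (cinv c y))"
    by (rule set_integrable_subset) auto
  have ae: "AE y in lborel. y \<in> ball ?z R \<longrightarrow> 0 \<le> q (cinv c y)"
  proof -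
    have "AE y in lborel. y \<notin> snd c ` S"
      by (intro AE_not_in finite_imp_null_set_lborel finite_imageI S)
    then show ?thesis
    proof eventually_elim
      case (elim y)
      show ?case
      proof
        assume "y \<in> ball ?z R"
        then have "y \<in> cimage c" using bR by blast
        then have "cinv c y \<notin> S" using elim snd_cinv[OF c] by (metis image_eqI)
        then show "0 \<le> q (cinv c y)" using nn by blast
      qed
    qed
  qed
  have ct: "isCont (\<lambda>y. q (cinv c y)) y1" if "y1 \<in> ball ?z R" "cinv c y1 \<notin> S" for y1
  proof -
    have "isCont (cinv c) y1"
      using continuous_cinv[OF c] open_cimage[OF c] that(1) bR(2) by (auto simp: continuous_on_eq_continuous_at)
    moreover have "isCont q (cinv c y1)" using cont that(2) by blast
    ultimately show ?thesis by (rule isCont_o2[where f = "cinv c" and g = q])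
  qed
  have sup: "(LINT y:ball ?z R|lborel. q (cinv c y) * chart_div c \<phi> y) \<le> - (\<Lambda> * \<phi> ?z)"
    if \<phi>: "test_function (ball ?z R) \<phi>" "\<And>y. 0 \<le> \<phi> y" for \<phi>
  proof -
    interpret B: elliptic "ball ?z R" "principal_coeff g c" by (rule E.elliptic_subset[OF open_ball bR(1)])
    obtain K where K: "K \<subseteq> ball ?z R" "\<And>y. y \<notin> K \<Longrightarrow> chart_div c \<phi> y = 0"
      using B.test_divop[OF \<phi>(1)] by (rule test_function_support) (rule that)
    \<comment> \<open>The operator applied to \<open>\<phi>\<close> is supported in the ball, so
      enlarging the domain of integration changes nothing.\<close>
    have "(LINT y:ball ?z R|lborel. q (cinv c y) * chart_div c \<phi> y) =
        (LINT y:cimage c|lborel. q (cinv c y) * chart_div c \<phi> y)"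
      unfolding set_lebesgue_integral_def
    proof (rule Bochner_Integration.integral_cong[OF refl])
      fix y
      show "indicator (ball ?z R) y *\<^sub>R (q (cinv c y) * chart_div c \<phi> y) =
          indicator (cimage c) y *\<^sub>R (q (cinv c y) * chart_div c \<phi> y)"
      proof (cases "y \<in> K")
        case True
        then have "y \<in> ball ?z R" "y \<in> cimage c" using K(1) bR(2) by blast+
        then show ?thesis by simp
      qed (simp add: K(2))
    qed
    also have "\<dots> \<le> - (\<Lambda> * \<phi> ?z)"
      using super test_function_mono[OF \<phi>(1) bR(1)] \<phi>(2) unfolding \<Omega>_def by blast
    finally show ?thesis .
  qed
  show thesis
  proof (rule that[OF \<rho>(1) c0 C])
    show "ball ?z \<rho> \<subseteq> cimage c" using b\<rho> bR by blast
    show "set_integrable lborel (ball ?z \<rho>) (\<lambda>y. q (cinv c y))"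
      by (rule set_integrable_subset[OF iR _ b\<rho>]) simp
    show "AE y in lborel. y \<in> ball ?z \<rho> \<longrightarrow> 0 \<le> q (cinv c y)"
      using ae by eventually_elim (use b\<rho> in blast)
    show "\<forall>y1\<in>ball ?z \<rho>. cinv c y1 \<notin> S \<longrightarrow> isCont (\<lambda>y. q (cinv c y)) y1"
      using b\<rho> ct by blast
    show "\<forall>y1\<in>ball ?z \<rho>. cinv c y1 \<notin> S \<longrightarrow>
      c0 * \<Lambda> + c0 * (LINT y:ball ?z \<rho>|lborel. q (cinv c y)) \<le> C * q (cinv c y1)"
    proof (intro ballI impI)
      fix y1 assume that: "y1 \<in> ball ?z \<rho>" "cinv c y1 \<notin> S"
      have "isCont (\<lambda>y. q (cinv c y)) y1" using that b\<rho> by (intro ct) blast+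
      moreover have "0 \<le> q (cinv c y1)" using nn that(2) by blast
      ultimately show "c0 * \<Lambda> + c0 * (LINT y:ball ?z \<rho>|lborel. q (cinv c y)) \<le> C * q (cinv c y1)"
        using mv[rule_format, of y1 "\<lambda>y. q (cinv c y)" \<Lambda>] that(1) iR ae \<Lambda> sup by blast
    qed
  qed
qed

lemma open_chart_ball:
  assumes "c \<in> A"
  shows "open {x \<in> fst c. snd c x \<in> ball z \<rho>}"
  using continuous_open_preimage[OF continuous_snd[OF assms] open_chart[OF assms] open_ball[of z \<rho>]]
  by (simp add: vimage_def Int_def)

lemma positive_near_source:
  assumes c: "c \<in> A" and y0: "y0 \<in> fst c" "y0 \<in> W" and W: "open W" and dim: "2 \<le> CARD('n)"
    and q: "integrable vol q" and S: "finite S" and nn: "\<forall>x. x \<notin> S \<longrightarrow> 0 \<le> q x"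
    and cont: "\<forall>x. x \<notin> S \<longrightarrow> isCont q x" and \<Lambda>: "0 < \<Lambda>"
    and super: "\<forall>\<phi>. test_function (snd c ` (fst c \<inter> W)) \<phi> \<longrightarrow> (\<forall>y. 0 \<le> \<phi> y) \<longrightarrow>
      (LINT y:cimage c|lborel. q (cinv c y) * chart_div c \<phi> y) \<le> - (\<Lambda> * \<phi> (snd c y0))"
  obtains W' \<delta> where "open W'" "y0 \<in> W'" "0 < \<delta>" "\<forall>x\<in>W' - S. \<delta> \<le> q x"
proof -
  obtain \<rho> c0 C where h: "0 < \<rho>" "0 < c0" "0 \<le> C"
    and b: "ball (snd c y0) \<rho> \<subseteq> cimage c"
    and i: "set_integrable lborel (ball (snd c y0) \<rho>) (\<lambda>y. q (cinv c y))"
    and ae: "AE y in lborel. y \<in> ball (snd c y0) \<rho> \<longrightarrow> 0 \<le> q (cinv c y)"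
    and ct: "\<forall>y1\<in>ball (snd c y0) \<rho>. cinv c y1 \<notin> S \<longrightarrow> isCont (\<lambda>y. q (cinv c y)) y1"
    and le: "\<forall>y1\<in>ball (snd c y0) \<rho>. cinv c y1 \<notin> S \<longrightarrow>
       c0 * \<Lambda> + c0 * (LINT y:ball (snd c y0) \<rho>|lborel. q (cinv c y)) \<le> C * q (cinv c y1)"
    by (rule local_harnack[OF c y0 W dim q S nn cont less_imp_le[OF \<Lambda>] super]) (rule that)
  have "0 \<le> (LINT y:ball (snd c y0) \<rho>|lborel. q (cinv c y))"
    unfolding set_lebesgue_integral_def
    by (rule integral_nonneg_AE) (use ae in \<open>auto elim!: eventually_mono simp: indicator_def\<close>)
  then have I: "0 \<le> c0 * (LINT y:ball (snd c y0) \<rho>|lborel. q (cinv c y))" using h(2) by simp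
  show thesis
  proof (rule that[of "{x \<in> fst c. snd c x \<in> ball (snd c y0) \<rho>}" "c0 * \<Lambda> / (C + 1)"])
    show "open {x \<in> fst c. snd c x \<in> ball (snd c y0) \<rho>}" by (rule open_chart_ball[OF c])
    show "y0 \<in> {x \<in> fst c. snd c x \<in> ball (snd c y0) \<rho>}" using y0 h by simp
    show "0 < c0 * \<Lambda> / (C + 1)" using h \<Lambda> by simp
    show "\<forall>x\<in>{x \<in> fst c. snd c x \<in> ball (snd c y0) \<rho>} - S. c0 * \<Lambda> / (C + 1) \<le> q x"
    proof
    fix x assume x: "x \<in> {x \<in> fst c. snd c x \<in> ball (snd c y0) \<rho>} - S"
    then have "c0 * \<Lambda> \<le> C * q x" using le[rule_format, of "snd c x"] cinv_snd[OF c, of x] I by simp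
    also have "\<dots> \<le> (C + 1) * q x" using nn x by (intro mult_right_mono) auto
    finally show "c0 * \<Lambda> / (C + 1) \<le> q x" using h(3) by (simp add: field_simps)
    qed
  qed
qed

text \<open>The local strong maximum principle. At a zero the Harnack inequality without mass forces
  the integral of \<open>q\<close> over a ball to be 0, so \<open>q\<close> vanishes there almost
  everywhere and by continuity everywhere off \<open>S\<close>.\<close>

lemma zero_near_zero:
  assumes c: "c \<in> A" and y0: "y0 \<in> fst c" "y0 \<in> W" and W: "open W" and dim: "2 \<le> CARD('n)"
    and q: "integrable vol q" and S: "finite S" and nn: "\<forall>x. x \<notin> S \<longrightarrow> 0 \<le> q x"
    and cont: "\<forall>x. x \<notin> S \<longrightarrow> isCont q x"
    and super: "\<forall>\<phi>. test_function (snd c ` (fst c \<inter> W)) \<phi> \<longrightarrow> (\<forall>y. 0 \<le> \<phi> y) \<longrightarrow>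
      (LINT y:cimage c|lborel. q (cinv c y) * chart_div c \<phi> y) \<le> 0"
    and z: "y0 \<notin> S" "q y0 = 0"
  obtains W' where "open W'" "y0 \<in> W'" "W' \<inter> S = {}" "\<forall>x\<in>W'. q x = 0"
proof -
  have super0: "\<forall>\<phi>. test_function (snd c ` (fst c \<inter> W)) \<phi> \<longrightarrow> (\<forall>y. 0 \<le> \<phi> y) \<longrightarrow>
      (LINT y:cimage c|lborel. q (cinv c y) * chart_div c \<phi> y) \<le> - (0 * \<phi> (snd c y0))"
    using super by simp
  obtain \<rho> c0 C where h: "0 < \<rho>" "0 < c0" "0 \<le> C" and b: "ball (snd c y0) \<rho> \<subseteq> cimage c"
    and i: "set_integrable lborel (ball (snd c y0) \<rho>) (\<lambda>y. q (cinv c y))"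
    and ae: "AE y in lborel. y \<in> ball (snd c y0) \<rho> \<longrightarrow> 0 \<le> q (cinv c y)"
    and ct: "\<forall>y1\<in>ball (snd c y0) \<rho>. cinv c y1 \<notin> S \<longrightarrow> isCont (\<lambda>y. q (cinv c y)) y1"
    and le: "\<forall>y1\<in>ball (snd c y0) \<rho>. cinv c y1 \<notin> S \<longrightarrow>
       c0 * 0 + c0 * (LINT y:ball (snd c y0) \<rho>|lborel. q (cinv c y)) \<le> C * q (cinv c y1)"
    by (rule local_harnack[OF c y0 W dim q S nn cont order_refl super0]) (rule that)
  let ?b = "ball (snd c y0) \<rho>"
  have "c0 * (LINT y:?b|lborel. q (cinv c y)) \<le> 0"
    using le[rule_format, of "snd c y0"] cinv_snd[OF c y0(1)] z h(1) by simp
  then have I0: "(LINT y:?b|lborel. q (cinv c y)) \<le> 0" using h(2) by (simp add: mult_le_0_iff)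
  have ae': "AE y in lborel. 0 \<le> indicator ?b y *\<^sub>R q (cinv c y)"
    using ae by eventually_elim (auto simp: indicator_def)
  have "(LINT y|lborel. indicator ?b y *\<^sub>R q (cinv c y)) = 0"
    using I0 integral_nonneg_AE[OF ae'] by (simp add: set_lebesgue_integral_def)
  then have "AE y in lborel. indicator ?b y *\<^sub>R q (cinv c y) = 0"
    using integral_nonneg_eq_0_iff_AE[OF _ ae'] i by (simp add: set_integrable_def)
  then have z0: "AE y in lborel. y \<in> {y \<in> ?b. cinv c y \<in> - S} \<longrightarrow> q (cinv c y) = 0"
    by eventually_elim (auto simp: indicator_def)
  have oS: "open (- S)" using finite_imp_closed[OF S] by blast
  have oU: "open {y \<in> ?b. cinv c y \<in> - S}"
    using continuous_open_preimage[OF continuous_on_subset[OF continuous_cinv[OF c] b] open_ball oS]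
    by (simp add: vimage_def Int_def)
  have cU: "continuous_on {y \<in> ?b. cinv c y \<in> - S} (\<lambda>y. q (cinv c y))"
    by (intro continuous_at_imp_continuous_on ballI) (use ct in auto)
  show thesis
  proof (rule that[of "{x \<in> fst c. snd c x \<in> ?b} \<inter> - S"])
    show "open ({x \<in> fst c. snd c x \<in> ?b} \<inter> - S)" by (intro open_Int open_chart_ball[OF c] oS)
    show "y0 \<in> {x \<in> fst c. snd c x \<in> ?b} \<inter> - S" using y0 h z by simp
    show "({x \<in> fst c. snd c x \<in> ?b} \<inter> - S) \<inter> S = {}" by blast
    show "\<forall>x\<in>{x \<in> fst c. snd c x \<in> ?b} \<inter> - S. q x = 0"
    proof
    fix x assume x: "x \<in> {x \<in> fst c. snd c x \<in> ?b} \<inter> - S"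
    then have "q (cinv c (snd c x)) = 0"
      by (intro continuous_AE_zero_imp_zero[OF oU cU z0]) (use cinv_snd[OF c, of x] in auto)
    then show "q x = 0" using x cinv_snd[OF c] by simp
    qed
  qed
qed

section \<open>Comparison of the obstacle solution with the potential of the remaining
  points\<close>

lemma minimizer_outside_harmonic_ball:
  assumes dim: "2 \<le> CARD('n)" and G: "greens_function A g vol G" and min: "minimizing_configuration G N x"
    and N: "3 \<le> N" and V: "V = measure vol UNIV" and a: "a = V / (real N - 1)"
    and i: "i \<in> {1..N}" and j: "j \<in> {1..N}" and ij: "i \<noteq> j"
  shows "x i \<notin> harmonic_ball A g vol G (x j) a"
proof
  assume "x i \<in> harmonic_ball A g vol G (x j) a"
  then obtain u where sol: "obstacle_solution A g vol G (x j) a u"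
    and below: "ereal (u (x i)) < ereal a * green_ext G (x j) (x i)"
    unfolding harmonic_ball_def by blast
  define p where "p = x j"
  \<comment> \<open>The points other than \<open>x i\<close> and \<open>x j\<close>; their positions
    \<open>S\<close> are the poles of the comparison function \<open>h\<close>.\<close>
  define I where "I = {1..N} - {i} - {j}"
  define S where "S = x ` I"
  have inj: "inj_on x {1..N}" using min by (simp add: minimizing_configuration_def)
  have xij: "x i \<noteq> p" using inj_on_eq_iff[OF inj i j] ij by (simp add: p_def)
  have IN: "I \<subseteq> {1..N}" unfolding I_def by blast
  have xiS: "x i \<notin> S" unfolding S_def inj_on_image_mem_iff[OF inj i IN] by (simp add: I_def)
  have pS: "p \<notin> S" unfolding S_def p_def inj_on_image_mem_iff[OF inj j IN] by (simp add: I_def)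
  have finI: "finite I" and finS: "finite S" by (simp_all add: I_def S_def)
  have cardI: "card I = N - 2" using i j ij by (simp add: I_def)
  then have "I \<noteq> {}" using N by auto
  then have Sne: "S \<noteq> {}" by (simp add: S_def)
  have V0: "0 < V" using finite_volume V by simp
  have a0: "0 < a" using V0 N by (simp add: a)
  \<comment> \<open>The background terms of the \<open>N - 2\<close> Green functions add up to the
    constant driving the obstacle problem, thanks to \<open>a = V / (N - 1)\<close>.\<close>
  have aI: "a * (real (card I) / V) = 1 - a / V"
    using V0 N by (simp add: a cardI of_nat_diff field_simps)
  have sym: "\<And>q r. G q r = G r q" using G unfolding greens_function_def by blast
  have u_below: "u (x i) < a * G p (x i)" using below xij by (simp add: green_ext_def p_def)
  have u: "u \<in> W12 A g vol" and uc: "continuous_on UNIV u"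
    using sol unfolding obstacle_solution_def obstacle_class_def by blast+
  have ucont: "isCont u y" for y using uc by (simp add: continuous_on_eq_continuous_at)
  define m where "m = (\<Sum>k\<in>{1..N} - {i}. G (x k) (x i))"
  define h where "h y = a * m - a * (\<Sum>k\<in>I. G (x k) y)" for y
  have Isplit: "{1..N} - {i} = insert j I" "j \<notin> I" using j ij by (auto simp: I_def)
  have h_le: "h y \<le> a * G p y" if "y \<notin> S" "y \<noteq> p" for y
  proof -
    have "y \<notin> x ` ({1..N} - {i})" using that unfolding Isplit(1) S_def p_def by blast
    then have "m \<le> (\<Sum>k\<in>{1..N} - {i}. G (x k) y)"
      unfolding m_def by (rule minimizing_configuration_potential[OF min i sym])
    then have "a * m \<le> a * (G p y + (\<Sum>k\<in>I. G (x k) y))"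
      unfolding Isplit(1) using a0 Isplit(2) finI by (simp add: p_def)
    then show ?thesis by (simp add: h_def algebra_simps)
  qed
  have h_eq: "h (x i) = a * G p (x i)"
    unfolding h_def m_def Isplit(1) using Isplit(2) finI by (simp add: p_def algebra_simps)
  define w where "w y = h y - u y" for y
  have hcont: "isCont h y" if "y \<notin> S" for y
  proof -
    have "isCont (\<lambda>y. G (x k) y) y" if "k \<in> I" for k
      using \<open>y \<notin> S\<close> that by (intro green_isCont[OF G]) (auto simp: S_def)
    then show ?thesis unfolding h_def by (intro continuous_intros) auto
  qed
  have wcont: "isCont w y" if "y \<notin> S" for y
    unfolding w_def using hcont[OF that] ucont by (intro continuous_intros)
  \<comment> \<open>The gap between obstacle and solution. Its value at \<open>p\<close> is
    meaningless, since there it uses the arbitrary real number \<open>G p p\<close>.\<close>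
  define r where "r y = a * G p y - u y" for y
  have rcont: "isCont r y" if "y \<noteq> p" for y
    unfolding r_def using green_isCont[OF G that] ucont by (intro continuous_intros)
  have w_le_r: "w y \<le> r y" if "y \<notin> S" "y \<noteq> p" for y using h_le[OF that] by (simp add: w_def r_def)
  \<comment> \<open>At a pole \<open>w\<close> is uncontrolled, but around it \<open>w\<close> is
    bounded by \<open>r\<close>, which is continuous there because \<open>p\<close> is not a
    pole.\<close>
  have nbhd_S: "\<exists>W. open W \<and> y \<in> W \<and> (\<forall>z\<in>W - S. w z \<le> b)" if y: "y \<in> S" "r y < b" for y b
  proof -
    have yp: "y \<noteq> p" using y pS by auto
    obtain W where W: "open W" "y \<in> W" "\<And>z. z \<in> W \<Longrightarrow> r z < b"
      using isCont_eventually_less[OF rcont[OF yp] y(2)] by metis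
    have "w z \<le> b" if "z \<in> (W - {p}) - S" for z
      using W(3)[of z] w_le_r[of z] that by auto
    then show ?thesis using W yp by (intro exI[of _ "W - {p}"]) auto
  qed
  have nbhd: "\<exists>W. open W \<and> y \<in> W \<and> (\<forall>z\<in>W - S. w z \<le> b)" if y: "y \<notin> S" "w y < b" for y b
    using isCont_eventually_less[OF wcont[OF y(1)] y(2)] by (metis DiffD1 less_imp_le)
  \<comment> \<open>Local bounds taken from \<open>D\<close> combine into a global one in
    \<open>D\<close>, as the maximum of finitely many elements is one of them. This is used with all
    reals to see that \<open>w\<close> is bounded above off \<open>S\<close>, and with the numbers
    below \<open>M\<close> for the contradiction.\<close>
  have cover: "\<exists>b\<in>D. \<forall>y. y \<notin> S \<longrightarrow> w y \<le> b"
    if loc: "\<And>y. \<exists>W. open W \<and> y \<in> W \<and> (\<exists>b\<in>D. \<forall>z\<in>W - S. w z \<le> b)" for D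
  proof -
    define \<W> where "\<W> = {W. open W \<and> (\<exists>b\<in>D. \<forall>z\<in>W - S. w z \<le> b)}"
    have "UNIV \<subseteq> \<Union>\<W>" using loc unfolding \<W>_def by blast
    then obtain \<W>' where W': "\<W>' \<subseteq> \<W>" "finite \<W>'" "UNIV \<subseteq> \<Union>\<W>'"
      using compactE[OF compact_UNIV, of \<W>] unfolding \<W>_def by blast
    have "\<forall>W\<in>\<W>'. \<exists>b. b \<in> D \<and> (\<forall>z\<in>W - S. w z \<le> b)" using W'(1) by (auto simp: \<W>_def)
    then obtain \<beta> where \<beta>: "\<And>W. W \<in> \<W>' \<Longrightarrow> \<beta> W \<in> D" "\<And>W z. W \<in> \<W>' \<Longrightarrow> z \<in> W - S \<Longrightarrow> w z \<le> \<beta> W"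
      by (auto dest!: bchoice)
    have ne: "\<W>' \<noteq> {}" using W'(3) by auto
    have "Max (\<beta> ` \<W>') \<in> \<beta> ` \<W>'" using W'(2) ne by (intro Max_in) simp_all
    moreover have "\<beta> ` \<W>' \<subseteq> D" using \<beta>(1) by (rule image_subsetI)
    ultimately have "Max (\<beta> ` \<W>') \<in> D" by (rule rev_subsetD)
    moreover have "w y \<le> Max (\<beta> ` \<W>')" if "y \<notin> S" for y
    proof -
      obtain W where "W \<in> \<W>'" "y \<in> W" using W'(3) by blast
      then have "w y \<le> \<beta> W" using that by (intro \<beta>(2)) simp_all
      also have "\<dots> \<le> Max (\<beta> ` \<W>')" using W'(2) \<open>W \<in> \<W>'\<close> by (intro Max_ge) auto
      finally show ?thesis .
    qed
    ultimately show ?thesis by (intro bexI[of _ "Max (\<beta> ` \<W>')"]) simp_all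
  qed
  have "\<exists>b\<in>UNIV. \<forall>y. y \<notin> S \<longrightarrow> w y \<le> b"
  proof (rule cover)
    fix y
    show "\<exists>W. open W \<and> y \<in> W \<and> (\<exists>b\<in>UNIV. \<forall>z\<in>W - S. w z \<le> b)"
      using nbhd_S[of y "r y + 1"] nbhd[of y "w y + 1"] by (cases "y \<in> S") auto
  qed
  then have bdd: "bdd_above (w ` (- S))" by (auto simp: bdd_above_def)
  define M where "M = Sup (w ` (- S))"
  have wM: "w y \<le> M" if "y \<notin> S" for y unfolding M_def using that by (intro cSup_upper bdd) auto
  have M0: "0 < M"
  proof -
    have "0 < w (x i)" using u_below by (simp add: w_def h_eq)
    also have "\<dots> \<le> M" by (rule wM[OF xiS])
    finally show ?thesis .
  qed
  define q where "q y = M - w y" for y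
  have q_nn: "0 \<le> q y" if "y \<notin> S" for y using wM[OF that] by (simp add: q_def)
  have q_cont: "isCont q y" if "y \<notin> S" for y unfolding q_def using wcont[OF that] by (intro continuous_intros)
  have q_nn': "\<forall>y. y \<notin> S \<longrightarrow> 0 \<le> q y" and q_cont': "\<forall>y. y \<notin> S \<longrightarrow> isCont q y"
    using q_nn q_cont by blast+
  have Gi: "integrable vol (G y)" for y using G unfolding greens_function_def by blast
  have q_eq: "q = (\<lambda>y. (M - a * m) + a * (\<Sum>k\<in>I. G (x k) y) + u y)" by (auto simp: q_def w_def h_def)
  have q_int: "integrable vol q"
    unfolding q_eq
    by (intro Bochner_Integration.integrable_add Bochner_Integration.integrable_sum integrable_mult_right
        finite_measure.integrable_const[OF finite_measure_vol] Gi W12_integrable[OF u])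
  \<comment> \<open>The constant part of \<open>q\<close> contributes nothing, the Green functions
    give their background and point terms, and \<open>u\<close> gives the obstacle equation. By
    \<open>aI\<close> the volume terms cancel and only the point masses remain.\<close>
  have equation: "(LINT y:cimage c|lborel. q (cinv c y) * chart_div c \<phi> y) =
      - (a * (\<Sum>k\<in>I. ext_chart c \<phi> (x k)))"
    if c: "c \<in> A" and \<gamma>: "0 < \<gamma>" and gap: "\<And>y. y \<in> W \<Longrightarrow> y \<noteq> p \<Longrightarrow> \<gamma> \<le> r y"
      and \<phi>: "test_function (snd c ` (fst c \<inter> W)) \<phi>" for c W \<gamma> \<phi>
  proof -
    interpret elliptic "cimage c" "principal_coeff g c" by (rule elliptic_chart[OF c])
    have sub: "snd c ` (fst c \<inter> W) \<subseteq> cimage c" using snd_mem[OF c] by blast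
    have \<phi>c: "test_function (cimage c) \<phi>" by (rule test_function_mono[OF \<phi> sub])
    let ?D = "chart_div c \<phi>"
    let ?J = "LINT y:cimage c|lborel. vol_density g c y * \<phi> y"
    note t = test_divop[OF \<phi>c]
    have i1: "set_integrable lborel (cimage c) (\<lambda>y. (M - a * m) * ?D y)"
      by (intro set_integrable_mult_test_function t locally_integrable_continuous continuous_on_const)
    have i2: "set_integrable lborel (cimage c) (\<lambda>y. G (x k) (cinv c y) * ?D y)" for k
      by (intro set_integrable_mult_test_function t chart_locally_integrable[OF c Gi])
    have i3: "set_integrable lborel (cimage c) (\<lambda>y. u (cinv c y) * ?D y)"
      by (intro set_integrable_mult_test_function t chart_locally_integrable[OF c W12_integrable[OF u]])
    have i2s: "set_integrable lborel (cimage c) (\<lambda>y. a * (\<Sum>k\<in>I. G (x k) (cinv c y) * ?D y))"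
    proof -
      have "set_integrable lborel (cimage c) (\<lambda>y. \<Sum>k\<in>I. G (x k) (cinv c y) * ?D y)"
        using i2 unfolding set_integrable_def scaleR_sum_right by (intro Bochner_Integration.integrable_sum)
      then show ?thesis by simp
    qed
    have "(LINT y:cimage c|lborel. q (cinv c y) * ?D y) =
        (LINT y:cimage c|lborel. ((M - a * m) * ?D y + a * (\<Sum>k\<in>I. G (x k) (cinv c y) * ?D y)) + u (cinv c y) * ?D y)"
      by (simp only: q_eq sum_distrib_right[symmetric] distrib_right mult.assoc)
    also have "\<dots> = (LINT y:cimage c|lborel. (M - a * m) * ?D y) +
        (LINT y:cimage c|lborel. a * (\<Sum>k\<in>I. G (x k) (cinv c y) * ?D y)) + (LINT y:cimage c|lborel. u (cinv c y) * ?D y)"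
      using set_integral_add(2)[OF set_integral_add(1)[OF i1 i2s] i3] set_integral_add(2)[OF i1 i2s] by simp
    also have "(LINT y:cimage c|lborel. (M - a * m) * ?D y) = 0"
      using integral_divop_test[OF \<phi>c] by simp
    also have "(LINT y:cimage c|lborel. a * (\<Sum>k\<in>I. G (x k) (cinv c y) * ?D y)) =
        a * (\<Sum>k\<in>I. ?J / V - ext_chart c \<phi> (x k))"
      using set_lebesgue_integral_sum[of I lborel "cimage c" "\<lambda>k y. G (x k) (cinv c y) * ?D y"] i2
        green_chart_identity[OF G c \<phi>c] by (simp add: V)
    also have "(LINT y:cimage c|lborel. u (cinv c y) * ?D y) = - ((1 - a / V) * ?J)"
      unfolding V
      by (rule obstacle_equation[OF sol a0 c \<gamma> _ \<phi>]) (use gap in \<open>force simp: r_def p_def\<close>)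
    also have "a * (\<Sum>k\<in>I. ?J / V - ext_chart c \<phi> (x k)) = (a * (real (card I) / V)) * ?J - a * (\<Sum>k\<in>I. ext_chart c \<phi> (x k))"
      by (simp add: sum_subtractf algebra_simps)
    finally show ?thesis unfolding aI by simp
  qed
  have ext_nn: "0 \<le> ext_chart c \<phi> y" if "\<forall>y. 0 \<le> \<phi> y" for c :: "('a, 'n) chart" and \<phi> y
    using that by (simp add: ext_chart_def)
  \<comment> \<open>Near a point that is a pole, or at which \<open>w\<close> lies below
    \<open>M\<close>, the function \<open>w\<close> stays below a fixed number smaller than
    \<open>M\<close>. Only poles require work.\<close>
  have low: "\<exists>W. open W \<and> y \<in> W \<and> (\<exists>b\<in>{..<M}. \<forall>z\<in>W - S. w z \<le> b)" if y: "y \<in> S \<or> w y < M" for y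
  proof (cases "y \<in> S")
    case False
    then obtain b where "w y < b" "b < M" using y dense by blast
    then show ?thesis using nbhd[OF False] by (metis lessThan_iff)
  next
    case yS: True
    have yp: "y \<noteq> p" using yS pS by auto
    show ?thesis
    proof (cases "r y \<le> 0")
      case True
      \<comment> \<open>Contact with the obstacle is possible here and the equation may fail, but
        the bound by \<open>r\<close> already suffices.\<close>
      then have "r y < M / 2" using M0 by simp
      from nbhd_S[OF yS this] show ?thesis using M0 by (auto intro!: bexI[of _ "M / 2"])
    next
      case False
      \<comment> \<open>Now a full neighbourhood of the pole is free of contact, so the equation
        holds across it and shows a point source of mass at least \<open>a\<close>.\<close>
      define \<gamma> where "\<gamma> = r y / 2"
      have \<gamma>: "0 < \<gamma>" using False by (simp add: \<gamma>_def)
      have "\<gamma> < r y" using False by (simp add: \<gamma>_def)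
      then obtain W where W: "open W" "y \<in> W" "\<And>z. z \<in> W \<Longrightarrow> \<gamma> < r z"
        using isCont_eventually_greater[OF rcont[OF yp]] by metis
      obtain c where c: "c \<in> A" "y \<in> fst c" by (rule chart_covers)
      obtain k0 where k0: "k0 \<in> I" "y = x k0" using yS by (auto simp: S_def)
      have gap: "\<gamma> \<le> r z" if "z \<in> W" for z using W(3)[OF that] by (rule less_imp_le)
      have super: "\<forall>\<phi>. test_function (snd c ` (fst c \<inter> W)) \<phi> \<longrightarrow> (\<forall>y. 0 \<le> \<phi> y) \<longrightarrow>
        (LINT y:cimage c|lborel. q (cinv c y) * chart_div c \<phi> y) \<le> - (a * \<phi> (snd c y))"
      proof (intro allI impI)
        fix \<phi> assume \<phi>: "test_function (snd c ` (fst c \<inter> W)) \<phi>" "\<forall>y. 0 \<le> \<phi> y"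
        have "\<phi> (snd c y) = ext_chart c \<phi> (x k0)" using c k0 by (simp add: ext_chart_def)
        also have "\<dots> \<le> (\<Sum>k\<in>I. ext_chart c \<phi> (x k))"
          using k0 finI \<phi>(2) by (intro member_le_sum ext_nn) auto
        finally have "a * \<phi> (snd c y) \<le> a * (\<Sum>k\<in>I. ext_chart c \<phi> (x k))" using a0 by (intro mult_left_mono) auto
        then show "(LINT y:cimage c|lborel. q (cinv c y) * chart_div c \<phi> y) \<le> - (a * \<phi> (snd c y))"
          using equation[OF c(1) \<gamma> gap \<phi>(1)] by simp
      qed
      obtain W' \<delta> where W': "open W'" "y \<in> W'" "0 < \<delta>" "\<forall>z\<in>W' - S. \<delta> \<le> q z"
        by (rule positive_near_source[OF c W(2,1) dim q_int finS q_nn' q_cont' a0 super]) (rule that)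
      have "w z \<le> M - \<delta>" if "z \<in> W' - S" for z using W'(4) that by (force simp: q_def)
      then show ?thesis using W'(1-3) by (intro exI[of _ W']) (auto intro!: bexI[of _ "M - \<delta>"])
    qed
  qed
  \<comment> \<open>The zero set of \<open>q\<close> off the poles. It is shown to be open by
    \<open>high\<close>, and its complement by \<open>low\<close>.\<close>
  define T where "T = {y. y \<notin> S \<and> w y = M}"
  have high: "\<exists>W. open W \<and> y \<in> W \<and> W \<subseteq> T" if y: "y \<in> T" for y
  proof -
    have yS: "y \<notin> S" and wy: "w y = M" using y by (auto simp: T_def)
    have "M / 2 < w y" using M0 wy by simp
    then obtain W0 where W0: "open W0" "y \<in> W0" "\<And>z. z \<in> W0 \<Longrightarrow> M / 2 < w z"
      using isCont_eventually_greater[OF wcont[OF yS]] by metis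
    define W where "W = W0 - S"
    have W: "open W" "y \<in> W" using W0(1,2) yS finite_imp_closed[OF finS] by (auto simp: W_def)
    \<comment> \<open>Where \<open>w\<close> exceeds \<open>M / 2\<close>, so does \<open>r\<close>;
      hence points of \<open>T\<close> are away from the contact set.\<close>
    have gap: "M / 2 \<le> r z" if "z \<in> W" "z \<noteq> p" for z
      using W0(3)[of z] w_le_r[of z] that by (auto simp: W_def)
    obtain c where c: "c \<in> A" "y \<in> fst c" by (rule chart_covers)
    have super: "\<forall>\<phi>. test_function (snd c ` (fst c \<inter> W)) \<phi> \<longrightarrow> (\<forall>y. 0 \<le> \<phi> y) \<longrightarrow>
      (LINT y:cimage c|lborel. q (cinv c y) * chart_div c \<phi> y) \<le> 0"
    proof (intro allI impI)
      fix \<phi> assume \<phi>: "test_function (snd c ` (fst c \<inter> W)) \<phi>" "\<forall>y. 0 \<le> \<phi> y"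
      have "0 \<le> a * (\<Sum>k\<in>I. ext_chart c \<phi> (x k))"
        using a0 \<phi>(2) by (intro mult_nonneg_nonneg sum_nonneg ext_nn) auto
      then show "(LINT y:cimage c|lborel. q (cinv c y) * chart_div c \<phi> y) \<le> 0"
        using equation[OF c(1) _ gap \<phi>(1)] M0 by simp
    qed
    have qy: "q y = 0" using wy by (simp add: q_def)
    obtain W' where W': "open W'" "y \<in> W'" "W' \<inter> S = {}" "\<forall>z\<in>W'. q z = 0"
      by (rule zero_near_zero[OF c W(2,1) dim q_int finS q_nn' q_cont' super yS qy]) (rule that)
    have "z \<in> T" if "z \<in> W'" for z
    proof -
      have "z \<notin> S" using W'(3) that by blast
      moreover have "q z = 0" using W'(4) that by blast
      ultimately show ?thesis by (simp add: T_def q_def)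
    qed
    then show ?thesis using W'(1,2) by blast
  qed
  have "open T" using high by (subst open_subopen) blast
  moreover have "open (- T)"
  proof (subst open_subopen, rule ballI)
    fix y assume "y \<in> - T"
    then have "y \<in> S \<or> w y < M" using wM[of y] unfolding T_def by (cases "y \<in> S") (auto simp: less_le)
    from low[OF this] obtain W b where W: "open W" "y \<in> W" "b \<in> {..<M}" "\<forall>z\<in>W - S. w z \<le> b"
      by (elim exE conjE bexE) (rule that)
    have "z \<notin> T" if "z \<in> W" for z
    proof
      assume z: "z \<in> T"
      then have "w z \<le> b" by (intro bspec[OF W(4)]) (use that in \<open>simp add: T_def\<close>)
      then show False using W(3) z by (simp add: T_def)
    qed
    then show "\<exists>W. open W \<and> y \<in> W \<and> W \<subseteq> - T" using W(1,2) by blast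
  qed
  ultimately have "T = {} \<or> - T = {}" using connectedD[OF connected_UNIV, of T "- T"] by auto
  \<comment> \<open>The existence of a pole, that is N >= 3, enters here.\<close>
  moreover have "- T \<noteq> {}" using Sne by (auto simp: T_def)
  ultimately have T: "T = {}" by blast
  \<comment> \<open>With \<open>T\<close> empty every point falls under \<open>low\<close>, so a
    number below \<open>M\<close> bounds \<open>w\<close> off the poles, against the definition of
    \<open>M\<close> as a supremum.\<close>
  have "\<exists>b\<in>{..<M}. \<forall>y. y \<notin> S \<longrightarrow> w y \<le> b"
  proof (rule cover)
    fix y
    have "y \<notin> T" using T by simp
    then have "y \<in> S \<or> w y < M" using wM[of y] unfolding T_def by (cases "y \<in> S") (auto simp: less_le)
    then show "\<exists>W. open W \<and> y \<in> W \<and> (\<exists>b\<in>{..<M}. \<forall>z\<in>W - S. w z \<le> b)" by (rule low)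
  qed
  then obtain b where b: "b < M" "\<And>y. y \<notin> S \<Longrightarrow> w y \<le> b" by auto
  have "M \<le> b" unfolding M_def using xiS b(2) by (intro cSup_least) auto
  then show False using b(1) by simp
qed

end

theorem theorem1p1:
  fixes A :: "('a::{t2_space, second_countable_topology}, 'n::finite) chart set"
    and g :: "('a, 'n) metric_tensor"
    and vol :: "'a measure"
    and G :: "'a \<Rightarrow> 'a \<Rightarrow> real"
    and x :: "nat \<Rightarrow> 'a"
    and N :: nat
    and V a :: real
  assumes "compact_connected_riemannian_manifold A g"
    and "CARD('n) \<ge> 2"
    and "riemannian_volume A g vol"
    and "greens_function A g vol G"
    and "N \<ge> 2"
    and "minimizing_configuration G N x"
    and "V = measure vol UNIV"
    and "a = V / (real N - 1)"
    and "0 < a" and "a < V"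
  shows "\<forall>i\<in>{1..N}. \<forall>j\<in>{1..N}. i \<noteq> j \<longrightarrow> x i \<notin> harmonic_ball A g vol G (x j) a"
proof (intro ballI impI)
  fix i j assume ij: "i \<in> {1..N}" "j \<in> {1..N}" "i \<noteq> j"
  \<comment> \<open>Positivity of \<open>a\<close> is passed on to \<open>V\<close>, which gives the
    positive \<open>measure\<close> that the locale asks for.\<close>
  have "0 < V" using assms(5,8,9) by (simp add: zero_less_divide_iff)
  then interpret riemannian A g vol using assms(1,3,7) by (intro riemannian.intro) simp_all
  \<comment> \<open>For two points \<open>a\<close> would equal \<open>V\<close>.\<close>
  have "N \<noteq> 2" using assms(8,10) by auto
  then have "3 \<le> N" using assms(5) by simp
  then show "x i \<notin> harmonic_ball A g vol G (x j) a"
    by (intro minimizer_outside_harmonic_ball[OF assms(2,4,6) _ assms(7,8)] ij)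
qed

end
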